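(* Let $s<t$ be real numbers such that the open interval $(s,t)$ is contained in $$\mathcal I = \left[\frac{1}{\zeta(2)},\frac23\right]\cup\left[\frac{9}{8\zeta(2)},\frac34\right].$$ Then there is a set of primes of positive lower density such that every prime $p$ in the set has the following property: if $A,B$ are independent and uniformly random in $\mathfrak{sl}_2(\mathbf{F}_p)$, $\nu$ is the uniform distribution on $\mathrm{Lin}\{[A,B]\}\setminus\{0\}$, and $\nu_{2k}$ are the limiting distributions of the random Lie bracket associated with $A,B$, then $$\mathbf{P}_{A,B}(\nu_{2k}=\nu)\in(s,t)\qquad\text{for all integers } k\ge 0.$$
   Context: $\zeta$ is the Riemann zeta function, so $\zeta(2)=\pi^2/6$. The lower density of a set $Z$ of primes is $\liminf_{N\to\infty}|Z\cap\mathbf{P}_{\le N}|/|\mathbf{P}_{\le N}|$, where $\mathbf{P}_{\le N}$ is the set of primes at most $N$. Throughout $p$ is an odd prime. $\mathfrak{sl}_2(\mathbf{F}_p)$ is the Lie algebra of trace-zero $2\times2$ matrices over $\mathbf{F}_p$ with $[X,Y]=XY-YX$, and $\mathrm{Lin}\{v\}$ is the $\mathbf{F}_p$-line spanned by $v$. Random Lie bracket associated with $A,B$: $X_0=[A,B]$, $X_k=[Z_k,X_{k-1}]$, where $Z_1,Z_2,\dots$ are independent, each equal to $A$ or to $B$ with probability $1/2$. Its limiting distribution $\nu_{2k}$ after $2k$ steps is the following. Let $\alpha=2\,\mathrm{tr}(AB)$, $\beta=2\,\mathrm{tr}(A^2)$, $\gamma=2\,\mathrm{tr}(B^2)$. Suppose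 $\alpha\beta\gamma\neq0$ and $[A,B]\ne0$. Put $n=p-1$, fix a group isomorphism $\log:\mathbf{F}_p^\ast\to\mathbf{Z}_n=\mathbf{Z}/n\mathbf{Z}$, and let $\alpha'=\log\alpha$, $\beta'=\log\beta$, $\gamma'=\log\gamma$. For $j\in\mathbf{Z}_n$ let $\chi_j(x)=e^{2\pi ijx/n}$ and $\lambda_j=\frac12\chi_j(-\alpha')+\frac14\chi_j(-\beta')+\frac14\chi_j(-\gamma')$, and let $\phi_k=\frac1n\sum_{j:|\lambda_j|=1}\lambda_j^k\chi_j$, a probability distribution on $\mathbf{Z}_n$. Then $\nu_{2k}(c\,[A,B])=\phi_k(\log c)$ for $c\in\mathbf{F}_p^\ast$. If $\alpha\beta\gamma=0$ or $[A,B]=0$, the event $\nu_{2k}=\nu$ is regarded as not occurring. *)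

theory Defs
  imports
    "HOL-Probability.Probability"
    "HOL-Algebra.Elementary_Groups"
    "HOL-Number_Theory.Number_Theory"
begin

(* F_p is represented by the residues {0..<p}, as in residue_ring, and
   2x2 matrices over F_p by integer matrices with entries in {0..<p}. *)

type_synonym mat2 = "int ^ 2 ^ 2"

definition sl2 :: "nat \<Rightarrow> mat2 set" where
  "sl2 p = {X. (\<forall>i j. X $ i $ j \<in> {0..<int p}) \<and> [trace X = 0] (mod int p)}"

definition scale :: "nat \<Rightarrow> int \<Rightarrow> mat2 \<Rightarrow> mat2" where
  "scale p c X = map_matrix (\<lambda>x. (c * x) mod int p) X"

definition bracket :: "nat \<Rightarrow> mat2 \<Rightarrow> mat2 \<Rightarrow> mat2" where
  "bracket p X Y = map_matrix (\<lambda>x. x mod int p) (X ** Y - Y ** X)"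

definition line :: "nat \<Rightarrow> mat2 \<Rightarrow> mat2 set" where
  "line p V = (\<lambda>c. scale p c V) ` {0..<int p}"

definition mult_group :: "nat \<Rightarrow> int monoid" where
  "mult_group p = units_of (residue_ring (int p))"

(* lg is a discrete logarithm: a group isomorphism from F_p^* to Z/(p-1)Z, the latter on
   the representatives {0..<p-1}. *)

definition is_log :: "nat \<Rightarrow> (int \<Rightarrow> int) \<Rightarrow> bool" where
  "is_log p lg \<longleftrightarrow> lg \<in> iso (mult_group p) (integer_mod_group (p - 1))"

definition alpha :: "nat \<Rightarrow> mat2 \<Rightarrow> mat2 \<Rightarrow> int" where
  "alpha p A B = (2 * trace (A ** B)) mod int p"

definition beta :: "nat \<Rightarrow> mat2 \<Rightarrow> mat2 \<Rightarrow> int" where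
  "beta p A B = (2 * trace (A ** A)) mod int p"

definition gamma :: "nat \<Rightarrow> mat2 \<Rightarrow> mat2 \<Rightarrow> int" where
  "gamma p A B = (2 * trace (B ** B)) mod int p"

definition chi :: "nat \<Rightarrow> int \<Rightarrow> int \<Rightarrow> complex" where
  "chi n j x = exp (2 * of_real pi * \<i> * of_int j * of_int x / of_nat n)"

definition lam :: "nat \<Rightarrow> (int \<Rightarrow> int) \<Rightarrow> mat2 \<Rightarrow> mat2 \<Rightarrow> int \<Rightarrow> complex" where
  "lam p lg A B j =
     1/2 * chi (p - 1) j (- lg (alpha p A B))
     + 1/4 * chi (p - 1) j (- lg (beta p A B))
     + 1/4 * chi (p - 1) j (- lg (gamma p A B))"

definition phi :: "nat \<Rightarrow> (int \<Rightarrow> int) \<Rightarrow> mat2 \<Rightarrow> mat2 \<Rightarrow> nat \<Rightarrow> int \<Rightarrow> complex" where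
  "phi p lg A B k x =
     1 / of_nat (p - 1) *
     (\<Sum>j | j \<in> {0..<int (p - 1)} \<and> cmod (lam p lg A B j) = 1. lam p lg A B j ^ k * chi (p - 1) j x)"

(* The mass function of the limiting distribution nu_{2k} of the random Lie bracket after 2k
   steps. If [A,B] is nonzero, the sum has the single term phi (lg c) when X = c [A,B] with c
   in F_p^*, and is empty for all other X. *)

definition nu_even ::
    "nat \<Rightarrow> (int \<Rightarrow> int) \<Rightarrow> mat2 \<Rightarrow> mat2 \<Rightarrow> nat \<Rightarrow> mat2 \<Rightarrow> complex" where
  "nu_even p lg A B k X =
     (\<Sum>c | c \<in> carrier (mult_group p) \<and> scale p c (bracket p A B) = X. phi p lg A B k (lg c))"

definition nu :: "nat \<Rightarrow> mat2 \<Rightarrow> mat2 \<Rightarrow> mat2 pmf" where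
  "nu p A B = pmf_of_set (line p (bracket p A B) - {0})"

(* The event nu_{2k} = nu; it does not occur if alpha beta gamma = 0 or [A,B] = 0. *)

definition limit_uniform :: "nat \<Rightarrow> (int \<Rightarrow> int) \<Rightarrow> nat \<Rightarrow> mat2 \<Rightarrow> mat2 \<Rightarrow> bool" where
  "limit_uniform p lg k A B \<longleftrightarrow>
     \<not> [alpha p A B * beta p A B * gamma p A B = 0] (mod int p) \<and>
     bracket p A B \<noteq> 0 \<and>
     (\<forall>X. nu_even p lg A B k X = complex_of_real (pmf (nu p A B) X))"

definition prob_limit_uniform :: "nat \<Rightarrow> (int \<Rightarrow> int) \<Rightarrow> nat \<Rightarrow> real" where
  "prob_limit_uniform p lg k =
     measure_pmf.prob (pmf_of_set (sl2 p \<times> sl2 p)) {(A, B). limit_uniform p lg k A B}"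

definition primes_upto :: "nat \<Rightarrow> nat set" where
  "primes_upto N = {p. prime p \<and> p \<le> N}"

definition lower_density :: "nat set \<Rightarrow> ereal" where
  "lower_density Z =
     liminf (\<lambda>N. ereal (real (card (Z \<inter> primes_upto N)) / real (card (primes_upto N))))"

(* The Dirichlet series, which is the Riemann zeta function for s > 1 only. *)

definition zeta :: "real \<Rightarrow> real" where
  "zeta s = (\<Sum>n. 1 / real (Suc n) powr s)"

lemma zeta_2: "zeta 2 = pi\<^sup>2 / 6"
  using sums_unique[OF inverse_squares_sums] by (simp add: zeta_def add.commute)

lemma ex_is_log:
  assumes "prime p" "odd p"
  shows "\<exists>lg. is_log p lg"
proof -
  have p2: "p > 2" using assms prime_gt_1_nat[of p] by (cases "p = 2") auto
  obtain g where g: "residue_primroot p g"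
    using residue_primroot_odd_prime_power_exists[OF assms] by (metis power_one_right zero_less_one)
  interpret R: residues_prime p "residue_ring p"
    using assms by (simp_all add: residues_prime_def)
  define h where "h = (\<lambda>x::int. int (g ^ nat x mod p))"
  have ord: "ord p g = p - 1" and cop: "coprime p g"
    using g assms by (simp_all add: residue_primroot_def totient_prime)
  have tot: "totient p = p - 1" using assms totient_prime by blast
  have bij: "bij_betw (\<lambda>i. g ^ i mod p) {..<p - 1} (totatives p)"
    using residue_primroot_is_generator[OF _ g] p2 tot by simp
  have tots: "totatives p = {0<..<p}" using assms totatives_prime by blast
  have car: "carrier (mult_group p) = {0<..<int p}"
    using assms by (auto simp: mult_group_def units_of_carrier R.res_prime_units_eq)
  have carn: "carrier (integer_mod_group (p - 1)) = {0..<int (p - 1)}"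
    using p2 by (simp add: carrier_integer_mod_group)
  have b1: "bij_betw nat {0..<int (p - 1)} {..<p - 1}"
    by (rule bij_betwI[where g = int]) auto
  have b2: "bij_betw int {0<..<p} {0<..<int p}"
    by (rule bij_betwI[where g = nat]) auto
  have hb: "bij_betw h {0..<int (p - 1)} {0<..<int p}"
    using bij_betw_trans[OF bij_betw_trans[OF b1 bij] b2[folded tots]]
    by (simp add: h_def o_def)
  have "h \<in> iso (integer_mod_group (p - 1)) (mult_group p)"
  proof (rule isoI)
    show "bij_betw h (carrier (integer_mod_group (p - 1))) (carrier (mult_group p))"
      using hb by (simp only: car carn)
    show "h \<in> hom (integer_mod_group (p - 1)) (mult_group p)"
    proof (rule homI)
      fix x assume "x \<in> carrier (integer_mod_group (p - 1))"
      then show "h x \<in> carrier (mult_group p)"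
        using hb unfolding car carn bij_betw_def by blast
    next
      fix x y assume "x \<in> carrier (integer_mod_group (p - 1))"
        "y \<in> carrier (integer_mod_group (p - 1))"
      then have xy: "0 \<le> x" "0 \<le> y" unfolding carn by auto
      have "nat ((x + y) mod int (p - 1)) = (nat x + nat y) mod (p - 1)"
        using xy by (simp add: nat_mod_distrib nat_add_distrib)
      moreover have "[g ^ ((nat x + nat y) mod (p - 1)) = g ^ (nat x + nat y)] (mod p)"
        using cop ord by (subst order_divides_expdiff) (simp_all add: cong_def)
      ultimately have "h ((x + y) mod int (p - 1)) = int ((g ^ nat x * g ^ nat y) mod p)"
        by (simp add: h_def cong_def power_add)
      also have "\<dots> = (h x * h y) mod int p"
        by (simp add: h_def zmod_int mod_mult_eq)
      finally show "h (x \<otimes>\<^bsub>integer_mod_group (p - 1)\<^esub> y) = h x \<otimes>\<^bsub>mult_group p\<^esub> h y"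
        by (simp add: mult_group_def units_of_mult residue_ring_def)
    qed
  qed
  then show ?thesis
    using group.iso_set_sym[OF group_integer_mod_group] unfolding is_log_def by blast
qed

end

theory Submission
  imports Defs "HOL-Computational_Algebra.Squarefree" "HOL-Real_Asymp.Real_Asymp"
begin

text \<open>
  Put \<open>n = p - 1\<close>. The probability in question is, up to \<open>O(1/p)\<close>, the product of
  \<open>1 - 1/q\<^sup>2\<close> over the primes \<open>q\<close> dividing \<open>n\<close>. By Fourier inversion on \<open>\<int>/n\<close>, the
  limiting distribution is uniform exactly when no \<open>j \<noteq> 0\<close> satisfies \<open>\<bar>\<lambda>\<^sub>j\<bar> = 1\<close>. By strict
  convexity of the disc that modulus is 1 only if the three characters in \<open>\<lambda>\<^sub>j\<close> agree, so
  uniformity means that \<open>\<alpha>' - \<beta>'\<close> and \<open>\<alpha>' - \<gamma>'\<close> generate \<open>\<int>/n\<close>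
  (\<open>limit_uniform_iff\<close>). A random pair of residues modulo \<open>n\<close> generates with probability
  \<open>\<Prod>(1 - 1/q\<^sup>2)\<close> (\<open>card_generates\<close>), and the pair of ratios \<open>\<beta>/\<alpha>\<close>, \<open>\<gamma>/\<alpha>\<close> of a random
  pair of matrices is exactly equidistributed once \<open>\<alpha> \<noteq> 0\<close> and one entry of \<open>A\<close> is nonzero:
  a linear change of variables turns the count into that of the points of the conics
  \<open>x\<^sup>2 = u f(y)\<close>, where \<open>f\<close> is a quadratic polynomial, and these are easy to count together
  because \<open>u\<close> varies as well (\<open>sum_gram_invariants\<close>).

  It remains to find primes \<open>p\<close> for which this product lies in a given interval. The factors
  with large \<open>q\<close> hardly matter, whatever \<open>p\<close> is, so only the set of small primes dividing
  \<open>p - 1\<close> has to be prescribed, and that is a congruence condition on \<open>p\<close>. The factor at 2 is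
  always present; with or without the factor at 3 the product starts at \<open>2/3\<close> or \<open>3/4\<close>, and the
  full product over all primes is \<open>1/\<zeta>(2)\<close>. Each factor \<open>1 - 1/q\<^sup>2\<close> with \<open>q \<ge> 5\<close> is at least the
  product of all the later ones. Therefore a greedy choice of primes \<open>\<ge> 5\<close> approximates every
  number between the two ends (\<open>sieve_factor_dense\<close>); the gap between the two intervals is there
  because the inequality fails for \<open>q = 3\<close>.

  The primes in a residue class \<open>a\<close> modulo \<open>M\<close> have positive lower density by an elementary
  argument. Mertens' theorem for the class, \<open>\<Sum> \<Lambda>(m)/m = c ln N + O(1)\<close> over the \<open>m \<le> N\<close> with
  \<open>m \<equiv> a\<close>, puts a total von Mangoldt weight of at least \<open>N\<close> into the class between \<open>N\<close> and
  \<open>K N\<close> for a suitable constant \<open>K\<close>, and Chebyshev's upper bound for the number of all primes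
  does the rest. Mertens' theorem follows from \<open>L(1,\<chi>) \<noteq> 0\<close> for nonprincipal \<open>\<chi>\<close>; for
  nonreal \<open>\<chi>\<close> this holds because zeros come in conjugate pairs, whereas two of them would make
  \<open>\<Sum> \<Lambda>(m)/m\<close> over \<open>m \<equiv> 1\<close> negative (\<open>L_one_nonzero\<close>), and for real \<open>\<chi>\<close> by comparison with a
  Lambert series (\<open>L_one_nonzero_real\<close>). The moduli that occur are squarefree, so the characters
  needed come from discrete logarithms modulo primes.
\<close>

section \<open>Chebyshev's estimates\<close>

text \<open>The finite form of multiplying two Dirichlet series: a sum over factorizations
  \<open>n = d m\<close> with \<open>n \<le> N\<close> can be summed over \<open>d\<close> first.\<close>

lemma sum_divisors_swap:
  fixes f :: "nat \<Rightarrow> nat \<Rightarrow> 'a::comm_monoid_add"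
  shows "(\<Sum>n\<in>{1..N}. \<Sum>d | d dvd n. f d (n div d)) = (\<Sum>d\<in>{1..N}. \<Sum>m\<in>{1..N div d}. f d m)"
proof -
  have "(\<Sum>n\<in>{1..N}. \<Sum>d | d dvd n. f d (n div d)) = (\<Sum>(n,d)\<in>(SIGMA n:{1..N}. {d. d dvd n}). f d (n div d))"
    by (subst sum.Sigma) auto
  also have "\<dots> = (\<Sum>(d,m)\<in>(SIGMA d:{1..N}. {1..N div d}). f d m)"
  proof (rule sum.reindex_bij_witness[where j="\<lambda>(n,d). (d, n div d)" and i="\<lambda>(d,m). (d*m, d)"])
    fix a assume "a \<in> (SIGMA n:{1..N}. {d. d dvd n})"
    then obtain n d where a: "a = (n,d)" "1 \<le> n" "n \<le> N" "d dvd n" by auto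
    then obtain k where k: "n = d * k" by auto
    with a have "d > 0" "k > 0" by (auto intro!: Nat.gr0I)
    moreover have "d \<le> N" using a dvd_imp_le[of d n] by auto
    moreover have "k \<le> N div d" using a k \<open>d > 0\<close> by (metis div_le_mono nonzero_mult_div_cancel_left less_not_refl2)
    ultimately show "(case (case a of (n,d) \<Rightarrow> (d, n div d)) of (d,m) \<Rightarrow> (d*m,d)) = a"
      "(case a of (n,d) \<Rightarrow> (d, n div d)) \<in> (SIGMA d:{1..N}. {1..N div d})"
      "(case (case a of (n,d) \<Rightarrow> (d, n div d)) of (d,m) \<Rightarrow> f d m) = (case a of (n,d) \<Rightarrow> f d (n div d))"
      using a k by auto
  next
    fix b assume "b \<in> (SIGMA d:{1..N}. {1..N div d})"
    then obtain d m where b: "b = (d,m)" "1 \<le> d" "d \<le> N" "1 \<le> m" "m \<le> N div d" by auto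
    have "d * m \<le> N" using b by (metis mult.commute less_eq_div_iff_mult_less_eq less_eq_Suc_le One_nat_def)
    thus "(case b of (d,m) \<Rightarrow> (d*m,d)) \<in> (SIGMA n:{1..N}. {d. d dvd n})"
     "(case (case b of (d,m) \<Rightarrow> (d*m,d)) of (n,d) \<Rightarrow> (d, n div d)) = b"
      using b by (auto simp: Suc_le_eq)
  qed
  also have "\<dots> = (\<Sum>d\<in>{1..N}. \<Sum>m\<in>{1..N div d}. f d m)"
    by (subst sum.Sigma) auto
  finally show ?thesis .
qed

lemma ln_fact_mangoldt:
  "ln (fact N) = (\<Sum>d\<in>{1..N}. mangoldt d * real (N div d))"
proof -
  have "ln (fact N :: real) = (\<Sum>n\<in>{1..N}. ln (real n))"
  proof (induction N)
    case (Suc N)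
    thus ?case by (simp add: ln_mult)
  qed simp
  also have "\<dots> = (\<Sum>n\<in>{1..N}. \<Sum>d | d dvd n. mangoldt d)"
    by (intro sum.cong refl) (subst mangoldt_sum, auto)
  also have "\<dots> = (\<Sum>d\<in>{1..N}. \<Sum>m\<in>{1..N div d}. mangoldt d)"
    by (rule sum_divisors_swap)
  finally show ?thesis by (simp add: mult.commute)
qed

definition chebyshev_psi :: "nat \<Rightarrow> real" where
  "chebyshev_psi N = (\<Sum>n\<in>{1..N}. mangoldt n)"

lemma chebyshev_psi_mono: "m \<le> n \<Longrightarrow> chebyshev_psi m \<le> chebyshev_psi n"
  unfolding chebyshev_psi_def by (rule sum_mono2) (auto simp: mangoldt_nonneg)

lemma ln_central_binomial_mangoldt:
  "ln (real ((2*n) choose n)) =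
     (\<Sum>d\<in>{1..2*n}. mangoldt d * (real (2*n div d) - 2 * real (n div d)))"
proof -
  have "ln (real ((2*n) choose n)) = ln (fact (2*n)) - 2 * ln (fact n)"
    by (subst binomial_fact) (auto simp: ln_div ln_mult)
  moreover have "ln (fact n) = (\<Sum>d\<in>{1..2*n}. mangoldt d * real (n div d))"
    unfolding ln_fact_mangoldt by (rule sum.mono_neutral_left) auto
  ultimately show ?thesis
    unfolding ln_fact_mangoldt[of "2*n"]
    by (simp add: sum_distrib_left sum_subtractf right_diff_distrib mult.left_commute)
qed

text \<open>So every coefficient in \<open>ln_central_binomial_mangoldt\<close> is 0 or 1.\<close>

lemma double_div_cases: "(2*n) div d = 2 * (n div d) \<or> (2*n) div d = 2 * (n div d) + (1::nat)"
proof (cases "d = 0")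
  case False
  define q r where "q = n div d" "r = n mod d"
  have n: "n = q * d + r" by (simp add: q_r_def)
  have r: "r < d" using False by (simp add: q_r_def)
  have "2 * n = 2 * r + (2 * q) * d" using n by (simp add: algebra_simps)
  hence e: "(2*n) div d = 2*q + (2*r) div d" using False by simp
  have "2*r div d < 2" using r False by (simp add: div_less_iff_less_mult)
  hence "2*r div d = 0 \<or> 2*r div d = 1" by linarith
  with e show ?thesis by (auto simp: q_r_def)
qed auto

lemma chebyshev_psi_ge_central_binomial: "ln (real ((2*n) choose n)) \<le> chebyshev_psi (2*n)"
  unfolding ln_central_binomial_mangoldt chebyshev_psi_def
proof (rule sum_mono)
  fix d show "mangoldt d * (real (2*n div d) - 2 * real (n div d)) \<le> (mangoldt d :: real)"
    using double_div_cases[of n d] mangoldt_nonneg[of d]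
    by (auto)
qed

text \<open>For \<open>n < d \<le> 2n\<close> the coefficient of \<open>\<Lambda>(d)\<close> in the logarithm of the central
  binomial coefficient is 1.\<close>

lemma chebyshev_psi_doubling: "chebyshev_psi (2*n) - chebyshev_psi n \<le> ln (real ((2*n) choose n))"
proof -
  have "chebyshev_psi (2*n) = chebyshev_psi n + (\<Sum>d\<in>{n+1..2*n}. mangoldt d)"
    unfolding chebyshev_psi_def by (subst sum.union_disjoint[symmetric]) (auto intro!: sum.cong)
  also have "(\<Sum>d\<in>{n+1..2*n}. mangoldt d) = (\<Sum>d\<in>{n+1..2*n}. mangoldt d * (real (2*n div d) - 2 * real (n div d)))"
  proof (rule sum.cong[OF refl])
    fix d assume d: "d \<in> {n+1..2*n}"
    have "2*n div d = 1" using d by (intro div_nat_eqI) auto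
    with d show "mangoldt d = mangoldt d * (real (2*n div d) - 2 * real (n div d))" by simp
  qed
  also have "\<dots> \<le> (\<Sum>d\<in>{1..2*n}. mangoldt d * (real (2*n div d) - 2 * real (n div d)))"
  proof (rule sum_mono2)
    fix d show "0 \<le> mangoldt d * (real (2*n div d) - 2 * real (n div d))"
      using double_div_cases[of n d] mangoldt_nonneg[of d] by auto
  qed auto
  finally show ?thesis unfolding ln_central_binomial_mangoldt by simp
qed

text \<open>The central binomial coefficient is at most \<open>4\<^sup>n\<close>, so doubling the argument adds at
  most \<open>2 n\<close>; halving repeatedly gives a geometric sum.\<close>

lemma chebyshev_psi_le: "chebyshev_psi N \<le> 4 * real N"
proof (induction N rule: less_induct)
  case (less N)
  show ?case
  proof (cases "N < 2")
    case True
    then have "N = 0 \<or> N = 1" by auto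
    thus ?thesis by (auto simp: chebyshev_psi_def)
  next
    case False
    define n where "n = (N+1) div 2"
    have n: "n < N" "N \<le> 2*n" "3 * n \<le> 2 * N" using False by (auto simp: n_def)
    have "(2*n) choose n \<le> 4 ^ n"
      using binomial_le_pow2[of "2*n" n] by (simp add: power_mult)
    hence "real ((2*n) choose n) \<le> 4 ^ n" by (metis of_nat_le_iff of_nat_numeral of_nat_power)
    hence "ln (real ((2*n) choose n)) \<le> ln (4 ^ n)" by (subst ln_le_cancel_iff) auto
    also have "\<dots> = real n * (2 * ln 2)"
      using ln_realpow[of 2 2] by (simp add: ln_realpow)
    also have "\<dots> \<le> real n * (2 * 1)" using ln_2_less_1 by (intro mult_left_mono) auto
    finally have "chebyshev_psi (2*n) \<le> chebyshev_psi n + 2 * n"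
      using chebyshev_psi_doubling[of n] by simp
    moreover have "chebyshev_psi N \<le> chebyshev_psi (2*n)" using n by (intro chebyshev_psi_mono)
    moreover have "chebyshev_psi n \<le> 4 * n" using less n by simp
    ultimately show ?thesis using n by linarith
  qed
qed

lemma prime_aprimedivisor_primepow: "primepow (n::nat) \<Longrightarrow> prime (aprimedivisor n)"
  by (auto simp: primepow_def aprimedivisor_prime_power)

text \<open>The powers \<open>q\<^sup>k \<le> N\<close> of one prime \<open>q\<close> number at most \<open>ln N / ln q\<close> and weigh \<open>ln q\<close> each, so
  every base prime contributes at most \<open>ln N\<close>.\<close>

lemma sum_mangoldt_le_card_mult_ln:
  assumes T: "T \<subseteq> {1..N}" "\<And>n. n \<in> T \<Longrightarrow> primepow n"
  shows "(\<Sum>n\<in>T. mangoldt n) \<le> real (card (aprimedivisor ` T)) * ln (real N)"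
proof -
  have fin: "finite T" using T finite_subset by blast
  have "(\<Sum>n\<in>T. mangoldt n) = (\<Sum>q\<in>aprimedivisor ` T. \<Sum>n | n \<in> T \<and> aprimedivisor n = q. mangoldt n :: real)"
    using fin by (subst sum.group) auto
  also have "\<dots> \<le> (\<Sum>q\<in>aprimedivisor ` T. ln (real N))"
  proof (rule sum_mono)
    fix q assume "q \<in> aprimedivisor ` T"
    then obtain m where m: "m \<in> T" "q = aprimedivisor m" by auto
    have pm: "primepow m" using T m by auto
    hence q: "prime q" using m by (simp add: prime_aprimedivisor_primepow)
    hence q1: "1 < q" by (rule prime_gt_1_nat)
    define K where "K = nat \<lfloor>ln (real N) / ln (real q)\<rfloor>"
    \<comment> \<open>\<open>K\<close> is the largest exponent \<open>k\<close> with \<open>q\<^sup>k \<le> N\<close>.\<close>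
    have "{n \<in> T. aprimedivisor n = q} \<subseteq> (\<lambda>k. q ^ k) ` {1..K}"
    proof
      fix n assume n: "n \<in> {n \<in> T. aprimedivisor n = q}"
      hence "primepow n" using T by auto
      then obtain r k where rk: "prime r" "k > 0" "n = r ^ k" by (auto simp: primepow_def)
      hence "r = q" using n by (simp add: aprimedivisor_prime_power)
      with rk have nk: "n = q ^ k" by simp
      have "n \<le> N" using n T by auto
      hence "real q ^ k \<le> real N" using nk by (metis of_nat_le_iff of_nat_power)
      hence "ln (real q ^ k) \<le> ln (real N)" using q1 by (subst ln_le_cancel_iff) (use n T in auto)
      hence "real k * ln (real q) \<le> ln (real N)" using q1 by (simp add: ln_realpow)
      hence "real k \<le> ln (real N) / ln (real q)" using q1 by (simp add: field_simps)
      hence "k \<le> K" unfolding K_def by (simp add: le_nat_iff le_floor_iff)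
      thus "n \<in> (\<lambda>k. q ^ k) ` {1..K}" using nk rk by auto
    qed
    hence "card {n \<in> T. aprimedivisor n = q} \<le> card {1..K}"
      by (rule surj_card_le[rotated]) simp
    hence "card {n \<in> T. aprimedivisor n = q} \<le> K" by simp
    moreover have "(\<Sum>n | n \<in> T \<and> aprimedivisor n = q. mangoldt n :: real) = real (card {n \<in> T. aprimedivisor n = q}) * ln (real q)"
      using T by (simp add: mangoldt_def)
    moreover have "real K * ln (real q) \<le> ln (real N)"
    proof -
      have "N \<ge> 1" using m T by auto
      hence "real K \<le> ln (real N) / ln (real q)" unfolding K_def using q1 by (simp)
      thus ?thesis using q1 by (simp add: field_simps)
    qed
    moreover have "real (card {n \<in> T. aprimedivisor n = q}) * ln (real q) \<le> real K * ln (real q)"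
      using calculation(1) q1 by (intro mult_right_mono) auto
    ultimately show "(\<Sum>n | n \<in> T \<and> aprimedivisor n = q. mangoldt n) \<le> ln (real N)"
      by linarith
  qed
  finally show ?thesis by simp
qed

lemma finite_primes_upto [simp]: "finite (primes_upto N)"
  unfolding primes_upto_def by (rule finite_subset[of _ "{..N}"]) auto

lemma chebyshev_psi_le_card_primes: "chebyshev_psi N \<le> real (card (primes_upto N)) * ln (real N)"
proof (cases "N = 0")
  case False
  let ?T = "{n\<in>{1..N}. primepow n}"
  have "chebyshev_psi N = (\<Sum>n\<in>?T. mangoldt n)" unfolding chebyshev_psi_def
    by (rule sum.mono_neutral_right) (auto simp: mangoldt_def)
  also have "\<dots> \<le> real (card (aprimedivisor ` ?T)) * ln (real N)"
    by (rule sum_mangoldt_le_card_mult_ln) auto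
  also have "\<dots> \<le> real (card (primes_upto N)) * ln (real N)"
  proof (intro mult_right_mono of_nat_mono card_mono)
    show "aprimedivisor ` ?T \<subseteq> primes_upto N"
      by (auto simp: primes_upto_def prime_aprimedivisor_primepow intro!: order_trans[OF aprimedivisor_le_nat] primepow_gt_Suc_0)
  qed (use False in auto)
  finally show ?thesis .
qed (auto simp: chebyshev_psi_def)

text \<open>A proper prime power up to \<open>N\<close> has its base at most the square root of \<open>N\<close>.\<close>

lemma sum_mangoldt_nonprime_le:
  "(\<Sum>n | n \<in> {1..N} \<and> \<not> prime n. mangoldt n) \<le> sqrt (real N) * ln (real N)"
proof (cases "N = 0")
  case False
  let ?T = "{n\<in>{1..N}. primepow n \<and> \<not> prime n}"
  have "(\<Sum>n | n \<in> {1..N} \<and> \<not> prime n. mangoldt n) = (\<Sum>n\<in>?T. mangoldt n :: real)"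
    by (rule sum.mono_neutral_right) (auto simp: mangoldt_def)
  also have "\<dots> \<le> real (card (aprimedivisor ` ?T)) * ln (real N)"
    by (rule sum_mangoldt_le_card_mult_ln) auto
  also have "\<dots> \<le> sqrt (real N) * ln (real N)"
  proof (intro mult_right_mono)
    have "aprimedivisor ` ?T \<subseteq> {1..floor_sqrt N}"
    proof
      fix q assume "q \<in> aprimedivisor ` ?T"
      then obtain n where n: "n \<le> N" "primepow n" "\<not> prime n" "q = aprimedivisor n" by auto
      then obtain r k where rk: "prime r" "k > 0" "n = r ^ k" by (auto simp: primepow_def)
      hence "r = q" using n by (simp add: aprimedivisor_prime_power)
      have "k \<noteq> 1" using rk n(3) by auto
      with rk(2) have "k \<ge> 2" by linarith
      moreover have "1 \<le> q" using rk(1) \<open>r = q\<close> prime_ge_1_nat by blast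
      ultimately have "q ^ 2 \<le> q ^ k" by (rule power_increasing)
      hence "q ^ 2 \<le> n" using rk(3) \<open>r = q\<close> by simp
      hence "q \<le> floor_sqrt N" using n(1) by (simp add: le_floor_sqrt_iff)
      thus "q \<in> {1..floor_sqrt N}" using rk(1) \<open>r = q\<close> by (auto simp: Suc_le_eq prime_gt_0_nat)
    qed
    hence "card (aprimedivisor ` ?T) \<le> floor_sqrt N"
      using card_mono[of "{1..floor_sqrt N}"] by simp
    also have "real (floor_sqrt N) \<le> sqrt (real N)"
      by (rule real_le_rsqrt) (metis floor_sqrt_power2_le of_nat_le_iff of_nat_power)
    finally show "real (card (aprimedivisor ` ?T)) \<le> sqrt (real N)" by simp
  qed (use False in auto)
  finally show ?thesis .
qed auto

lemma card_primes_upto_lower: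
  assumes "n \<ge> 1"
  shows "real n * ln 4 \<le> (real (card (primes_upto (2*n))) + 1) * ln (2 * real n)"
proof -
  have "4 ^ n \<le> 2 * real n * real ((2*n) choose n)"
    using assms central_binomial_lower_bound[of n] by (simp add: field_simps)
  hence "ln (4 ^ n) \<le> ln (2 * real n * real ((2*n) choose n))"
    by (subst ln_le_cancel_iff) (use assms in auto)
  also have "\<dots> = ln (2 * real n) + ln (real ((2*n) choose n))"
    using assms by (subst ln_mult) auto
  also have "\<dots> \<le> ln (2 * real n) + real (card (primes_upto (2*n))) * ln (2 * real n)"
    using chebyshev_psi_ge_central_binomial[of n] chebyshev_psi_le_card_primes[of "2*n"] by simp
  finally show ?thesis by (simp add: algebra_simps ln_realpow)
qed

text \<open>Primes above the square root of \<open>N\<close> have logarithm at least \<open>ln N / 2\<close>, so Chebyshev's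
  bound controls their number; the remaining ones are no more than the square root.\<close>

lemma card_primes_upto_upper:
  assumes "N \<ge> 2"
  shows "real (card (primes_upto N)) * ln (real N) \<le> 10 * real N"
proof -
  let ?s = "floor_sqrt N"
  have s: "real ?s \<le> sqrt (real N)"
    by (rule real_le_rsqrt) (metis floor_sqrt_power2_le of_nat_le_iff of_nat_power)
  have "primes_upto N = primes_upto ?s \<union> {p \<in> primes_upto N. p > ?s}"
    using floor_sqrt_le[of N] by (auto simp: primes_upto_def)
  hence "card (primes_upto N) \<le> card (primes_upto ?s) + card {p \<in> primes_upto N. p > ?s}"
    using card_Un_le by metis
  moreover have "card (primes_upto ?s) \<le> ?s"
    using card_mono[of "{1..?s}" "primes_upto ?s"] by (force simp: primes_upto_def Suc_le_eq prime_gt_0_nat)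
  ultimately have c: "real (card (primes_upto N)) \<le> sqrt (real N) + real (card {p \<in> primes_upto N. p > ?s})"
    using s by linarith
  have "real (card {p \<in> primes_upto N. p > ?s}) * (ln (real N) / 2) = (\<Sum>p \<in> {p \<in> primes_upto N. p > ?s}. ln (real N) / 2)"
    by simp
  also have "\<dots> \<le> (\<Sum>p \<in> {p \<in> primes_upto N. p > ?s}. mangoldt p)"
  proof (rule sum_mono)
    fix p assume p: "p \<in> {p \<in> primes_upto N. p > ?s}"
    hence "N < p\<^sup>2" by (simp add: le_floor_sqrt_iff flip: not_le)
    hence "ln (real N) < ln (real p ^ 2)" using p assms
      by (subst ln_less_cancel_iff) (auto simp: primes_upto_def prime_gt_0_nat simp flip: of_nat_power)
    thus "ln (real N) / 2 \<le> mangoldt p" using p by (auto simp: primes_upto_def ln_realpow prime_gt_0_nat)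
  qed
  also have "\<dots> \<le> chebyshev_psi N" unfolding chebyshev_psi_def
    by (rule sum_mono2) (auto simp: primes_upto_def mangoldt_nonneg Suc_le_eq prime_gt_0_nat)
  also have "\<dots> \<le> 4 * real N" by (rule chebyshev_psi_le)
  finally have c2: "real (card {p \<in> primes_upto N. p > ?s}) * ln (real N) \<le> 8 * real N" by simp
  have "ln (sqrt (real N)) \<le> sqrt (real N) - 1" using assms by (intro ln_le_minus_one) auto
  hence l: "ln (real N) \<le> 2 * sqrt (real N)" using assms by (simp add: ln_sqrt)
  have "real (card (primes_upto N)) * ln (real N) \<le> sqrt (real N) * ln (real N) + real (card {p \<in> primes_upto N. p > ?s}) * ln (real N)"
    using mult_right_mono[OF c, of "ln (real N)"] assms by (simp add: distrib_right)
  also have "sqrt (real N) * ln (real N) \<le> sqrt (real N) * (2 * sqrt (real N))" using l by (intro mult_left_mono) auto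
  also have "\<dots> = 2 * real N" by simp
  finally show ?thesis using c2 by linarith
qed

section \<open>Dirichlet characters and their values at one\<close>

text \<open>Abel summation: decreasing nonnegative weights multiply the bound on the partial
  sums by no more than the first weight.\<close>

lemma norm_sum_antimono_le:
  fixes c :: "nat \<Rightarrow> complex" and f :: "nat \<Rightarrow> real"
  assumes B: "\<And>b. norm (\<Sum>n\<in>{a..<b}. c n) \<le> B"
    and mono: "\<And>n. n \<ge> a \<Longrightarrow> f (Suc n) \<le> f n" and nonneg: "\<And>n. n \<ge> a \<Longrightarrow> 0 \<le> f n"
  shows "norm (\<Sum>n\<in>{a..<b}. c n * of_real (f n)) \<le> B * f a"
proof (cases "a < b")
  case False
  have "B \<ge> 0" using B[of a] by simp
  with False nonneg[of a] show ?thesis by simp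
next
  case True
  define C where "C m = (\<Sum>n\<in>{a..<m}. c n)" for m
  have id: "(\<Sum>n\<in>{a..<a + Suc k}. c n * of_real (f n)) = C (a + Suc k) * of_real (f (a+k))
      + (\<Sum>i<k. C (a+i+1) * of_real (f (a+i) - f (a+i+1)))" for k
  proof (induction k)
    case (Suc k)
    have "C (a + Suc (Suc k)) = C (a + Suc k) + c (a + Suc k)"
      unfolding C_def by simp
    thus ?case using Suc by (simp add: algebra_simps)
  qed (simp add: C_def)
  obtain k where k: "b = a + Suc k" using True less_iff_Suc_add by auto
  have "norm (\<Sum>n\<in>{a..<b}. c n * of_real (f n)) \<le> norm (C (a + Suc k) * of_real (f (a+k)))
      + norm (\<Sum>i<k. C (a+i+1) * of_real (f (a+i) - f (a+i+1)))"
    unfolding k id by (rule norm_triangle_ineq)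
  also have "\<dots> \<le> B * f (a+k) + (\<Sum>i<k. B * (f (a+i) - f (a+i+1)))"
  proof (intro add_mono)
    show "norm (C (a + Suc k) * of_real (f (a+k))) \<le> B * f (a+k)"
      unfolding norm_mult C_def norm_of_real using B[of "a + Suc k"] nonneg[of "a+k"] order_trans[OF norm_ge_zero B[of a]]
      by (intro mult_mono) auto
    show "norm (\<Sum>i<k. C (a+i+1) * of_real (f (a+i) - f (a+i+1))) \<le> (\<Sum>i<k. B * (f (a+i) - f (a+i+1)))"
    proof (rule sum_norm_le)
      fix i
      have "f (a+i+1) \<le> f (a+i)" using mono[of "a+i"] by simp
      moreover have "norm (C (a+i+1)) \<le> B" unfolding C_def by (rule B)
      ultimately show "norm (C (a+i+1) * of_real (f (a+i) - f (a+i+1))) \<le> B * (f (a+i) - f (a+i+1))"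
        unfolding norm_mult norm_of_real using order_trans[OF norm_ge_zero B[of a]] by (intro mult_mono) auto
    qed
  qed
  also have "\<dots> = B * f (a+k) + B * (f a - f (a + k))"
  proof -
    have "(\<Sum>i<k. f (a+i) - f (a+i+1)) = f a - f (a+k)"
      using sum_lessThan_telescope'[of "\<lambda>i. f (a+i)" k] by simp
    thus ?thesis by (simp add: sum_distrib_left[symmetric])
  qed
  also have "\<dots> = B * f a" by (simp add: algebra_simps)
  finally show ?thesis .
qed

definition harmonic_sum :: "(nat \<Rightarrow> complex) \<Rightarrow> nat \<Rightarrow> complex" where
  "harmonic_sum c N = (\<Sum>n\<in>{1..N}. c n / of_nat n)"

text \<open>For a nonprincipal Dirichlet character \<open>c\<close> this is the value \<open>L(1,c)\<close>.\<close>

definition L_one :: "(nat \<Rightarrow> complex) \<Rightarrow> complex" where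
  "L_one c = lim (harmonic_sum c)"

definition mangoldt_sum_char :: "(nat \<Rightarrow> complex) \<Rightarrow> nat \<Rightarrow> complex" where
  "mangoldt_sum_char c N = (\<Sum>d\<in>{1..N}. c d * mangoldt d / of_nat d)"

locale dirichlet_char =
  fixes M :: nat and \<psi> :: "nat \<Rightarrow> complex"
  assumes M_pos: "0 < M"
    and mult: "\<And>m n. \<psi> (m * n) = \<psi> m * \<psi> n"
    and periodic: "\<And>n. \<psi> (n + M) = \<psi> n"
    and nonzero_iff: "\<And>n. \<psi> n \<noteq> 0 \<longleftrightarrow> coprime n M"
begin

lemma at_one [simp]: "\<psi> (Suc 0) = 1"
  using mult[of 1 1] nonzero_iff[of 1] by simp

lemma power: "\<psi> (n ^ k) = \<psi> n ^ k"
  by (induction k) (simp_all add: mult)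

lemma add_period: "\<psi> (n + k * M) = \<psi> n"
proof (induction k)
  case (Suc k)
  show ?case using periodic[of "n + k * M"] Suc by (simp add: algebra_simps)
qed simp

lemma mod_period [simp]: "\<psi> (n mod M) = \<psi> n"
  using add_period[of "n mod M" "n div M"] by simp

lemma cong_imp_eq: "[m = n] (mod M) \<Longrightarrow> \<psi> m = \<psi> n"
  using mod_period[of m] mod_period[of n] by (simp add: cong_def)

lemma power_totient: "coprime n M \<Longrightarrow> \<psi> n ^ totient M = 1"
  using cong_imp_eq[OF euler_theorem[of n M]] by (simp add: power)

lemma norm_eq_1: "coprime n M \<Longrightarrow> norm (\<psi> n) = 1"
proof -
  assume "coprime n M"
  hence "norm (\<psi> n) = 1 \<or> totient M = 0" by (intro power_eq_1_iff power_totient)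
  thus ?thesis using M_pos by simp
qed

lemma norm_le_1: "norm (\<psi> n) \<le> 1"
  using norm_eq_1[of n] nonzero_iff[of n] by (cases "coprime n M") auto

text \<open>Multiplication by \<open>b\<close> permutes the residues, so it leaves the sum unchanged and also
  multiplies it by \<open>\<psi> b\<close>.\<close>

lemma sum_period_eq_0:
  assumes "coprime b M" "\<psi> b \<noteq> 1"
  shows "(\<Sum>n<M. \<psi> n) = 0"
proof -
  have inj: "inj_on (\<lambda>n. b * n mod M) {..<M}"
  proof (rule inj_onI)
    fix x y assume xy: "x \<in> {..<M}" "y \<in> {..<M}" "b * x mod M = b * y mod M"
    hence "[b * x = b * y] (mod M)" by (simp add: cong_def)
    hence "[x = y] (mod M)" using assms cong_mult_lcancel_nat by blast
    thus "x = y" using xy by (simp add: cong_def)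
  qed
  have "(\<lambda>n. b * n mod M) ` {..<M} = {..<M}"
    using inj M_pos by (intro endo_inj_surj) auto
  hence "sum \<psi> {..<M} = sum \<psi> ((\<lambda>n. b * n mod M) ` {..<M})" by simp
  also have "\<dots> = (\<Sum>n<M. \<psi> (b * n mod M))"
    using inj by (simp only: sum.reindex o_def)
  also have "\<dots> = \<psi> b * sum \<psi> {..<M}" by (simp only: mod_period mult sum_distrib_left)
  finally have "sum \<psi> {..<M} = \<psi> b * sum \<psi> {..<M}" .
  thus ?thesis using assms by simp
qed

end

locale nonprincipal_char = dirichlet_char +
  assumes nonprincipal: "\<exists>b. coprime b M \<and> \<psi> b \<noteq> 1"
begin

lemma norm_sum_lessThan_le: "norm (\<Sum>n<k. \<psi> n) \<le> real M"
proof -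
  have zero: "(\<Sum>n<M. \<psi> n) = 0" using nonprincipal sum_period_eq_0 by blast
  have shift: "(\<Sum>n<k+M. \<psi> n) = (\<Sum>n<k. \<psi> n)" for k
    by (induction k) (simp_all add: zero periodic)
  have shifts: "(\<Sum>n<k+j*M. \<psi> n) = (\<Sum>n<k. \<psi> n)" for k j
  proof (induction j)
    case (Suc j)
    show ?case using shift[of "k + j*M"] Suc by (simp add: algebra_simps)
  qed simp
  have "norm (\<Sum>n<k. \<psi> n) = norm (\<Sum>n<k mod M. \<psi> n)"
    using shifts[of "k mod M" "k div M"] by simp
  also have "\<dots> \<le> real (k mod M) * 1"
    using sum_norm_le[of "{..<k mod M}" \<psi> "\<lambda>_. 1"] norm_le_1 by simp
  also have "\<dots> \<le> real M" using M_pos by (simp add: less_imp_le)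
  finally show ?thesis .
qed

lemma norm_sum_interval_le: "norm (\<Sum>n\<in>{a..<b}. \<psi> n) \<le> 2 * real M"
proof (cases "a \<le> b")
  case True
  have "(\<Sum>n\<in>{a..<b}. \<psi> n) = (\<Sum>n<b. \<psi> n) - (\<Sum>n<a. \<psi> n)"
    using True by (simp add: lessThan_atLeast0 sum_diff_nat_ivl)
  thus ?thesis using norm_sum_lessThan_le[of a] norm_sum_lessThan_le[of b]
      norm_triangle_ineq4[of "\<Sum>n<b. \<psi> n" "\<Sum>n<a. \<psi> n"] by simp
qed simp

lemmas norm_weighted_sum_le = norm_sum_antimono_le[OF norm_sum_interval_le]

lemma harmonic_sum_diff_le: "m \<le> n \<Longrightarrow> norm (harmonic_sum \<psi> n - harmonic_sum \<psi> m) \<le> 2 * real M / real (m + 1)"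
proof -
  assume mn: "m \<le> n"
  have "harmonic_sum \<psi> n = harmonic_sum \<psi> m + (\<Sum>k\<in>{m+1..<n+1}. \<psi> k / of_nat k)"
    unfolding harmonic_sum_def using mn
    by (subst sum.union_disjoint[symmetric]) (auto intro!: sum.cong)
  hence "harmonic_sum \<psi> n - harmonic_sum \<psi> m = (\<Sum>k\<in>{m+1..<n+1}. \<psi> k * of_real (1 / real k))"
    by (simp add: field_simps)
  also have "norm \<dots> \<le> 2 * real M * (1 / real (m + 1))"
    by (rule norm_weighted_sum_le) (auto simp: field_simps)
  finally show ?thesis by simp
qed

lemma harmonic_sum_tendsto: "harmonic_sum \<psi> \<longlonglongrightarrow> L_one \<psi>"
proof -
  have "Cauchy (harmonic_sum \<psi>)"
  proof (rule CauchyI')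
    fix e :: real assume "0 < e"
    obtain m where m: "2 * real M / e < real m" using reals_Archimedean2 by blast
    show "\<exists>m. \<forall>k\<ge>m. \<forall>n>k. dist (harmonic_sum \<psi> k) (harmonic_sum \<psi> n) < e"
    proof (intro exI allI impI)
      fix k n assume k: "k \<ge> m" "n > k"
      have "dist (harmonic_sum \<psi> k) (harmonic_sum \<psi> n) \<le> 2 * real M / real (k + 1)"
        using harmonic_sum_diff_le[of k n] k by (simp add: dist_norm norm_minus_commute)
      also have "\<dots> < e"
      proof -
        have "2 * real M < e * real m" using m \<open>0 < e\<close> by (simp add: field_simps)
        also have "\<dots> \<le> e * real (k+1)" using k \<open>0 < e\<close> by (intro mult_left_mono) auto
        finally show ?thesis by (simp add: field_simps)
      qed
      finally show "dist (harmonic_sum \<psi> k) (harmonic_sum \<psi> n) < e" .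
    qed
  qed
  thus ?thesis unfolding L_one_def by (simp add: Cauchy_convergent_iff convergent_LIMSEQ_iff)
qed

lemma harmonic_sum_approx: "norm (harmonic_sum \<psi> m - L_one \<psi>) \<le> 2 * real M / real (m + 1)"
proof -
  have "(\<lambda>n. norm (harmonic_sum \<psi> n - harmonic_sum \<psi> m)) \<longlonglongrightarrow> norm (L_one \<psi> - harmonic_sum \<psi> m)"
    by (intro tendsto_intros harmonic_sum_tendsto)
  hence "norm (L_one \<psi> - harmonic_sum \<psi> m) \<le> 2 * real M / real (m + 1)"
    by (rule Lim_bounded[where M=m]) (use harmonic_sum_diff_le[of m] in blast)
  thus ?thesis by (simp add: norm_minus_commute)
qed

text \<open>The error made when the sum up to \<open>N div d\<close> is replaced by its limit is at most
  \<open>2 M d / N\<close>; this is small enough to be summed over \<open>d\<close> against \<open>\<Lambda>(d)/d\<close>.\<close>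

lemma harmonic_sum_approx_div:
  assumes "1 \<le> d" "1 \<le> N"
  shows "norm (harmonic_sum \<psi> (N div d) - L_one \<psi>) / real d \<le> 2 * real M / real N"
proof -
  have "N < d * (N div d + 1)" using assms by (simp add: dividend_less_times_div)
  hence "real N \<le> real (N div d + 1) * real d" by (metis mult.commute of_nat_le_iff of_nat_mult less_imp_le)
  have "norm (harmonic_sum \<psi> (N div d) - L_one \<psi>) / real d \<le> 2 * real M / real (N div d + 1) / real d"
    using harmonic_sum_approx by (intro divide_right_mono) auto
  also have "\<dots> = 2 * real M / (real (N div d + 1) * real d)" by simp
  also have "\<dots> \<le> 2 * real M / real N"
    using \<open>real N \<le> real (N div d + 1) * real d\<close> assms by (intro divide_left_mono) auto
  finally show ?thesis .
qed

lemma ln_over_self_antimono: "n \<ge> 3 \<Longrightarrow> ln (real (Suc n)) / real (Suc n) \<le> ln (real n) / real n"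
proof -
  assume n: "n \<ge> 3"
  have "exp 1 \<le> real n" using exp_le n by linarith
  hence "ln (exp 1) \<le> ln (real n)" by (subst ln_le_cancel_iff) (use n in auto)
  hence l: "1 \<le> ln (real n)" by simp
  have "ln (real (Suc n)) = ln (real n * (1 + 1 / real n))" using n by (simp add: distrib_left add.commute)
  also have "\<dots> = ln (real n) + ln (1 + 1 / real n)" using n by (subst ln_mult_pos) (auto intro: add_pos_nonneg)
  also have "ln (1 + 1 / real n) \<le> 1 / real n" by (rule ln_add_one_self_le_self) auto
  finally have "ln (real (Suc n)) \<le> ln (real n) + 1 / real n" by simp
  hence "real n * ln (real (Suc n)) \<le> real n * ln (real n) + 1" using n by (simp add: field_simps)
  thus ?thesis using n l by (simp add: field_simps)
qed

lemma log_sum_bounded: "norm (\<Sum>n\<in>{1..N}. \<psi> n * of_real (ln (real n) / real n)) \<le> 2 + 4 * real M"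
proof -
  let ?f = "\<lambda>n. \<psi> n * of_real (ln (real n) / real n)"
  have le1: "ln (real n) / real n \<le> 1" for n
    by (cases "n = 0") (auto simp: field_simps intro: order_trans[OF ln_le_minus_one])
  have le0: "0 \<le> ln (real n) / real n" for n
    by (cases "n = 0") auto
  have le1': "norm (?f n) \<le> 1" for n
  proof -
    have "norm (?f n) = norm (\<psi> n) * (ln (real n) / real n)"
      by (cases "n = 0") (auto simp: norm_mult norm_divide)
    also have "\<dots> \<le> 1 * 1" using le1[of n] norm_le_1[of n] le0 by (intro mult_mono) auto
    finally show ?thesis by simp
  qed
  have "sum ?f {1..N} = sum ?f ({1..N} \<inter> {1,2}) + sum ?f {3..<Suc N}"
    by (subst sum.union_disjoint[symmetric]) (auto intro!: sum.cong)
  hence "norm (sum ?f {1..N}) \<le> norm (sum ?f ({1..N} \<inter> {1,2})) + norm (sum ?f {3..<Suc N})"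
    by (simp only: norm_triangle_ineq)
  also have "norm (sum ?f ({1..N} \<inter> {1,2})) \<le> (\<Sum>n\<in>{1..N} \<inter> {1,2}. 1)"
    by (rule sum_norm_le) (rule le1')
  also have "\<dots> \<le> 2" using card_mono[of "{1,2::nat}" "{1..N} \<inter> {1,2}"] by simp
  also have "norm (sum ?f {3..<Suc N}) \<le> 2 * real M * (ln (real 3) / real 3)"
    by (rule norm_weighted_sum_le) (use ln_over_self_antimono in auto)
  also have "\<dots> \<le> 2 * real M * 1" using le1[of 3] by (intro mult_left_mono) auto
  finally show ?thesis by simp
qed

lemma sum_convolution:
  "(\<Sum>n\<in>{1..N}. \<psi> n / of_nat n * (\<Sum>d | d dvd n. of_real (g d))) = (\<Sum>d\<in>{1..N}. \<psi> d * of_real (g d) / of_nat d * harmonic_sum \<psi> (N div d))"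
proof -
  have "(\<Sum>n\<in>{1..N}. \<psi> n / of_nat n * (\<Sum>d | d dvd n. of_real (g d))) =
     (\<Sum>n\<in>{1..N}. \<Sum>d | d dvd n. (\<psi> d * of_real (g d) / of_nat d) * (\<psi> (n div d) / of_nat (n div d)))"
    unfolding sum_distrib_left
  proof (intro sum.cong refl)
    fix n d assume n: "n \<in> {1..N}" "d \<in> {d. d dvd n}"
    then obtain k where k: "n = d * k" by auto
    with n have "d > 0" "k > 0" by (auto intro!: Nat.gr0I)
    thus "\<psi> n / of_nat n * of_real (g d) = \<psi> d * of_real (g d) / of_nat d * (\<psi> (n div d) / of_nat (n div d))"
      using k by (simp add: mult field_simps)
  qed
  also have "\<dots> = (\<Sum>d\<in>{1..N}. \<Sum>m\<in>{1..N div d}. (\<psi> d * of_real (g d) / of_nat d) * (\<psi> m / of_nat m))"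
    by (rule sum_divisors_swap)
  finally show ?thesis by (simp add: harmonic_sum_def sum_distrib_left)
qed

text \<open>Since \<open>ln = \<Lambda> * 1\<close>, the bounded sum of \<open>\<psi>(n) ln n / n\<close> splits over divisors
  into \<open>L(1,\<psi>)\<close> times the sum in question, with an error that Chebyshev's bound keeps
  bounded.\<close>

lemma mangoldt_sum_char_bounded:
  assumes "L_one \<psi> \<noteq> 0"
  shows "\<exists>C. \<forall>N. norm (mangoldt_sum_char \<psi> N) \<le> C"
proof (intro exI allI)
  fix N
  show "norm (mangoldt_sum_char \<psi> N) \<le> (2 + 12 * real M) / norm (L_one \<psi>)"
  proof (cases "N = 0")
    case True thus ?thesis by (simp add: mangoldt_sum_char_def)
  next
    case False
    have "(\<Sum>n\<in>{1..N}. \<psi> n * of_real (ln (real n) / real n)) = (\<Sum>n\<in>{1..N}. \<psi> n / of_nat n * (\<Sum>d | d dvd n. of_real (mangoldt d)))"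
      by (intro sum.cong refl) (simp add: mangoldt_sum)
    also have "\<dots> = (\<Sum>d\<in>{1..N}. \<psi> d * of_real (mangoldt d) / of_nat d * harmonic_sum \<psi> (N div d))"
      by (rule sum_convolution)
    also have "\<dots> = (\<Sum>d\<in>{1..N}. \<psi> d * mangoldt d / of_nat d * L_one \<psi> + \<psi> d * mangoldt d / of_nat d * (harmonic_sum \<psi> (N div d) - L_one \<psi>))"
      by (intro sum.cong refl) (simp add: right_diff_distrib)
    also have "\<dots> = mangoldt_sum_char \<psi> N * L_one \<psi> + (\<Sum>d\<in>{1..N}. \<psi> d * mangoldt d / of_nat d * (harmonic_sum \<psi> (N div d) - L_one \<psi>))"
      by (simp only: sum.distrib mangoldt_sum_char_def sum_distrib_right)
    finally have e: "mangoldt_sum_char \<psi> N * L_one \<psi> = (\<Sum>n\<in>{1..N}. \<psi> n * of_real (ln (real n) / real n))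
       - (\<Sum>d\<in>{1..N}. \<psi> d * mangoldt d / of_nat d * (harmonic_sum \<psi> (N div d) - L_one \<psi>))" by simp
    have "norm (\<Sum>d\<in>{1..N}. \<psi> d * mangoldt d / of_nat d * (harmonic_sum \<psi> (N div d) - L_one \<psi>)) \<le> (\<Sum>d\<in>{1..N}. mangoldt d * (2 * real M / real N))"
    proof (rule sum_norm_le)
      fix d assume d: "d \<in> {1..N}"
      have "norm (\<psi> d * mangoldt d / of_nat d * (harmonic_sum \<psi> (N div d) - L_one \<psi>)) = norm (\<psi> d) * (mangoldt d * (norm (harmonic_sum \<psi> (N div d) - L_one \<psi>) / real d))"
        by (simp add: norm_mult norm_divide)
      also have "\<dots> \<le> 1 * (mangoldt d * (2 * real M / real N))"
        using norm_le_1 harmonic_sum_approx_div[of d N] d False mangoldt_nonneg by (intro mult_mono) auto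
      finally show "norm (\<psi> d * mangoldt d / of_nat d * (harmonic_sum \<psi> (N div d) - L_one \<psi>)) \<le> mangoldt d * (2 * real M / real N)" by simp
    qed
    also have "\<dots> = chebyshev_psi N * (2 * real M / real N)" by (simp only: chebyshev_psi_def sum_distrib_right)
    also have "\<dots> \<le> 4 * real N * (2 * real M / real N)" using chebyshev_psi_le by (intro mult_right_mono) auto
    also have "\<dots> = 8 * real M" using False by simp
    finally have "norm (mangoldt_sum_char \<psi> N * L_one \<psi>) \<le> (2 + 4 * real M) + 8 * real M"
      unfolding e by (intro order_trans[OF norm_triangle_ineq4] add_mono log_sum_bounded)
    thus ?thesis using assms by (simp add: norm_mult field_simps)
  qed
qed

end

section \<open>The Moebius function and sums of the von Mangoldt function\<close>

definition moebius :: "nat \<Rightarrow> real" where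
  "moebius n = (if squarefree n then (-1) ^ card (prime_factors n) else 0)"

lemma abs_moebius_le: "\<bar>moebius n\<bar> \<le> 1"
  by (simp add: moebius_def power_abs)

lemma moebius_prime_mult:
  assumes "prime q" "\<not> q dvd e"
  shows "moebius (q * e) = - moebius e"
proof -
  have cop: "coprime q e" using assms by (simp add: prime_imp_coprime)
  have "e \<noteq> 0" using assms(2) by (metis dvd_0_right)
  have q0: "q \<noteq> 0" using assms by auto
  have pf: "prime_factors (q * e) = insert q (prime_factors e)"
    using assms \<open>e \<noteq> 0\<close> q0 by (simp add: prime_factors_product prime_prime_factors)
  have nin: "q \<notin> prime_factors e" using assms by auto
  have "squarefree (q * e) \<longleftrightarrow> squarefree e"
  proof
    assume "squarefree (q * e)" thus "squarefree e" by (rule squarefree_mono[rotated]) simp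
  next
    assume "squarefree e" thus "squarefree (q * e)" using cop squarefree_prime[OF assms(1)]
      by (intro squarefree_mult_coprime)
  qed
  thus ?thesis using nin by (simp add: moebius_def pf)
qed

text \<open>For \<open>n > 1\<close> fix a prime \<open>q\<close> dividing \<open>n\<close>. The squarefree divisors pair off as \<open>e\<close> and \<open>q e\<close>,
  with opposite signs.\<close>

lemma sum_moebius_divisors:
  assumes "n > 0"
  shows "(\<Sum>d | d dvd n. moebius d) = (if n = 1 then 1 else 0)"
proof (cases "n = 1")
  case True
  have "{d. d dvd (1::nat)} = {1}" by auto
  thus ?thesis using True by (simp add: moebius_def)
next
  case False
  then obtain q where q: "prime q" "q dvd n" using prime_factor_nat by blast
  let ?E = "{e. e dvd n \<and> squarefree e \<and> \<not> q dvd e}"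
  have fin: "finite {d. d dvd n}" using assms by simp
  have split: "{d. d dvd n \<and> squarefree d} = ?E \<union> (*) q ` ?E"
  proof (intro equalityI subsetI)
    fix d assume d: "d \<in> {d. d dvd n \<and> squarefree d}"
    show "d \<in> ?E \<union> (*) q ` ?E"
    proof (cases "q dvd d")
      case True
      then obtain e where e: "d = q * e" by auto
      have "\<not> q dvd e"
      proof
        assume "q dvd e"
        hence "q ^ 2 dvd d" using e by (simp add: power2_eq_square)
        hence "is_unit q" using d by (auto simp: squarefree_def)
        thus False using q by auto
      qed
      moreover have "squarefree e" using d e by (auto intro: squarefree_mono[of e "q * e"])
      moreover have "e dvd n" using d e by (auto intro: dvd_trans)
      ultimately show ?thesis using e by auto
    qed (use d in auto)
  next
    fix d assume "d \<in> ?E \<union> (*) q ` ?E"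
    thus "d \<in> {d. d dvd n \<and> squarefree d}"
    proof
      assume "d \<in> (*) q ` ?E"
      then obtain e where e: "d = q * e" "e \<in> ?E" by auto
      have "coprime q e" using q e by (simp add: prime_imp_coprime)
      thus ?thesis using e q squarefree_prime[OF q(1)] by (auto intro: divides_mult squarefree_mult_coprime)
    qed auto
  qed
  have "(\<Sum>d | d dvd n. moebius d) = (\<Sum>d | d dvd n \<and> squarefree d. moebius d)"
    using fin by (intro sum.mono_neutral_right) (auto simp: moebius_def)
  also have "\<dots> = sum moebius ?E + sum moebius ((*) q ` ?E)"
    unfolding split by (rule sum.union_disjoint) (use fin in \<open>auto intro: finite_subset[of _ "{d. d dvd n}"]\<close>)
  also have "sum moebius ((*) q ` ?E) = (\<Sum>e\<in>?E. - moebius e)"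
    using q by (subst sum.reindex) (auto simp: inj_on_def prime_gt_0_nat moebius_prime_mult intro!: sum.cong)
  finally show ?thesis using False by (simp add: sum_negf)
qed

text \<open>Moebius inversion of \<open>ln = \<Lambda> * 1\<close>.\<close>

lemma sum_moebius_ln:
  assumes "n > 0"
  shows "(\<Sum>d | d dvd n. moebius d * ln (real n / real d)) = mangoldt n"
proof -
  have fin: "finite {d. d dvd n}" using assms by simp
  have "(\<Sum>d | d dvd n. moebius d * ln (real n / real d)) = (\<Sum>d | d dvd n. \<Sum>e | e dvd n \<and> d * e dvd n. moebius d * mangoldt e)"
  proof (rule sum.cong[OF refl])
    fix d assume "d \<in> {d. d dvd n}"
    then obtain k where k: "n = d * k" by auto
    with assms have kd: "k > 0" "d > 0" by auto
    have "ln (real n / real d) = ln (real k)" using k kd by simp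
    also have "\<dots> = (\<Sum>e | e dvd k. mangoldt e)" using kd by (simp add: mangoldt_sum)
    also have "{e. e dvd k} = {e. e dvd n \<and> d * e dvd n}" using k kd by auto
    finally show "moebius d * ln (real n / real d) = (\<Sum>e | e dvd n \<and> d * e dvd n. moebius d * mangoldt e)"
      by (simp add: sum_distrib_left)
  qed
  also have "\<dots> = (\<Sum>e | e dvd n. \<Sum>d | d dvd n \<and> d * e dvd n. moebius d * mangoldt e)"
    using sum.swap_restrict[OF fin fin, of "\<lambda>d e. moebius d * mangoldt e" "\<lambda>d e. d * e dvd n"] by simp
  also have "\<dots> = (\<Sum>e | e dvd n. if e = n then mangoldt n else 0)"
  proof (rule sum.cong[OF refl])
    fix e assume "e \<in> {d. d dvd n}"
    then obtain k where k: "n = e * k" by auto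
    with assms have kd: "k > 0" "e > 0" by auto
    have "{d. d dvd n \<and> d * e dvd n} = {d. d dvd k}" using k kd by (auto simp: mult.commute)
    hence "(\<Sum>d | d dvd n \<and> d * e dvd n. moebius d * mangoldt e) = (if k = 1 then 1 else 0) * mangoldt e"
      using sum_moebius_divisors[OF kd(1)] by (simp add: sum_distrib_right[symmetric])
    also have "\<dots> = (if e = n then mangoldt n else 0)" using k kd by auto
    finally show "(\<Sum>d | d dvd n \<and> d * e dvd n. moebius d * mangoldt e) = (if e = n then mangoldt n else 0)" .
  qed
  also have "\<dots> = mangoldt n" using fin assms by simp
  finally show ?thesis .
qed

text \<open>The logarithms of \<open>x / d\<close> for fixed \<open>x\<close> produce an extra \<open>ln x\<close> at \<open>n = 1\<close>. This is the
  source of the term \<open>- ln N\<close> for a character with \<open>L(1,\<psi>) = 0\<close>.\<close>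

lemma sum_moebius_ln_quotient:
  assumes "n > 0" "x > 0"
  shows "(\<Sum>d | d dvd n. moebius d * ln (x / real d)) = (if n = 1 then ln x else 0) + mangoldt n"
proof -
  have "(\<Sum>d | d dvd n. moebius d * ln (x / real d)) = (\<Sum>d | d dvd n. moebius d * (ln x - ln (real n)) + moebius d * ln (real n / real d))"
  proof (intro sum.cong refl)
    fix d assume "d \<in> {d. d dvd n}"
    hence "d > 0" using assms by (auto intro!: Nat.gr0I)
    thus "moebius d * ln (x / real d) = moebius d * (ln x - ln (real n)) + moebius d * ln (real n / real d)"
      using assms by (simp add: ln_div algebra_simps)
  qed
  also have "\<dots> = (\<Sum>d | d dvd n. moebius d) * (ln x - ln (real n)) + mangoldt n"
    using assms by (simp add: sum.distrib sum_distrib_right sum_moebius_ln)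
  finally show ?thesis using assms by (auto simp: sum_moebius_divisors)
qed

lemma ln_fact_lower: "real N * ln (real N) - real N \<le> ln (fact N)"
proof (induction N)
  case (Suc N)
  show ?case
  proof (cases "N = 0")
    case False
    have "ln (real (Suc N)) = ln (real N * (1 + 1 / real N))" using False by (simp add: distrib_left add.commute)
    also have "\<dots> = ln (real N) + ln (1 + 1 / real N)" using False by (subst ln_mult_pos) (auto intro: add_pos_nonneg)
    also have "ln (1 + 1 / real N) \<le> 1 / real N" by (rule ln_add_one_self_le_self) auto
    finally have "real N * ln (real (Suc N)) \<le> real N * (ln (real N) + 1 / real N)" by (intro mult_left_mono) auto
    hence "real N * ln (real (Suc N)) \<le> real N * ln (real N) + 1" using False by (simp add: distrib_left)
    moreover have "ln (fact (Suc N) :: real) = ln (real (Suc N)) + ln (fact N)" by (simp add: ln_mult)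
    ultimately show ?thesis using Suc by (simp add: algebra_simps)
  qed simp
qed simp

lemma ln_fact_upper: "ln (fact N) \<le> real N * ln (real N)"
proof -
  have "ln (fact N :: real) \<le> ln (real N ^ N)" using fact_le_power[of N]
    by (cases "N = 0") (auto intro!: ln_mono)
  thus ?thesis by (cases "N = 0") (auto simp: ln_realpow)
qed

text \<open>Compare \<open>N / n\<close> with its integer part in the formula for \<open>ln (N!)\<close>.\<close>

lemma sum_mangoldt_over_self:
  assumes "N \<ge> 1"
  shows "\<bar>(\<Sum>n\<in>{1..N}. mangoldt n / real n) - ln (real N)\<bar> \<le> 4"
proof -
  let ?T = "(\<Sum>n\<in>{1..N}. mangoldt n / real n)"
  have r: "real (N div n) \<le> real N / real n \<and> real N / real n \<le> real (N div n) + 1" if "n \<ge> 1" for n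
  proof -
    have "n * (N div n) \<le> N" "N < n * (N div n + 1)" using that by (simp_all add: dividend_less_times_div)
    hence "real n * real (N div n) \<le> real N" "real N \<le> real n * (real (N div n) + 1)"
      by (metis of_nat_le_iff of_nat_mult, metis of_nat_le_iff of_nat_mult less_imp_le of_nat_add of_nat_1)
    thus ?thesis using that by (simp add: field_simps)
  qed
  have "ln (fact N) \<le> (\<Sum>n\<in>{1..N}. mangoldt n * (real N / real n))"
    unfolding ln_fact_mangoldt using r by (intro sum_mono mult_left_mono mangoldt_nonneg) auto
  hence 1: "ln (fact N) \<le> real N * ?T" by (simp add: sum_distrib_left algebra_simps)
  have "(\<Sum>n\<in>{1..N}. mangoldt n * (real N / real n)) \<le> (\<Sum>n\<in>{1..N}. mangoldt n * (real (N div n) + 1))"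
    using r by (intro sum_mono mult_left_mono mangoldt_nonneg) auto
  also have "\<dots> = ln (fact N) + chebyshev_psi N"
    by (simp add: ln_fact_mangoldt chebyshev_psi_def sum.distrib algebra_simps)
  finally have 2: "real N * ?T \<le> ln (fact N) + 4 * real N" using chebyshev_psi_le[of N]
    by (simp add: sum_distrib_left algebra_simps)
  have "real N * (ln (real N) - 1) \<le> real N * ?T" using 1 ln_fact_lower[of N] by (simp add: algebra_simps)
  moreover have "real N * ?T \<le> real N * (ln (real N) + 4)" using 2 ln_fact_upper[of N] by (simp add: algebra_simps)
  ultimately have "ln (real N) - 1 \<le> ?T" "?T \<le> ln (real N) + 4" using assms by auto
  thus ?thesis by auto
qed

context nonprincipal_char begin

text \<open>Weighting \<open>\<psi>(n)/n\<close> with the sum of \<open>\<mu>(d) ln (N/d)\<close> over the divisors \<open>d\<close> of \<open>n\<close> gives the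
  left-hand side. Summed over \<open>d\<close> first, the inner sums of \<open>\<psi>(m)/m\<close> tend to 0 with error
  \<open>O(d/N)\<close>, and the sum of \<open>ln (N/d)\<close> over \<open>d \<le> N\<close> is \<open>O(N)\<close>.\<close>

lemma mangoldt_sum_char_if_zero:
  assumes "L_one \<psi> = 0" "N \<ge> 1"
  shows "norm (mangoldt_sum_char \<psi> N + of_real (ln (real N))) \<le> 2 * real M"
proof -
  have "mangoldt_sum_char \<psi> N + of_real (ln (real N)) = (\<Sum>n\<in>{1..N}. \<psi> n / of_nat n * of_real (mangoldt n + (if n = 1 then ln (real N) else 0)))"
  proof -
    have "(\<Sum>n\<in>{1..N}. \<psi> n / of_nat n * of_real (mangoldt n + (if n = 1 then ln (real N) else 0)))
      = (\<Sum>n\<in>{1..N}. \<psi> n * mangoldt n / of_nat n + (if n = 1 then of_real (ln (real N)) else 0))"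
      by (intro sum.cong refl) (auto simp: distrib_left)
    also have "\<dots> = mangoldt_sum_char \<psi> N + of_real (ln (real N))"
      using assms by (simp add: sum.distrib mangoldt_sum_char_def)
    finally show ?thesis ..
  qed
  also have "\<dots> = (\<Sum>n\<in>{1..N}. \<psi> n / of_nat n * (\<Sum>d | d dvd n. of_real (moebius d * ln (real N / real d))))"
  proof (intro sum.cong refl)
    fix n assume "n \<in> {1..N}"
    hence "(\<Sum>d | d dvd n. moebius d * ln (real N / real d)) = mangoldt n + (if n = 1 then ln (real N) else 0)"
      using sum_moebius_ln_quotient[of n "real N"] assms by simp
    thus "\<psi> n / of_nat n * of_real (mangoldt n + (if n = 1 then ln (real N) else 0)) = \<psi> n / of_nat n * (\<Sum>d | d dvd n. of_real (moebius d * ln (real N / real d)))"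
      by (metis of_real_sum)
  qed
  also have "\<dots> = (\<Sum>d\<in>{1..N}. \<psi> d * of_real (moebius d * ln (real N / real d)) / of_nat d * harmonic_sum \<psi> (N div d))"
    by (rule sum_convolution)
  also have "norm \<dots> \<le> (\<Sum>d\<in>{1..N}. (ln (real N) - ln (real d)) * (2 * real M / real N))"
  proof (rule sum_norm_le)
    fix d assume d: "d \<in> {1..N}"
    hence l: "ln (real N / real d) = ln (real N) - ln (real d)" by (simp add: ln_div)
    have l0: "0 \<le> ln (real N) - ln (real d)" using d by auto
    have "norm (\<psi> d * of_real (moebius d * ln (real N / real d)) / of_nat d * harmonic_sum \<psi> (N div d))
       = (norm (\<psi> d) * \<bar>moebius d\<bar>) * ((ln (real N) - ln (real d)) * (norm (harmonic_sum \<psi> (N div d) - L_one \<psi>) / real d))"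
      using assms l0 by (simp add: l norm_mult norm_divide del: of_real_diff)
    also have "\<dots> \<le> (1 * 1) * ((ln (real N) - ln (real d)) * (2 * real M / real N))"
      using norm_le_1 abs_moebius_le l0 harmonic_sum_approx_div[of d N] d assms by (intro mult_mono) auto
    finally show "norm (\<psi> d * of_real (moebius d * ln (real N / real d)) / of_nat d * harmonic_sum \<psi> (N div d)) \<le> (ln (real N) - ln (real d)) * (2 * real M / real N)" by simp
  qed
  also have "\<dots> = (real N * ln (real N) - ln (fact N)) * (2 * real M / real N)"
  proof -
    have "ln (fact N :: real) = (\<Sum>d\<in>{1..N}. ln (real d))"
    proof (induction N)
      case (Suc N) thus ?case by (simp add: ln_mult)
    qed simp
    hence "(\<Sum>d\<in>{1..N}. ln (real N) - ln (real d)) = real N * ln (real N) - ln (fact N)"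
      by (simp add: sum_subtractf)
    thus ?thesis by (simp only: sum_distrib_right[symmetric])
  qed
  also have "\<dots> \<le> real N * (2 * real M / real N)" using ln_fact_lower[of N] by (intro mult_right_mono) auto
  also have "\<dots> = 2 * real M" using assms by simp
  finally show ?thesis .
qed

end

lemma sum_ln_over_prime_powers_le:
  assumes "prime q"
  shows "(\<Sum>k\<in>{1..N}. ln (real q) / real q ^ k) \<le> ln (real q)"
proof -
  have q: "real q \<ge> 2" using assms prime_ge_2_nat[of q] by simp
  have "(\<Sum>k\<in>{1..N}. 1 / real q ^ k) \<le> 1 - 1 / real q ^ N"
  proof (induction N)
    case (Suc N)
    have "2 * (1 / real q ^ Suc N) \<le> 1 / real q ^ N" using q by (simp add: field_simps)
    thus ?case using Suc by simp
  qed simp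
  also have "\<dots> \<le> 1" by simp
  finally have "ln (real q) * (\<Sum>k\<in>{1..N}. 1 / real q ^ k) \<le> ln (real q) * 1"
    using q by (intro mult_left_mono) auto
  thus ?thesis by (simp add: sum_distrib_left)
qed

text \<open>Only powers of the finitely many primes dividing \<open>M\<close> contribute, and each prime gives
  a convergent geometric series.\<close>

lemma sum_mangoldt_noncoprime_le:
  assumes "M > 0"
  shows "(\<Sum>n | n \<in> {1..N} \<and> \<not> coprime n M. mangoldt n / real n) \<le> (\<Sum>q\<in>prime_factors M. ln (real q))"
proof -
  let ?T = "{n \<in> {1..N}. \<not> coprime n M \<and> primepow n}"
  let ?P = "prime_factors M \<times> {1..N}"
  let ?f = "\<lambda>(q,k). (q::nat) ^ k"
  have "(\<Sum>n | n \<in> {1..N} \<and> \<not> coprime n M. mangoldt n / real n) = (\<Sum>n\<in>?T. mangoldt n / real n)"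
    by (rule sum.mono_neutral_right) (auto simp: mangoldt_def)
  also have "\<dots> \<le> (\<Sum>n\<in>?f ` ?P. mangoldt n / real n)"
  proof (rule sum_mono2)
    show "?T \<subseteq> ?f ` ?P"
    proof
      fix n assume n: "n \<in> ?T"
      then obtain q k where qk: "prime q" "k > 0" "n = q ^ k" by (auto simp: primepow_def)
      have "\<not> coprime q M" using n qk by auto
      hence "q \<in> prime_factors M" using qk(1) assms by (metis in_prime_factors_iff neq0_conv prime_imp_coprime)
      moreover have "k \<le> N"
      proof -
        have "1 < q" using qk(1) by (rule prime_gt_1_nat)
        hence "k < q ^ k" by (simp add: power_gt_expt)
        thus ?thesis using n qk(3) by auto
      qed
      ultimately show "n \<in> ?f ` ?P" using qk by (intro image_eqI[of _ _ "(q,k)"]) auto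
    qed
  qed (auto simp: mangoldt_nonneg)
  also have "\<dots> \<le> (\<Sum>x\<in>?P. mangoldt (?f x) / real (?f x))"
    by (rule order_trans[OF sum_image_le]) (auto simp: mangoldt_nonneg)
  also have "\<dots> = (\<Sum>q\<in>prime_factors M. \<Sum>k\<in>{1..N}. mangoldt (q ^ k) / real (q ^ k))"
    by (subst sum.cartesian_product) (simp add: case_prod_unfold)
  also have "\<dots> = (\<Sum>q\<in>prime_factors M. \<Sum>k\<in>{1..N}. ln (real q) / real q ^ k)"
    by (intro sum.cong refl) (auto simp: in_prime_factors_iff mangoldt_primepow)
  also have "\<dots> \<le> (\<Sum>q\<in>prime_factors M. ln (real q))"
    by (intro sum_mono sum_ln_over_prime_powers_le) auto
  finally show ?thesis .
qed

lemma sum_mangoldt_coprime: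
  assumes "M > 0" "N \<ge> 1"
  shows "\<bar>(\<Sum>n | n \<in> {1..N} \<and> coprime n M. mangoldt n / real n) - ln (real N)\<bar> \<le> 4 + (\<Sum>q\<in>prime_factors M. ln (real q))"
proof -
  have "(\<Sum>n\<in>{1..N}. mangoldt n / real n) = (\<Sum>n | n \<in> {1..N} \<and> coprime n M. mangoldt n / real n) + (\<Sum>n | n \<in> {1..N} \<and> \<not> coprime n M. mangoldt n / real n)"
    by (subst sum.union_disjoint[symmetric]) (auto intro!: sum.cong)
  moreover have "0 \<le> (\<Sum>n | n \<in> {1..N} \<and> \<not> coprime n M. mangoldt n / real n)"
    by (intro sum_nonneg) (auto simp: mangoldt_nonneg)
  ultimately show ?thesis using sum_mangoldt_over_self[OF assms(2)] sum_mangoldt_noncoprime_le[OF assms(1), of N] by linarith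
qed

section \<open>Real characters\<close>

lemma geometric_sum_lower:
  fixes x :: real
  assumes "x \<in> {-1, 0, 1}"
  shows "0 \<le> (\<Sum>i\<le>k. x ^ i)" and "even k \<Longrightarrow> 1 \<le> (\<Sum>i\<le>k. x ^ i)"
proof -
  have m: "(\<Sum>i\<le>k. (-1) ^ i :: real) = (if even k then 1 else 0)" for k
    by (induction k) auto
  have z: "(\<Sum>i\<le>k. 0 ^ i :: real) = 1" for k
    by (induction k) auto
  show "0 \<le> (\<Sum>i\<le>k. x ^ i)" "even k \<Longrightarrow> 1 \<le> (\<Sum>i\<le>k. x ^ i)"
    using assms m z by auto
qed

text \<open>With \<open>g\<^sub>d = 1 + t + \<dots> + t\<^sup>d\<^sup>-\<^sup>1\<close>, the difference of consecutive terms is, up to a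
  positive factor, \<open>1/(d (d+1)) - t\<^sup>d/(g\<^sub>d g\<^sub>d\<^sub>+\<^sub>1)\<close>; it is nonnegative by the inequality of
  arithmetic and geometric means applied to \<open>g\<^sub>d\<close> and \<open>g\<^sub>d\<^sub>+\<^sub>1\<close>.\<close>

lemma antimono_lambert_difference:
  fixes t :: real
  assumes t: "0 < t" "t < 1" and d: "1 \<le> d"
  defines "b \<equiv> \<lambda>d. 1 / (real d * (1 - t)) - t ^ d / (1 - t ^ d)"
  shows "b (Suc d) \<le> b d" and "0 \<le> b d"
proof -
  define g where "g d = (\<Sum>i<d. t ^ i)" for d
  have g: "1 - t ^ k = (1 - t) * g k" for k unfolding g_def by (rule one_diff_power_eq)
  have gS: "g (Suc k) = t * g k + 1" for k
    unfolding g_def by (subst sum.lessThan_Suc_shift) (simp add: sum_distrib_left)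
  have gpos: "0 < g k" if "k \<ge> 1" for k
    unfolding g_def using that t by (intro sum_pos) (auto simp: lessThan_empty_iff)
  \<comment> \<open>Pair the summands \<open>t\<^sup>i\<close> and \<open>t\<^sup>k\<^sup>-\<^sup>1\<^sup>-\<^sup>i\<close>, whose geometric mean does not depend on \<open>i\<close>.\<close>
  have amgm: "real k * sqrt (t ^ (k - 1)) \<le> g k" for k
  proof -
    have "real k * sqrt (t ^ (k - 1)) = (\<Sum>i<k. sqrt (t ^ (k - 1)))" by simp
    also have "\<dots> \<le> (\<Sum>i<k. (t ^ i + t ^ (k - Suc i)) / 2)"
    proof (rule sum_mono)
      fix i assume "i \<in> {..<k}"
      hence "t ^ (k - 1) = t ^ i * t ^ (k - Suc i)" by (simp flip: power_add)
      thus "sqrt (t ^ (k - 1)) \<le> (t ^ i + t ^ (k - Suc i)) / 2"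
        using arith_geo_mean_sqrt[of "t ^ i" "t ^ (k - Suc i)"] t by simp
    qed
    also have "\<dots> = ((\<Sum>i<k. t ^ i) + (\<Sum>i<k. t ^ (k - Suc i))) / 2"
      by (simp only: sum.distrib sum_divide_distrib[symmetric])
    also have "(\<Sum>i<k. t ^ (k - Suc i)) = (\<Sum>i<k. t ^ i)" by (rule sum.nat_diff_reindex)
    finally show ?thesis by (simp add: g_def)
  qed
  have prod: "real d * real (Suc d) * t ^ d \<le> g d * g (Suc d)"
  proof -
    have "t ^ d = sqrt (t ^ d) * sqrt (t ^ d)" using t by simp
    also have "\<dots> \<le> sqrt (t ^ (d - 1)) * sqrt (t ^ (Suc d - 1))"
      using t by (intro mult_mono real_sqrt_le_mono power_decreasing) auto
    finally have "real d * real (Suc d) * t ^ d \<le> real d * real (Suc d) * (sqrt (t ^ (d - 1)) * sqrt (t ^ (Suc d - 1)))"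
      by (intro mult_left_mono) auto
    also have "\<dots> = (real d * sqrt (t ^ (d - 1))) * (real (Suc d) * sqrt (t ^ (Suc d - 1)))" by simp
    also have "\<dots> \<le> g d * g (Suc d)"
      using amgm[of d] amgm[of "Suc d"] gpos[of d] d t by (intro mult_mono) auto
    finally show ?thesis .
  qed
  have b: "b k = (1 / real k - t ^ k / g k) / (1 - t)" for k
    unfolding b_def g using t by (simp add: diff_divide_distrib mult.commute)
  have gd: "0 < g d" "0 < g (Suc d)" using gpos d by auto
  have "t ^ d / g d - t ^ Suc d / g (Suc d) = t ^ d * (g (Suc d) - t * g d) / (g d * g (Suc d))"
    using gd by (simp add: field_simps)
  also have "\<dots> = t ^ d / (g d * g (Suc d))" by (simp add: gS)
  also have "\<dots> \<le> 1 / (real d * real (Suc d))"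
  proof -
    define D G where "D = real d * real (Suc d)" and "G = g d * g (Suc d)"
    have "D > 0" "G > 0" "D * t ^ d \<le> G" using prod gd d by (auto simp: D_def G_def)
    hence "t ^ d / G \<le> 1 / D" by (simp add: field_simps)
    thus ?thesis by (simp add: D_def G_def)
  qed
  also have "\<dots> = 1 / real d - 1 / real (Suc d)" using d by (simp add: field_simps)
  finally have "1 / real (Suc d) - t ^ Suc d / g (Suc d) \<le> 1 / real d - t ^ d / g d" by simp
  thus "b (Suc d) \<le> b d" unfolding b using t by (intro divide_right_mono) auto
  have "real d * t ^ d = (\<Sum>i<d. t ^ d)" by simp
  also have "\<dots> \<le> g d" unfolding g_def using t by (intro sum_mono power_decreasing) auto
  finally have "0 \<le> 1 / real d - t ^ d / g d" using gd d by (simp add: field_simps)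
  thus "0 \<le> b d" unfolding b using t by simp
qed

context nonprincipal_char begin

text \<open>For a real character, the coefficients of \<open>\<zeta>(s) L(s,\<psi>)\<close>.\<close>

definition divisor_sum :: "nat \<Rightarrow> real" where
  "divisor_sum n = (\<Sum>d | d dvd n. Re (\<psi> d))"

context
  assumes real: "\<And>n. \<psi> n \<in> \<real>"
begin

lemma of_real_Re_char: "of_real (Re (\<psi> n)) = \<psi> n"
  using real[of n] by (auto elim: Reals_cases)

lemma Re_mult_char: "Re (\<psi> (m * n)) = Re (\<psi> m) * Re (\<psi> n)"
  using mult[of m n] of_real_Re_char[of m] of_real_Re_char[of n]
  by (metis Re_complex_of_real of_real_mult)

lemma Re_char_cases: "Re (\<psi> n) \<in> {-1, 0, 1}"
proof (cases "coprime n M")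
  case True
  hence "\<bar>Re (\<psi> n)\<bar> = 1" using norm_eq_1[of n] of_real_Re_char[of n] by (metis norm_of_real)
  thus ?thesis by auto
next
  case False
  thus ?thesis using nonzero_iff[of n] by auto
qed

text \<open>Among the divisors of \<open>q\<^sup>k\<^sup>+\<^sup>1 m\<close>, those prime to \<open>q\<close> divide \<open>m\<close> and the others are \<open>q\<close> times
  a divisor of \<open>q\<^sup>k m\<close>.\<close>

lemma divisor_sum_prime_power_mult:
  assumes q: "prime q" and m: "\<not> q dvd m"
  shows "divisor_sum (q ^ k * m) = (\<Sum>i\<le>k. Re (\<psi> q) ^ i) * divisor_sum m"
proof (induction k)
  case (Suc k)
  have m0: "m > 0" using m by (auto intro!: Nat.gr0I)
  have q0: "q > 0" using q by (rule prime_gt_0_nat)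
  have split: "{d. d dvd q ^ Suc k * m} = {d. d dvd m} \<union> (*) q ` {d. d dvd q ^ k * m}"
  proof (intro equalityI subsetI)
    fix d assume d: "d \<in> {d. d dvd q ^ Suc k * m}"
    show "d \<in> {d. d dvd m} \<union> (*) q ` {d. d dvd q ^ k * m}"
    proof (cases "q dvd d")
      case True
      then obtain e where e: "d = q * e" by auto
      have "q * e dvd q * (q ^ k * m)" using d e by (simp add: mult.assoc)
      hence "e dvd q ^ k * m" using q0 by simp
      thus ?thesis using e by auto
    next
      case False
      hence "coprime d (q ^ Suc k)" using prime_imp_coprime[OF q False] by (simp add: coprime_commute)
      thus ?thesis using d by (simp add: coprime_dvd_mult_right_iff)
    qed
  next
    fix d assume "d \<in> {d. d dvd m} \<union> (*) q ` {d. d dvd q ^ k * m}"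
    thus "d \<in> {d. d dvd q ^ Suc k * m}" by (auto simp: mult.assoc)
  qed
  have "divisor_sum (q ^ Suc k * m) = divisor_sum m + (\<Sum>d\<in>(*) q ` {d. d dvd q ^ k * m}. Re (\<psi> d))"
    unfolding divisor_sum_def split
  proof (rule sum.union_disjoint)
    show "{d. d dvd m} \<inter> (*) q ` {d. d dvd q ^ k * m} = {}"
      using m by (auto dest: dvd_mult_left)
  qed (use m0 q0 in auto)
  also have "(\<Sum>d\<in>(*) q ` {d. d dvd q ^ k * m}. Re (\<psi> d)) = Re (\<psi> q) * divisor_sum (q ^ k * m)"
    unfolding divisor_sum_def using q0
    by (subst sum.reindex) (auto simp: inj_on_def Re_mult_char sum_distrib_left)
  also have "\<dots> = Re (\<psi> q) * ((\<Sum>i\<le>k. Re (\<psi> q) ^ i) * divisor_sum m)" by (simp only: Suc.IH)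
  also have "divisor_sum m + \<dots> = (1 + (\<Sum>i\<le>k. Re (\<psi> q) ^ Suc i)) * divisor_sum m"
    by (simp add: sum_distrib_left algebra_simps)
  also have "1 + (\<Sum>i\<le>k. Re (\<psi> q) ^ Suc i) = (\<Sum>i\<le>Suc k. Re (\<psi> q) ^ i)"
    by (subst sum.atMost_Suc_shift) simp
  finally show ?case .
qed simp

lemma divisor_sum_bounds:
  "n > 0 \<Longrightarrow> 0 \<le> divisor_sum n \<and> 1 \<le> divisor_sum (n ^ 2)"
proof (induction n rule: less_induct)
  case (less n)
  show ?case
  proof (cases "n = 1")
    case True
    have "{d. d dvd Suc 0} = {Suc 0}" by auto
    thus ?thesis using True by (simp add: divisor_sum_def)
  next
    case False
    then obtain q where q: "prime q" "q dvd n" using prime_factor_nat by blast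
    define k where "k = multiplicity q n"
    obtain m where m: "n = q ^ k * m" "\<not> q dvd m"
      using multiplicity_decompose'[of n q] less.prems q unfolding k_def by (metis not_prime_unit less_numeral_extra(3))
    have k: "k > 0" using q less.prems unfolding k_def by (simp add: prime_multiplicity_gt_zero_iff)
    have m0: "m > 0" using m less.prems by (auto intro!: Nat.gr0I)
    have "1 < q ^ k" by (rule one_less_power[OF prime_gt_1_nat[OF q(1)] k])
    hence "m < n" using m m0 by simp
    hence IH: "0 \<le> divisor_sum m" "1 \<le> divisor_sum (m ^ 2)" using less.IH m0 by auto
    have "divisor_sum n = (\<Sum>i\<le>k. Re (\<psi> q) ^ i) * divisor_sum m"
      using divisor_sum_prime_power_mult[OF q(1) m(2), of k] m by simp
    hence 1: "0 \<le> divisor_sum n" using IH geometric_sum_lower(1)[OF Re_char_cases] by simp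
    have "\<not> q dvd m ^ 2" using q m prime_dvd_power by blast
    moreover have "n ^ 2 = q ^ (2 * k) * m ^ 2" using m by (simp add: power_mult_distrib power_mult[symmetric] mult.commute)
    ultimately have "divisor_sum (n ^ 2) = (\<Sum>i\<le>2*k. Re (\<psi> q) ^ i) * divisor_sum (m ^ 2)"
      using divisor_sum_prime_power_mult[OF q(1), of "m ^ 2" "2 * k"] by simp
    moreover have "1 \<le> (\<Sum>i\<le>2*k. Re (\<psi> q) ^ i)" using geometric_sum_lower(2)[OF Re_char_cases] by simp
    moreover have "1 * 1 \<le> (\<Sum>i\<le>2*k. Re (\<psi> q) ^ i) * divisor_sum (m ^ 2)"
      using calculation(2) IH by (intro mult_mono) auto
    ultimately show ?thesis using 1 by simp
  qed
qed

text \<open>The power series equals the Lambert series \<open>\<Sum> \<psi>(d) t\<^sup>d/(1 - t\<^sup>d)\<close> up to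
  truncation. Since \<open>\<Sum> \<psi>(d)/d = 0\<close>, each \<open>t\<^sup>d/(1 - t\<^sup>d)\<close> may be replaced by its
  difference from \<open>1/(d (1 - t))\<close>, which is decreasing in \<open>d\<close>, so that Abel summation
  bounds the series independently of \<open>t\<close>. The last two terms are the truncation errors.\<close>

lemma divisor_sum_power_series_upper:
  assumes L: "L_one \<psi> = 0" and t: "0 < t" "t < 1"
  shows "(\<Sum>n\<in>{1..N}. divisor_sum n * t ^ n) \<le> 2 * real M + 2 * real M / real (N + 1) / (1 - t) + real N * t ^ N / (1 - t)"
proof -
  define b where "b = (\<lambda>d. 1 / (real d * (1 - t)) - t ^ d / (1 - t ^ d))"
  let ?r = "\<lambda>d. Re (\<psi> d)"
  let ?K = "\<lambda>d. N div d"
  have td: "t ^ d \<le> t" "t ^ d < 1" "0 < t ^ d" if "d \<ge> 1" for d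
    using t that power_decreasing[of 1 d t] power_Suc_less_one[of t "d - 1"] by auto
  have "(\<Sum>n\<in>{1..N}. divisor_sum n * t ^ n) = (\<Sum>n\<in>{1..N}. \<Sum>d | d dvd n. ?r d * t ^ (d * (n div d)))"
    by (simp add: divisor_sum_def sum_distrib_right)
  also have "\<dots> = (\<Sum>d\<in>{1..N}. \<Sum>m\<in>{1..?K d}. ?r d * t ^ (d * m))"
    by (rule sum_divisors_swap)
  also have "\<dots> = (\<Sum>d\<in>{1..N}. ?r d / real d / (1 - t) - ?r d * b d - ?r d * (t ^ (d * Suc (?K d)) / (1 - t ^ d)))"
  proof (rule sum.cong[OF refl])
    fix d assume d: "d \<in> {1..N}"
    have g: "(\<Sum>m\<in>{1..k}. x ^ m) = (x - x ^ Suc k) / (1 - x)" if "x < 1" for x :: real and k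
    proof -
      have "(1 - x) * (\<Sum>m\<in>{1..k}. x ^ m) = x - x ^ Suc k"
      proof (induction k)
        case (Suc k)
        have "(1 - x) * (\<Sum>m\<in>{1..Suc k}. x ^ m) = (1 - x) * (\<Sum>m\<in>{1..k}. x ^ m) + (1 - x) * x ^ Suc k"
          by (simp add: distrib_left)
        also have "\<dots> = x - x ^ Suc (Suc k)" unfolding Suc.IH by (simp add: algebra_simps)
        finally show ?case .
      qed simp
      thus ?thesis using that by (simp add: field_simps)
    qed
    have "(\<Sum>m\<in>{1..?K d}. ?r d * t ^ (d * m)) = ?r d * (\<Sum>m\<in>{1..?K d}. (t ^ d) ^ m)"
      by (simp add: sum_distrib_left power_mult)
    also have "\<dots> = ?r d * ((t ^ d - (t ^ d) ^ Suc (?K d)) / (1 - t ^ d))"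
      using td d by (subst g) auto
    also have "(t ^ d) ^ Suc (?K d) = t ^ (d * Suc (?K d))" by (rule power_mult[symmetric])
    also have "?r d * ((t ^ d - t ^ (d * Suc (?K d))) / (1 - t ^ d)) = ?r d * (t ^ d / (1 - t ^ d)) - ?r d * (t ^ (d * Suc (?K d)) / (1 - t ^ d))"
      by (simp add: diff_divide_distrib right_diff_distrib)
    also have "t ^ d / (1 - t ^ d) = 1 / real d / (1 - t) - b d" by (simp add: b_def)
    finally show "(\<Sum>m\<in>{1..?K d}. ?r d * t ^ (d * m)) = ?r d / real d / (1 - t) - ?r d * b d - ?r d * (t ^ (d * Suc (?K d)) / (1 - t ^ d))"
      by (simp add: right_diff_distrib)
  qed
  also have "\<dots> = (\<Sum>d\<in>{1..N}. ?r d / real d) / (1 - t) - (\<Sum>d\<in>{1..N}. ?r d * b d) - (\<Sum>d\<in>{1..N}. ?r d * (t ^ (d * Suc (?K d)) / (1 - t ^ d)))"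
    by (simp only: sum_subtractf sum_divide_distrib)
  also have "\<dots> \<le> 2 * real M / real (N + 1) / (1 - t) + 2 * real M + real N * t ^ N / (1 - t)"
  proof -
    have "(\<Sum>d\<in>{1..N}. ?r d / real d) = Re (harmonic_sum \<psi> N)"
      by (simp add: harmonic_sum_def)
    also have "\<dots> \<le> norm (harmonic_sum \<psi> N)" by (rule complex_Re_le_cmod)
    also have "\<dots> \<le> 2 * real M / real (N + 1)" using harmonic_sum_approx[of N] L by simp
    finally have A: "(\<Sum>d\<in>{1..N}. ?r d / real d) / (1 - t) \<le> 2 * real M / real (N + 1) / (1 - t)"
      using t by (intro divide_right_mono) auto
    have "- (\<Sum>d\<in>{1..N}. ?r d * b d) = - Re (\<Sum>d\<in>{1..<Suc N}. \<psi> d * of_real (b d))"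
      by (simp add: atLeastLessThanSuc_atLeastAtMost)
    also have "\<dots> \<le> norm (\<Sum>d\<in>{1..<Suc N}. \<psi> d * of_real (b d))"
      using abs_Re_le_cmod[of "\<Sum>d\<in>{1..<Suc N}. \<psi> d * of_real (b d)"] by linarith
    also have "\<dots> \<le> 2 * real M * b 1"
      by (rule norm_weighted_sum_le) (use antimono_lambert_difference[OF t] in \<open>auto simp: b_def\<close>)
    also have "b 1 = 1" using t by (simp add: b_def field_simps)
    finally have B: "- (\<Sum>d\<in>{1..N}. ?r d * b d) \<le> 2 * real M" by simp
    have "- (\<Sum>d\<in>{1..N}. ?r d * (t ^ (d * Suc (?K d)) / (1 - t ^ d))) = (\<Sum>d\<in>{1..N}. - ?r d * (t ^ (d * Suc (?K d)) / (1 - t ^ d)))"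
      by (simp add: sum_negf)
    also have "\<dots> \<le> (\<Sum>d\<in>{1..N}. t ^ N / (1 - t))"
    proof (rule sum_mono)
      fix d assume d: "d \<in> {1..N}"
      have "N \<le> d * Suc (?K d)" using d dividend_less_times_div[of d N] by simp
      hence "t ^ (d * Suc (?K d)) \<le> t ^ N" using t by (intro power_decreasing) auto
      hence q: "t ^ (d * Suc (?K d)) / (1 - t ^ d) \<le> t ^ N / (1 - t)" using td[of d] d t by (intro frac_le) auto
      have "- ?r d * (t ^ (d * Suc (?K d)) / (1 - t ^ d)) \<le> 1 * (t ^ N / (1 - t))"
        using q Re_char_cases[of d] td[of d] d t by (intro mult_mono) auto
      thus "- ?r d * (t ^ (d * Suc (?K d)) / (1 - t ^ d)) \<le> t ^ N / (1 - t)" by simp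
    qed
    also have "\<dots> = real N * t ^ N / (1 - t)" by simp
    finally show ?thesis using A B by linarith
  qed
  finally show ?thesis by simp
qed

text \<open>The nonnegative coefficients are at least 1 at squares, so the power series is
  unbounded as \<open>t\<close> tends to 1; the vanishing of \<open>L(1,\<psi>)\<close> would bound it.\<close>

lemma L_one_nonzero_real: "L_one \<psi> \<noteq> 0"
proof
  assume L: "L_one \<psi> = 0"
  \<comment> \<open>The squares up to \<open>K\<^sup>2\<close> contribute at least \<open>K/2\<close> to the power series, while its
    bound is \<open>2 M + 1\<close> for large \<open>N\<close>; \<open>t\<close> is chosen so that \<open>t\<^sup>m \<ge> 1/2\<close> for \<open>m \<le> K\<^sup>2\<close>.\<close>
  define K where "K = 4 * M + 9"
  define t where "t = 1 - 1 / (2 * real K ^ 2)"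
  have K: "K \<ge> 9" by (simp add: K_def)
  have K2: "1 \<le> real K ^ 2" using K by (intro one_le_power) auto
  have "1 / (2 * x) \<le> 1 / 2" "0 < 1 / (2 * x)" if "1 \<le> x" for x :: real
    using that by (simp_all add: field_simps)
  from this[OF K2] have "1 / (2 * real K ^ 2) \<le> 1 / 2" "0 < 1 / (2 * real K ^ 2)" .
  hence t: "0 < t" "t < 1" unfolding t_def by linarith+
  have half: "1 / 2 \<le> t ^ (K ^ 2)"
  proof -
    have "1 + real (K ^ 2) * (- (1 / (2 * real K ^ 2))) \<le> (1 + (- (1 / (2 * real K ^ 2)))) ^ (K ^ 2)"
      using t by (intro Bernoulli_inequality) (simp add: t_def)
    thus ?thesis using K by (simp add: t_def)
  qed
  have "(\<lambda>N. 2 * real M + 2 * real M / real (N + 1) / (1 - t) + real N * t ^ N / (1 - t)) \<longlonglongrightarrow> 2 * real M + 0 / (1 - t) + 0 / (1 - t)"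
  proof (intro tendsto_intros)
    show "(\<lambda>N. 2 * real M / real (N + 1)) \<longlonglongrightarrow> 0" by real_asymp
    show "(\<lambda>N. real N * t ^ N) \<longlonglongrightarrow> 0" using t by (intro powser_times_n_limit_0) auto
  qed (use t in auto)
  hence "\<forall>\<^sub>F N in sequentially. 2 * real M + 2 * real M / real (N + 1) / (1 - t) + real N * t ^ N / (1 - t) < 2 * real M + 1"
    by (rule order_tendstoD) simp
  hence "\<forall>\<^sub>F N in sequentially. N \<ge> K ^ 2 \<and> 2 * real M + 2 * real M / real (N + 1) / (1 - t) + real N * t ^ N / (1 - t) < 2 * real M + 1"
    by (intro eventually_conj eventually_ge_at_top)
  from eventually_happens'[OF sequentially_bot this]
  obtain N where N: "N \<ge> K ^ 2" "2 * real M + 2 * real M / real (N + 1) / (1 - t) + real N * t ^ N / (1 - t) < 2 * real M + 1"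
    by blast
  have "real K * (1 / 2) = (\<Sum>m\<in>{1..K}. 1 / 2)" by simp
  also have "\<dots> \<le> (\<Sum>m\<in>{1..K}. divisor_sum (m ^ 2) * t ^ (m ^ 2))"
  proof (rule sum_mono)
    fix m assume m: "m \<in> {1..K}"
    have "t ^ (K ^ 2) \<le> t ^ (m ^ 2)" using t m by (intro power_decreasing power_mono) auto
    hence "1 * (1 / 2) \<le> divisor_sum (m ^ 2) * t ^ (m ^ 2)"
      using half divisor_sum_bounds[of m] m by (intro mult_mono) auto
    thus "1 / 2 \<le> divisor_sum (m ^ 2) * t ^ (m ^ 2)" by simp
  qed
  also have "\<dots> = (\<Sum>n\<in>(\<lambda>m. m ^ 2) ` {1..K}. divisor_sum n * t ^ n)"
    by (subst sum.reindex) (auto simp: inj_on_def)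
  also have "\<dots> \<le> (\<Sum>n\<in>{1..N}. divisor_sum n * t ^ n)"
  proof (rule sum_mono2)
    show "(\<lambda>m. m ^ 2) ` {1..K} \<subseteq> {1..N}"
      using N(1) by (auto intro: order_trans[OF power_mono])
    show "0 \<le> divisor_sum n * t ^ n" if "n \<in> {1..N} - (\<lambda>m. m ^ 2) ` {1..K}" for n
      using divisor_sum_bounds[of n] that t by auto
  qed auto
  also have "\<dots> < 2 * real M + 1" using divisor_sum_power_series_upper[OF L t, of N] N(2) by linarith
  finally show False by (simp add: K_def)
qed

end
end

section \<open>Primes in residue classes\<close>

lemma is_log_bij_hom:
  assumes "prime p" "odd p" "is_log p lg"
  shows "bij_betw lg {0<..<int p} {0..<int (p - 1)}"
    and "\<And>x y. x \<in> {0<..<int p} \<Longrightarrow> y \<in> {0<..<int p} \<Longrightarrow> lg (x * y mod int p) = (lg x + lg y) mod int (p - 1)"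
    and "lg 1 = 0"
    and "carrier (mult_group p) = {0<..<int p}"
proof -
  have p2: "p > 2" using assms prime_gt_1_nat[of p] by (cases "p = 2") auto
  interpret R: residues_prime p "residue_ring p"
    using assms by (simp_all add: residues_prime_def)
  show car: "carrier (mult_group p) = {0<..<int p}"
    using assms by (auto simp: mult_group_def units_of_carrier R.res_prime_units_eq)
  have carn: "carrier (integer_mod_group (p - 1)) = {0..<int (p - 1)}"
    using p2 by (simp add: carrier_integer_mod_group)
  have iso: "lg \<in> iso (mult_group p) (integer_mod_group (p - 1))" using assms by (simp add: is_log_def)
  show bij: "bij_betw lg {0<..<int p} {0..<int (p - 1)}"
    using iso by (simp only: iso_def car carn mem_Collect_eq)
  have hom: "lg \<in> hom (mult_group p) (integer_mod_group (p - 1))" using iso by (simp add: iso_def)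
  show mult: "lg (x * y mod int p) = (lg x + lg y) mod int (p - 1)"
    if "x \<in> {0<..<int p}" "y \<in> {0<..<int p}" for x y
    using hom_mult[OF hom, of x y] that car p2
    by (simp add: mult_group_def units_of_mult residue_ring_def)
  have "lg 1 \<in> {0..<int (p - 1)}" using bij p2 by (auto simp: bij_betw_def)
  moreover have "lg 1 = (lg 1 + lg 1) mod int (p - 1)" using mult[of 1 1] p2 by simp
  hence "[lg 1 + 0 = lg 1 + lg 1] (mod int (p - 1))" using calculation by (simp add: cong_def)
  hence "[0 = lg 1] (mod int (p - 1))" by (simp only: cong_add_lcancel)
  ultimately show "lg 1 = 0" using p2 by (simp add: cong_def)
qed

lemma exp_2pi_eq_1_iff:
  assumes "n > 0"
  shows "exp (2 * of_real pi * \<i> * of_int x / of_nat n) = (1::complex) \<longleftrightarrow> int n dvd x"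
proof -
  have "exp (2 * of_real pi * \<i> * of_int x / of_nat n) = (1::complex) \<longleftrightarrow> (\<exists>k::int. real_of_int x / real n = real_of_int k)"
    unfolding exp_eq_1 using assms by (auto simp: field_simps Re_divide Im_divide power2_eq_square)
  also have "\<dots> \<longleftrightarrow> (\<exists>k::int. x = int n * k)"
  proof -
    have "real_of_int x / real n = real_of_int k \<longleftrightarrow> x = int n * k" for k
    proof -
      have "real_of_int x / real n = real_of_int k \<longleftrightarrow> real_of_int x = real_of_int (int n * k)"
        using assms by (simp add: field_simps)
      also have "\<dots> \<longleftrightarrow> x = int n * k" by (simp only: of_int_eq_iff)
      finally show ?thesis .
    qed
    thus ?thesis by simp
  qed
  finally show ?thesis by (simp add: dvd_def)
qed

definition dirichlet_chars :: "nat \<Rightarrow> (nat \<Rightarrow> complex) set" where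
  "dirichlet_chars M = {\<psi>. dirichlet_char M \<psi>}"

text \<open>A character is determined by its values on one period, which are 0 or roots of
  unity of a fixed order.\<close>

lemma finite_dirichlet_chars:
  assumes "M > 0"
  shows "finite (dirichlet_chars M)"
proof -
  let ?R = "insert 0 {z::complex. z ^ totient M = 1}"
  have "totient M \<ge> 1" using assms by (simp add: Suc_le_eq)
  hence fin: "finite ?R" using finite_roots_unity[of "totient M"] by auto
  have "dirichlet_chars M \<subseteq> (\<lambda>f n. f (n mod M)) ` ({..<M} \<rightarrow>\<^sub>E ?R)"
  proof
    fix \<psi> assume "\<psi> \<in> dirichlet_chars M"
    then interpret dirichlet_char M \<psi> by (simp add: dirichlet_chars_def)
    have "\<psi> = (\<lambda>n. restrict \<psi> {..<M} (n mod M))" using M_pos by auto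
    moreover have "\<psi> n \<in> ?R" for n using power_totient[of n] nonzero_iff[of n] by auto
    hence "restrict \<psi> {..<M} \<in> {..<M} \<rightarrow>\<^sub>E ?R" by auto
    ultimately show "\<psi> \<in> (\<lambda>f n. f (n mod M)) ` ({..<M} \<rightarrow>\<^sub>E ?R)" by blast
  qed
  thus ?thesis using fin by (meson finite_PiE finite_imageI finite_lessThan finite_subset)
qed

definition principal_char :: "nat \<Rightarrow> nat \<Rightarrow> complex" where
  "principal_char M n = (if coprime n M then 1 else 0)"

lemma coprime_add_self: "coprime (n + M) M \<longleftrightarrow> coprime n (M::nat)"
  by (simp only: coprime_iff_gcd_eq_1 gcd_add1)

lemma principal_char_in: "M > 0 \<Longrightarrow> principal_char M \<in> dirichlet_chars M"
  unfolding dirichlet_chars_def mem_Collect_eq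
  by unfold_locales (auto simp: principal_char_def coprime_add_self)

lemma nonprincipal_charI:
  assumes "\<psi> \<in> dirichlet_chars M" "\<psi> \<noteq> principal_char M"
  shows "nonprincipal_char M \<psi>"
proof -
  interpret dirichlet_char M \<psi> using assms by (simp add: dirichlet_chars_def)
  from assms(2) obtain n where "\<psi> n \<noteq> principal_char M n" by auto
  hence "coprime n M" "\<psi> n \<noteq> 1" using nonzero_iff[of n] by (auto simp: principal_char_def split: if_splits)
  thus ?thesis by unfold_locales auto
qed

lemma char_mult_in:
  assumes "\<psi> \<in> dirichlet_chars M" "\<phi> \<in> dirichlet_chars M"
  shows "(\<lambda>n. \<psi> n * \<phi> n) \<in> dirichlet_chars M"
proof -
  interpret A: dirichlet_char M \<psi> using assms by (simp add: dirichlet_chars_def)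
  interpret B: dirichlet_char M \<phi> using assms by (simp add: dirichlet_chars_def)
  show ?thesis unfolding dirichlet_chars_def mem_Collect_eq
    by unfold_locales (use A.M_pos A.nonzero_iff B.nonzero_iff in \<open>auto simp: A.mult B.mult A.periodic B.periodic\<close>)
qed

lemma char_cnj_in:
  assumes "\<psi> \<in> dirichlet_chars M"
  shows "(\<lambda>n. cnj (\<psi> n)) \<in> dirichlet_chars M"
proof -
  interpret A: dirichlet_char M \<psi> using assms by (simp add: dirichlet_chars_def)
  show ?thesis unfolding dirichlet_chars_def mem_Collect_eq
    by unfold_locales (use A.M_pos A.nonzero_iff in \<open>auto simp: A.mult A.periodic\<close>)
qed

text \<open>Compose reduction modulo \<open>q\<close>, a discrete logarithm modulo \<open>q\<close> and a faithful character
  of \<open>\<int>/(q-1)\<close>.\<close>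

lemma exists_char_prime_factor:
  assumes M: "M > 0" "q dvd M" and q: "prime q" and a: "coprime a M" "\<not> [a = 1] (mod q)"
  shows "\<exists>\<psi>\<in>dirichlet_chars M. \<psi> a \<noteq> 1"
proof -
  have "q \<noteq> 2"
  proof
    assume "q = 2"
    hence "odd a" using a(1) M(2) by (meson coprime_common_divisor odd_one)
    hence "[a = 1] (mod q)" using \<open>q = 2\<close> by (auto simp: cong_def odd_iff_mod_2_eq_one)
    thus False using a by simp
  qed
  hence oddq: "odd q" using q by (metis primes_dvd_imp_eq two_is_prime_nat)
  have q1: "q > 1" using q by (rule prime_gt_1_nat)
  obtain lg where lg: "is_log q lg" using ex_is_log[OF q oddq] by auto
  note L = is_log_bij_hom[OF q oddq lg]
  define e where "e x = exp (2 * of_real pi * \<i> * of_int x / of_nat (q - 1))" for x :: int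
  have e_add: "e (x + y) = e x * e y" for x y
    by (simp add: e_def exp_add[symmetric] ring_distribs add_divide_distrib)
  have e_1: "e x = 1 \<longleftrightarrow> int (q - 1) dvd x" for x
    unfolding e_def using q1 by (intro exp_2pi_eq_1_iff) simp
  have e_mod: "e (x mod int (q - 1)) = e x" for x
  proof -
    have "e x = e (int (q - 1) * (x div int (q - 1))) * e (x mod int (q - 1))"
      by (simp flip: e_add)
    thus ?thesis by (simp add: e_1)
  qed
  have cop: "coprime n q" if "coprime n M" for n
    using that M(2) by (meson coprime_divisors dvd_refl)
  have range: "int (n mod q) \<in> {0<..<int q}" if "coprime n M" for n
  proof -
    have "n mod q \<noteq> 0" using cop[OF that] q1 by (metis coprime_iff_gcd_eq_1 gcd.commute gcd_red_nat gcd_0_nat less_irrefl)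
    thus ?thesis using q1 by auto
  qed
  define \<psi> where "\<psi> n = (if coprime n M then e (lg (int (n mod q))) else 0)" for n
  have "dirichlet_char M \<psi>"
  proof
    show "\<psi> (m * n) = \<psi> m * \<psi> n" for m n
    proof (cases "coprime m M \<and> coprime n M")
      case True
      have "int (m * n mod q) = int (m mod q) * int (n mod q) mod int q" by (simp add: zmod_int mod_mult_eq)
      hence "lg (int (m * n mod q)) = (lg (int (m mod q)) + lg (int (n mod q))) mod int (q - 1)"
        using L(2)[OF range range, of m n] True by simp
      thus ?thesis using True by (simp add: \<psi>_def e_mod[simplified] e_add)
    qed (auto simp: \<psi>_def)
    show "\<psi> (n + M) = \<psi> n" for n
    proof -
      obtain k where "M = q * k" using M(2) by auto
      hence "(n + M) mod q = n mod q" by simp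
      moreover have "coprime (n + M) M \<longleftrightarrow> coprime n M" by (rule coprime_add_self)
      ultimately show ?thesis by (simp only: \<psi>_def)
    qed
  qed (use M in \<open>auto simp: \<psi>_def e_def\<close>)
  moreover have "\<psi> a \<noteq> 1"
  proof
    assume "\<psi> a = 1"
    hence "int (q - 1) dvd lg (int (a mod q))" using a by (simp add: \<psi>_def e_1)
    moreover have "lg (int (a mod q)) \<in> {0..<int (q - 1)}" using L(1) range[OF a(1)] by (auto simp: bij_betw_def)
    ultimately have "lg (int (a mod q)) = lg 1" using L(3) by (auto dest: zdvd_not_zless simp: le_less)
    moreover have "1 \<in> {0<..<int q}" using q1 by simp
    ultimately have "int (a mod q) = 1" using L(1) range[OF a(1)] by (auto simp: bij_betw_def dest: inj_onD)
    hence "[a = 1] (mod q)" using q1 by (simp add: cong_def)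
    thus False using a by simp
  qed
  ultimately show ?thesis unfolding dirichlet_chars_def by blast
qed

text \<open>Multiplication by a character that separates \<open>a\<close> from 1 permutes the characters. It
  exists because residues that agree modulo every prime factor of the squarefree \<open>M\<close>
  agree modulo \<open>M\<close>.\<close>

lemma sum_dirichlet_chars:
  assumes S: "finite S" "\<And>q. q \<in> S \<Longrightarrow> prime q" and M: "M = \<Prod>S"
  shows "(\<Sum>\<psi>\<in>dirichlet_chars M. \<psi> a) = (if [a = 1] (mod M) then of_nat (card (dirichlet_chars M)) else 0)"
proof -
  have M0: "M > 0" using S M by (auto intro!: prod_pos simp: prime_gt_0_nat)
  have one: "\<psi> a = 1" if "\<psi> \<in> dirichlet_chars M" "[a = 1] (mod M)" for \<psi>
  proof -
    interpret dirichlet_char M \<psi> using that by (simp add: dirichlet_chars_def)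
    show ?thesis using cong_imp_eq[OF that(2)] by simp
  qed
  show ?thesis
  proof (cases "coprime a M")
    case False
    have "\<psi> a = 0" if "\<psi> \<in> dirichlet_chars M" for \<psi>
      using that False dirichlet_char.nonzero_iff[of M \<psi> a] by (auto simp: dirichlet_chars_def)
    moreover have "\<not> [a = 1] (mod M)" using False by (metis cong_imp_coprime cong_sym coprime_1_left)
    ultimately show ?thesis by (simp add: sum.neutral)
  next
    case True
    show ?thesis
    proof (cases "[a = 1] (mod M)")
      case True
      have "(\<Sum>\<psi>\<in>dirichlet_chars M. \<psi> a) = (\<Sum>\<psi>\<in>dirichlet_chars M. 1)"
        by (intro sum.cong refl one True)
      thus ?thesis using True by simp
    next
      case False
      have "\<exists>q\<in>S. \<not> [a = 1] (mod q)"
      proof (rule ccontr)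
        assume "\<not> (\<exists>q\<in>S. \<not> [a = 1] (mod q))"
        hence "[a = 1] (mod \<Prod>S)" using S
          by (intro coprime_cong_prod_nat[where m = "\<lambda>x. x"]) (auto simp: primes_coprime)
        thus False using False M by simp
      qed
      then obtain q where q: "q \<in> S" "\<not> [a = 1] (mod q)" by auto
      then obtain \<phi> where \<phi>: "\<phi> \<in> dirichlet_chars M" "\<phi> a \<noteq> 1"
        using exists_char_prime_factor[of M q a] M0 S M True by (auto intro: dvd_prodI)
      interpret P: dirichlet_char M \<phi> using \<phi> by (simp add: dirichlet_chars_def)
      let ?f = "\<lambda>\<psi> n. \<phi> n * \<psi> n"
      have inj: "inj_on ?f (dirichlet_chars M)"
      proof (rule inj_onI, rule ext)
        fix \<psi> \<psi>' n assume *: "\<psi> \<in> dirichlet_chars M" "\<psi>' \<in> dirichlet_chars M" "?f \<psi> = ?f \<psi>'"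
        have "\<phi> n * \<psi> n = \<phi> n * \<psi>' n" using fun_cong[OF *(3)] by simp
        moreover have "\<psi> n = 0" "\<psi>' n = 0" if "\<phi> n = 0"
          using that P.nonzero_iff[of n] *(1,2) dirichlet_char.nonzero_iff[of M \<psi> n]
            dirichlet_char.nonzero_iff[of M \<psi>' n] by (simp_all add: dirichlet_chars_def)
        ultimately show "\<psi> n = \<psi>' n" by (cases "\<phi> n = 0") simp_all
      qed
      have "?f ` dirichlet_chars M = dirichlet_chars M"
        using inj \<phi> finite_dirichlet_chars[OF M0] by (intro endo_inj_surj) (auto intro: char_mult_in)
      hence "(\<Sum>\<psi>\<in>dirichlet_chars M. \<psi> a) = (\<Sum>\<psi>\<in>?f ` dirichlet_chars M. \<psi> a)" by simp
      also have "\<dots> = \<phi> a * (\<Sum>\<psi>\<in>dirichlet_chars M. \<psi> a)"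
        unfolding sum.reindex[OF inj] by (simp add: sum_distrib_left)
      finally show ?thesis using \<phi> False by simp
    qed
  qed
qed

lemma L_one_cnj:
  assumes "nonprincipal_char M \<psi>"
  shows "L_one (\<lambda>n. cnj (\<psi> n)) = cnj (L_one \<psi>)"
proof -
  have "(\<lambda>N. cnj (harmonic_sum \<psi> N)) \<longlonglongrightarrow> cnj (L_one \<psi>)"
    by (intro tendsto_cnj nonprincipal_char.harmonic_sum_tendsto[OF assms])
  moreover have "(\<lambda>N. cnj (harmonic_sum \<psi> N)) = harmonic_sum (\<lambda>n. cnj (\<psi> n))"
    by (simp add: harmonic_sum_def fun_eq_iff)
  ultimately show ?thesis unfolding L_one_def[of "\<lambda>n. cnj (\<psi> n)"] by (metis limI)
qed

definition mangoldt_sum_class :: "nat \<Rightarrow> nat \<Rightarrow> nat \<Rightarrow> real" where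
  "mangoldt_sum_class M a N = (\<Sum>n | n \<in> {1..N} \<and> [n = a] (mod M). mangoldt n / real n)"

lemma sum_chars_mangoldt:
  assumes S: "finite S" "\<And>q. q \<in> S \<Longrightarrow> prime q" and M: "M = \<Prod>S" and ab: "[a * b = 1] (mod M)"
  shows "(\<Sum>\<psi>\<in>dirichlet_chars M. \<psi> b * mangoldt_sum_char \<psi> N) = of_real (card (dirichlet_chars M) * mangoldt_sum_class M a N)"
proof -
  have iff: "[b * n = 1] (mod M) \<longleftrightarrow> [n = a] (mod M)" for n
  proof
    assume "[b * n = 1] (mod M)"
    hence "[a * (b * n) = a * 1] (mod M)" by (intro cong_mult cong_refl)
    moreover have "[a * b * n = 1 * n] (mod M)" using ab by (intro cong_mult cong_refl)
    ultimately show "[n = a] (mod M)" by (simp add: mult.assoc) (metis cong_sym cong_trans)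
  next
    assume "[n = a] (mod M)"
    hence "[b * n = b * a] (mod M)" by (intro cong_mult cong_refl)
    thus "[b * n = 1] (mod M)" using ab by (metis cong_trans mult.commute)
  qed
  have "(\<Sum>\<psi>\<in>dirichlet_chars M. \<psi> b * mangoldt_sum_char \<psi> N) = (\<Sum>\<psi>\<in>dirichlet_chars M. \<Sum>n\<in>{1..N}. \<psi> (b * n) * (mangoldt n / of_nat n))"
    unfolding mangoldt_sum_char_def sum_distrib_left
  proof (intro sum.cong refl)
    fix \<psi> n assume "\<psi> \<in> dirichlet_chars M"
    then interpret dirichlet_char M \<psi> by (simp add: dirichlet_chars_def)
    show "\<psi> b * (\<psi> n * mangoldt n / of_nat n) = \<psi> (b * n) * (mangoldt n / of_nat n)" by (simp add: mult)
  qed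
  also have "\<dots> = (\<Sum>n\<in>{1..N}. (\<Sum>\<psi>\<in>dirichlet_chars M. \<psi> (b * n)) * (mangoldt n / of_nat n))"
    by (subst sum.swap) (simp only: sum_distrib_right)
  also have "\<dots> = (\<Sum>n\<in>{1..N}. if [n = a] (mod M) then of_nat (card (dirichlet_chars M)) * (mangoldt n / of_nat n) else 0)"
    by (intro sum.cong refl) (simp add: sum_dirichlet_chars[OF S M] iff[unfolded One_nat_def])
  also have "\<dots> = (\<Sum>n | n \<in> {1..N} \<and> [n = a] (mod M). of_nat (card (dirichlet_chars M)) * (mangoldt n / of_nat n))"
    by (subst sum.inter_filter[symmetric]) auto
  also have "\<dots> = of_real (card (dirichlet_chars M) * mangoldt_sum_class M a N)"
    by (simp add: mangoldt_sum_class_def sum_distrib_left)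
  finally show ?thesis .
qed

lemma mangoldt_sum_principal:
  assumes "M > 0"
  shows "\<exists>C. \<forall>N\<ge>1. norm (mangoldt_sum_char (principal_char M) N - of_real (ln (real N))) \<le> C"
proof (intro exI allI impI)
  fix N :: nat assume N: "N \<ge> 1"
  have "mangoldt_sum_char (principal_char M) N = (\<Sum>n\<in>{1..N}. if coprime n M then mangoldt n / of_nat n else 0)"
    unfolding mangoldt_sum_char_def by (intro sum.cong refl) (simp add: principal_char_def)
  also have "\<dots> = (\<Sum>n | n \<in> {1..N} \<and> coprime n M. mangoldt n / of_nat n)"
    by (subst sum.inter_filter[symmetric]) auto
  also have "\<dots> = of_real (\<Sum>n | n \<in> {1..N} \<and> coprime n M. mangoldt n / real n)" by simp
  finally have "mangoldt_sum_char (principal_char M) N - of_real (ln (real N)) = of_real ((\<Sum>n | n \<in> {1..N} \<and> coprime n M. mangoldt n / real n) - ln (real N))"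
    by simp
  thus "norm (mangoldt_sum_char (principal_char M) N - of_real (ln (real N))) \<le> 4 + (\<Sum>q\<in>prime_factors M. ln (real q))"
    using sum_mangoldt_coprime[OF assms N] by (simp only: norm_of_real)
qed

text \<open>Three cases: principal, \<open>L(1,\<psi>) = 0\<close> and \<open>L(1,\<psi>) \<noteq> 0\<close>. The weight \<open>w\<close> is the residue at 1
  of \<open>- L'/L\<close>, a zero being counted as simple.\<close>

lemma mangoldt_sum_char_asymp:
  assumes "\<psi> \<in> dirichlet_chars M" "M > 0"
  defines "w \<equiv> (if \<psi> = principal_char M then 1 else if L_one \<psi> = 0 then -1 else 0 :: real)"
  shows "\<exists>C. \<forall>N\<ge>1. norm (mangoldt_sum_char \<psi> N - of_real (w * ln (real N))) \<le> C"
proof (cases "\<psi> = principal_char M")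
  case True
  thus ?thesis using mangoldt_sum_principal[OF assms(2)] by (simp add: w_def)
next
  case False
  interpret nonprincipal_char M \<psi> using assms(1) False by (rule nonprincipal_charI)
  show ?thesis
  proof (cases "L_one \<psi> = 0")
    case True
    show ?thesis using mangoldt_sum_char_if_zero[OF True] True False
      by (intro exI[of _ "2 * real M"]) (simp add: w_def)
  next
    case nz: False
    show ?thesis using mangoldt_sum_char_bounded[OF nz] False nz by (auto simp: w_def)
  qed
qed

text \<open>Adding the asymptotics over all characters gives a nonnegative sum over the class
  of 1 on one side and \<open>(1 - z) ln N + O(1)\<close> on the other, where \<open>z\<close> is the number of
  characters with \<open>L(1,\<psi>) = 0\<close>. Hence \<open>z \<le> 1\<close>. The conjugate of a vanishing character also
  vanishes, so such a character would be real.\<close>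

lemma L_one_nonzero:
  assumes S: "finite S" "\<And>q. q \<in> S \<Longrightarrow> prime q" and M: "M = \<Prod>S"
    and \<psi>: "\<psi> \<in> dirichlet_chars M" "\<psi> \<noteq> principal_char M"
  shows "L_one \<psi> \<noteq> 0"
proof
  assume zero: "L_one \<psi> = 0"
  have M0: "M > 0" using S M by (auto intro!: prod_pos simp: prime_gt_0_nat)
  let ?D = "dirichlet_chars M"
  note fin = finite_dirichlet_chars[OF M0]
  define w :: "(nat \<Rightarrow> complex) \<Rightarrow> real" where "w = (\<lambda>\<psi>. if \<psi> = principal_char M then 1 else if L_one \<psi> = 0 then -1 else 0)"
  have "\<forall>\<psi>\<in>?D. \<exists>C. \<forall>N\<ge>1. norm (mangoldt_sum_char \<psi> N - of_real (w \<psi> * ln (real N))) \<le> C"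
  proof
    fix \<psi> assume "\<psi> \<in> ?D"
    from mangoldt_sum_char_asymp[OF this M0]
    show "\<exists>C. \<forall>N\<ge>1. norm (mangoldt_sum_char \<psi> N - of_real (w \<psi> * ln (real N))) \<le> C"
      by (simp only: w_def)
  qed
  then obtain C where C: "\<And>\<psi> N. \<psi> \<in> ?D \<Longrightarrow> N \<ge> 1 \<Longrightarrow> norm (mangoldt_sum_char \<psi> N - of_real (w \<psi> * ln (real N))) \<le> C \<psi>"
    by metis
  \<comment> \<open>One minus the number of nonprincipal characters with \<open>L(1,\<psi>) = 0\<close>.\<close>
  define W where "W = (\<Sum>\<psi>\<in>?D. w \<psi>)"
  have bound: "real (card ?D) * mangoldt_sum_class M 1 N - W * ln (real N) \<le> (\<Sum>\<psi>\<in>?D. C \<psi>)"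
    "W * ln (real N) \<ge> - (\<Sum>\<psi>\<in>?D. C \<psi>)" if N: "N \<ge> 1" for N
  proof -
    have "(\<Sum>\<psi>\<in>?D. \<psi> 1 * mangoldt_sum_char \<psi> N) = of_real (card ?D * mangoldt_sum_class M 1 N)"
      by (rule sum_chars_mangoldt[OF S M]) auto
    moreover have "(\<Sum>\<psi>\<in>?D. \<psi> 1 * mangoldt_sum_char \<psi> N) = (\<Sum>\<psi>\<in>?D. mangoldt_sum_char \<psi> N)"
      by (intro sum.cong refl) (auto simp: dirichlet_chars_def dirichlet_char.at_one)
    ultimately have "of_real (card ?D * mangoldt_sum_class M 1 N - W * ln (real N)) = (\<Sum>\<psi>\<in>?D. mangoldt_sum_char \<psi> N - of_real (w \<psi> * ln (real N)))"
      by (simp add: sum_subtractf W_def sum_distrib_right)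
    also have "norm \<dots> \<le> (\<Sum>\<psi>\<in>?D. C \<psi>)" using C N by (intro sum_norm_le) auto
    finally have "\<bar>card ?D * mangoldt_sum_class M 1 N - W * ln (real N)\<bar> \<le> (\<Sum>\<psi>\<in>?D. C \<psi>)" by (simp only: norm_of_real)
    moreover have "0 \<le> card ?D * mangoldt_sum_class M 1 N"
      unfolding mangoldt_sum_class_def by (intro mult_nonneg_nonneg sum_nonneg divide_nonneg_nonneg mangoldt_nonneg) auto
    ultimately show "real (card ?D) * mangoldt_sum_class M 1 N - W * ln (real N) \<le> (\<Sum>\<psi>\<in>?D. C \<psi>)"
    "W * ln (real N) \<ge> - (\<Sum>\<psi>\<in>?D. C \<psi>)" by linarith+
  qed
  have "W \<ge> 0"
  proof (rule ccontr)
    assume "\<not> W \<ge> 0"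
    obtain N :: nat where N: "N \<ge> 1" "ln (real N) > (\<Sum>\<psi>\<in>?D. C \<psi>) / (- W)"
    proof -
      have "filterlim (\<lambda>N. ln (real N)) at_top sequentially" by real_asymp
      hence "\<forall>\<^sub>F N in sequentially. ln (real N) > (\<Sum>\<psi>\<in>?D. C \<psi>) / (- W)" by (simp add: filterlim_at_top_dense)
      hence "\<forall>\<^sub>F N in sequentially. N \<ge> 1 \<and> ln (real N) > (\<Sum>\<psi>\<in>?D. C \<psi>) / (- W)"
        by (intro eventually_conj eventually_ge_at_top)
      from eventually_happens'[OF sequentially_bot this] show ?thesis using that by blast
    qed
    from N(2) \<open>\<not> W \<ge> 0\<close> have "(\<Sum>\<psi>\<in>?D. C \<psi>) < (- W) * ln (real N)" by (simp add: field_simps)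
    thus False using bound(2)[OF N(1)] by simp
  qed
  define V where "V = {\<phi> \<in> ?D. \<phi> \<noteq> principal_char M \<and> L_one \<phi> = 0}"
  have finV: "finite V" using fin by (simp add: V_def)
  have "W = (\<Sum>\<phi>\<in>insert (principal_char M) V. w \<phi>)"
    unfolding W_def using fin principal_char_in[OF M0] by (intro sum.mono_neutral_right) (auto simp: V_def w_def)
  also have "\<dots> = 1 + (\<Sum>\<phi>\<in>V. -1)"
    using finV by (subst sum.insert) (auto simp: V_def w_def intro!: sum.cong)
  finally have "real (card V) \<le> 1" using \<open>W \<ge> 0\<close> by simp
  hence "card V \<le> 1" by simp
  interpret nonprincipal_char M \<psi> using \<psi> by (rule nonprincipal_charI)
  have "\<psi> \<in> V" using \<psi> zero by (simp add: V_def)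
  moreover have "(\<lambda>n. cnj (\<psi> n)) \<in> V"
  proof -
    have "(\<lambda>n. cnj (\<psi> n)) \<noteq> principal_char M"
    proof
      assume *: "(\<lambda>n. cnj (\<psi> n)) = principal_char M"
      have "\<psi> n = principal_char M n" for n
      proof -
        have "cnj (cnj (\<psi> n)) = cnj (principal_char M n)" using fun_cong[OF *, of n] by simp
        thus ?thesis by (simp add: principal_char_def split: if_splits)
      qed
      thus False using \<psi>(2) by auto
    qed
    thus ?thesis using \<psi>(1) zero char_cnj_in L_one_cnj[OF nonprincipal_char_axioms] by (simp add: V_def)
  qed
  moreover have "\<forall>x\<in>V. \<forall>y\<in>V. x = y" using \<open>card V \<le> 1\<close> card_le_Suc0_iff_eq[OF finV] by simp
  ultimately have "\<psi> = (\<lambda>n. cnj (\<psi> n))" by blast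
  hence "cnj (\<psi> n) = \<psi> n" for n by (rule fun_cong[symmetric])
  hence "\<psi> n \<in> \<real>" for n by (simp only: Reals_cnj_iff)
  from L_one_nonzero_real[OF this] show False using zero by simp
qed

text \<open>Mertens' theorem for a residue class. Multiplying by \<open>\<psi> b\<close>, with \<open>b\<close> the inverse of \<open>a\<close>,
  detects the class by orthogonality, and only the principal character contributes to
  the main term.\<close>

theorem mangoldt_sum_class_asymp:
  assumes S: "finite S" "\<And>q. q \<in> S \<Longrightarrow> prime q" and M: "M = \<Prod>S" and a: "coprime a M"
  shows "\<exists>D>0. \<exists>C. \<forall>N\<ge>1. \<bar>D * mangoldt_sum_class M a N - ln (real N)\<bar> \<le> C"
proof -
  have M0: "M > 0" using S M by (auto intro!: prod_pos simp: prime_gt_0_nat)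
  let ?D = "dirichlet_chars M"
  note fin = finite_dirichlet_chars[OF M0]
  obtain b where b: "[a * b = 1] (mod M)" using cong_solve_coprime_nat[OF a] by auto
  have copb: "coprime b M" using b by (metis coprime_iff_invertible_nat mult.commute One_nat_def)
  define w :: "(nat \<Rightarrow> complex) \<Rightarrow> real" where "w = (\<lambda>\<psi>. if \<psi> = principal_char M then 1 else 0)"
  have "\<forall>\<psi>\<in>?D. \<exists>C. \<forall>N\<ge>1. norm (mangoldt_sum_char \<psi> N - of_real (w \<psi> * ln (real N))) \<le> C"
  proof
    fix \<psi> assume psi: "\<psi> \<in> ?D"
    from mangoldt_sum_char_asymp[OF this M0] L_one_nonzero[OF S M psi]
    show "\<exists>C. \<forall>N\<ge>1. norm (mangoldt_sum_char \<psi> N - of_real (w \<psi> * ln (real N))) \<le> C"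
      by (auto simp add: w_def split: if_splits)
  qed
  then obtain C where C: "\<And>\<psi> N. \<psi> \<in> ?D \<Longrightarrow> N \<ge> 1 \<Longrightarrow> norm (mangoldt_sum_char \<psi> N - of_real (w \<psi> * ln (real N))) \<le> C \<psi>"
    by metis
  have "\<bar>real (card ?D) * mangoldt_sum_class M a N - ln (real N)\<bar> \<le> (\<Sum>\<psi>\<in>?D. C \<psi>)" if N: "N \<ge> 1" for N
  proof -
    have "of_real (card ?D * mangoldt_sum_class M a N) = (\<Sum>\<psi>\<in>?D. \<psi> b * mangoldt_sum_char \<psi> N)"
      by (rule sum_chars_mangoldt[OF S M b, symmetric])
    moreover have "of_real (ln (real N)) = (\<Sum>\<psi>\<in>?D. \<psi> b * of_real (w \<psi> * ln (real N)))"
    proof -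
      have "(\<Sum>\<psi>\<in>?D. \<psi> b * of_real (w \<psi> * ln (real N))) = (\<Sum>\<psi>\<in>?D. if \<psi> = principal_char M then of_real (ln (real N)) else 0)"
        using copb by (intro sum.cong refl) (auto simp: w_def principal_char_def)
      also have "\<dots> = of_real (ln (real N))" using fin principal_char_in[OF M0] by simp
      finally show ?thesis ..
    qed
    ultimately have "of_real (card ?D * mangoldt_sum_class M a N - ln (real N)) = (\<Sum>\<psi>\<in>?D. \<psi> b * (mangoldt_sum_char \<psi> N - of_real (w \<psi> * ln (real N))))"
      by (simp add: sum_subtractf right_diff_distrib)
    also have "norm \<dots> \<le> (\<Sum>\<psi>\<in>?D. C \<psi>)"
    proof (rule sum_norm_le)
      fix \<psi> assume psi: "\<psi> \<in> ?D"
      have "norm (\<psi> b) \<le> 1" using psi by (simp add: dirichlet_chars_def dirichlet_char.norm_le_1)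
      hence "norm (\<psi> b * (mangoldt_sum_char \<psi> N - of_real (w \<psi> * ln (real N)))) \<le> 1 * C \<psi>"
        unfolding norm_mult using C[OF psi N] by (intro mult_mono) auto
      thus "norm (\<psi> b * (mangoldt_sum_char \<psi> N - of_real (w \<psi> * ln (real N)))) \<le> C \<psi>" by simp
    qed
    finally show ?thesis by (simp only: norm_of_real)
  qed
  moreover have "card ?D > 0" using fin principal_char_in[OF M0] by (auto simp: card_gt_0_iff)
  ultimately show ?thesis by (intro exI[of _ "real (card ?D)"]) auto
qed

text \<open>Two values of the asymptotic formula at \<open>N\<close> and \<open>K N\<close> differ by \<open>ln K\<close> up to a bounded
  error, so for large \<open>K\<close> the class has weight at least \<open>N\<close> between them. Proper prime
  powers are negligible.\<close>

lemma primes_in_class_lower: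
  assumes S: "finite S" "\<And>q. q \<in> S \<Longrightarrow> prime q" and M: "M = \<Prod>S" and a: "coprime a M"
  shows "\<exists>c>0. \<forall>\<^sub>F X in sequentially. c * real X \<le> real (card {p \<in> primes_upto X. [p = a] (mod M)}) * ln (real X)"
proof -
  obtain D C where D: "D > 0" and C: "\<And>N. N \<ge> 1 \<Longrightarrow> \<bar>D * mangoldt_sum_class M a N - ln (real N)\<bar> \<le> C"
    using mangoldt_sum_class_asymp[OF S M a] by blast
  let ?T = "mangoldt_sum_class M a"
  \<comment> \<open>\<open>ln K\<close> has to absorb the error \<open>C\<close> twice and leave \<open>D\<close>.\<close>
  define K where "K = nat \<lceil>exp (2 * C + D)\<rceil>"
  have K: "exp (2 * C + D) \<le> real K" unfolding K_def by linarith
  have "0 < real K" using K exp_gt_zero[of "2 * C + D"] by linarith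
  moreover have "ln (exp (2 * C + D)) \<le> ln (real K)" using K calculation by (subst ln_le_cancel_iff) auto
  ultimately have K0: "K > 0" "2 * C + D \<le> ln (real K)" by simp_all
  let ?A = "\<lambda>X. {n. n \<in> {1..X} \<and> [n = a] (mod M)}"
  have block: "real N \<le> (\<Sum>n\<in>?A (K * N). mangoldt n)" if N: "N \<ge> 1" for N
  proof -
    have "ln (real (K * N)) = ln (real K) + ln (real N)" using K0 N by (simp add: ln_mult)
    moreover have "N \<le> K * N" using K0 by simp
    moreover have "1 \<le> K * N" using N calculation(2) by linarith
    ultimately have "D \<le> D * ?T (K * N) - D * ?T N"
      using C[OF N] C[of "K * N"] K0(2) by linarith
    hence "D * 1 \<le> D * (?T (K * N) - ?T N)" by (simp add: right_diff_distrib)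
    hence "1 \<le> ?T (K * N) - ?T N" using D by simp
    also have "?T (K * N) = ?T N + (\<Sum>n\<in>?A (K*N) - ?A N. mangoldt n / real n)"
    proof -
      have "?A N \<subseteq> ?A (K * N)" using order_trans[OF _ \<open>N \<le> K * N\<close>] by auto
      thus ?thesis unfolding mangoldt_sum_class_def by (subst sum.subset_diff) auto
    qed
    finally have "1 \<le> (\<Sum>n\<in>?A (K*N) - ?A N. mangoldt n / real n)" by simp
    also have "\<dots> \<le> (\<Sum>n\<in>?A (K*N) - ?A N. mangoldt n / real N)"
      using N by (intro sum_mono divide_left_mono mangoldt_nonneg) auto
    also have "\<dots> = (\<Sum>n\<in>?A (K*N) - ?A N. mangoldt n) / real N" by (simp add: sum_divide_distrib)
    finally have "real N \<le> (\<Sum>n\<in>?A (K*N) - ?A N. mangoldt n)" using N by (simp add: field_simps)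
    also have "\<dots> \<le> (\<Sum>n\<in>?A (K*N). mangoldt n)" by (intro sum_mono2) (auto simp: mangoldt_nonneg)
    finally show ?thesis .
  qed
  have main: "real X / (2 * real K) - sqrt (real X) * ln (real X) \<le> real (card {p \<in> primes_upto X. [p = a] (mod M)}) * ln (real X)"
    if X: "X \<ge> K" for X
  proof -
    define N where "N = X div K"
    have N1: "N \<ge> 1" using X K0 by (simp add: N_def div_greater_zero_iff Suc_le_eq)
    have KN: "K * N \<le> X" by (simp add: N_def)
    have "X < K * (N + 1)" using K0 by (simp add: N_def dividend_less_times_div)
    also have "\<dots> \<le> K * (2 * N)" using N1 by (intro mult_left_mono) auto
    finally have "X \<le> K * (2 * N)" by simp
    hence "real X \<le> real K * (2 * real N)" by (metis of_nat_le_iff of_nat_mult of_nat_numeral)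
    hence "real X / (2 * real K) \<le> real N" using K0 by (simp add: field_simps)
    also have "\<dots> \<le> (\<Sum>n\<in>?A (K * N). mangoldt n)" by (rule block[OF N1])
    also have "\<dots> \<le> (\<Sum>n\<in>?A X. mangoldt n)" using KN by (intro sum_mono2) (auto simp: mangoldt_nonneg)
    also have "\<dots> = (\<Sum>n\<in>{n\<in>?A X. prime n}. mangoldt n) + (\<Sum>n\<in>{n\<in>?A X. \<not> prime n}. mangoldt n)"
      by (subst sum.union_disjoint[symmetric]) (auto intro!: sum.cong)
    also have "(\<Sum>n\<in>{n\<in>?A X. \<not> prime n}. mangoldt n :: real) \<le> (\<Sum>n | n \<in> {1..X} \<and> \<not> prime n. mangoldt n)"
      by (intro sum_mono2) (auto simp: mangoldt_nonneg)
    also have "\<dots> \<le> sqrt (real X) * ln (real X)" by (rule sum_mangoldt_nonprime_le)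
    also have "(\<Sum>n\<in>{n\<in>?A X. prime n}. mangoldt n) \<le> (\<Sum>n\<in>{n\<in>?A X. prime n}. ln (real X))"
      by (intro sum_mono) (auto intro!: order_trans[OF mangoldt_le])
    also have "\<dots> = real (card {p \<in> primes_upto X. [p = a] (mod M)}) * ln (real X)"
    proof -
      have "{n\<in>?A X. prime n} = {p \<in> primes_upto X. [p = a] (mod M)}"
        by (auto simp: primes_upto_def Suc_le_eq prime_gt_0_nat)
      thus ?thesis by simp
    qed
    finally show ?thesis by simp
  qed
  have "\<forall>\<^sub>F X in sequentially. real X / (4 * real K) \<le> real X / (2 * real K) - sqrt (real X) * ln (real X)"
    using \<open>0 < real K\<close> by real_asymp
  hence "\<forall>\<^sub>F X in sequentially. 1 / (4 * real K) * real X \<le> real (card {p \<in> primes_upto X. [p = a] (mod M)}) * ln (real X)"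
    using eventually_ge_at_top[of K]
  proof eventually_elim
    case (elim X)
    thus ?case using main[of X] by simp
  qed
  thus ?thesis using K0 by (intro exI[of _ "1 / (4 * real K)"]) auto
qed

lemma lower_density_class_pos:
  assumes S: "finite S" "\<And>q. q \<in> S \<Longrightarrow> prime q" and M: "M = \<Prod>S" and a: "coprime a M"
  shows "0 < lower_density {p. prime p \<and> p0 \<le> p \<and> [p = a] (mod M)}"
proof -
  obtain c where c: "c > 0" and ev: "\<forall>\<^sub>F X in sequentially. c * real X \<le> real (card {p \<in> primes_upto X. [p = a] (mod M)}) * ln (real X)"
    using primes_in_class_lower[OF S M a] by blast
  let ?Z = "{p. prime p \<and> p0 \<le> p \<and> [p = a] (mod M)}"
  have ev2: "\<forall>\<^sub>F X in sequentially. real p0 * ln (real X) \<le> c / 2 * real X"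
    using c by real_asymp
  have "\<forall>\<^sub>F N in sequentially. ereal (c / 20) \<le> ereal (real (card (?Z \<inter> primes_upto N)) / real (card (primes_upto N)))"
    using ev ev2 eventually_ge_at_top[of 2]
  proof eventually_elim
    case (elim N)
    have "{p \<in> primes_upto N. [p = a] (mod M)} \<subseteq> (?Z \<inter> primes_upto N) \<union> {..<p0}"
      by (auto simp: primes_upto_def)
    hence "card {p \<in> primes_upto N. [p = a] (mod M)} \<le> card ((?Z \<inter> primes_upto N) \<union> {..<p0})"
      by (intro card_mono) auto
    also have "\<dots> \<le> card (?Z \<inter> primes_upto N) + card {..<p0}" by (rule card_Un_le)
    finally have "real (card {p \<in> primes_upto N. [p = a] (mod M)}) \<le> real (card (?Z \<inter> primes_upto N)) + real p0" by simp
    hence "real (card {p \<in> primes_upto N. [p = a] (mod M)}) * ln (real N) \<le> (real (card (?Z \<inter> primes_upto N)) + real p0) * ln (real N)"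
      using elim by (intro mult_right_mono) auto
    hence 1: "c / 2 * real N \<le> real (card (?Z \<inter> primes_upto N)) * ln (real N)"
      using elim by (simp add: distrib_right)
    have 2: "real (card (primes_upto N)) * ln (real N) \<le> 10 * real N" using elim by (intro card_primes_upto_upper)
    have "2 \<in> primes_upto N" using elim by (simp add: primes_upto_def)
    hence pos: "card (primes_upto N) > 0" by (auto simp: card_gt_0_iff)
    have l: "ln (real N) > 0" using elim by simp
    have "(c / 20 * real (card (primes_upto N))) * ln (real N) \<le> c / 20 * (10 * real N)"
      using mult_left_mono[OF 2, of "c / 20"] c by simp
    also have "\<dots> \<le> real (card (?Z \<inter> primes_upto N)) * ln (real N)" using 1 by simp
    finally have "c / 20 * real (card (primes_upto N)) \<le> real (card (?Z \<inter> primes_upto N))" using l by simp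
    thus ?case using pos by (simp add: field_simps)
  qed
  hence "ereal (c / 20) \<le> lower_density ?Z" unfolding lower_density_def by (rule Liminf_bounded)
  moreover have "0 < ereal (c / 20)" using c by simp
  ultimately show ?thesis by (rule less_le_trans[rotated])
qed

section \<open>The Euler product and gaps between partial products\<close>

text \<open>The Euler product of \<open>1/\<zeta>(2)\<close> restricted to \<open>S\<close>.\<close>

definition sieve_factor :: "nat set \<Rightarrow> real" where
  "sieve_factor S = (\<Prod>q\<in>S. 1 - 1 / real q ^ 2)"

lemma sieve_factor_bounds:
  assumes "\<And>q. q \<in> S \<Longrightarrow> prime q"
  shows "0 < sieve_factor S" "sieve_factor S \<le> 1"
proof -
  have b: "0 < 1 - 1 / real q ^ 2 \<and> 1 - 1 / real q ^ 2 \<le> 1" if "q \<in> S" for q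
  proof -
    have "real q \<ge> 2" using assms[OF that] prime_ge_2_nat[of q] by simp
    hence "real q ^ 2 \<ge> 2 ^ 2" by (intro power_mono) auto
    hence "1 < real q ^ 2" by simp
    thus ?thesis by (simp add: divide_less_eq)
  qed
  show "0 < sieve_factor S" unfolding sieve_factor_def using b by (intro prod_pos) auto
  show "sieve_factor S \<le> 1" unfolding sieve_factor_def using b by (intro prod_le_1) (auto simp: less_imp_le)
qed

lemma sieve_factor_union:
  "finite A \<Longrightarrow> finite B \<Longrightarrow> A \<inter> B = {} \<Longrightarrow> sieve_factor (A \<union> B) = sieve_factor A * sieve_factor B"
  unfolding sieve_factor_def by (rule prod.union_disjoint)

lemma sieve_factor_antimono:
  assumes "A \<subseteq> B" "finite B" "\<And>q. q \<in> B \<Longrightarrow> prime q"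
  shows "sieve_factor B \<le> sieve_factor A"
proof -
  have "sieve_factor B = sieve_factor A * sieve_factor (B - A)"
    using assms by (subst sieve_factor_union[symmetric]) (auto intro: finite_subset simp: Un_absorb1)
  also have "\<dots> \<le> sieve_factor A * 1"
  proof (rule mult_left_mono)
    show "sieve_factor (B - A) \<le> 1" using assms by (intro sieve_factor_bounds(2)) auto
    show "0 \<le> sieve_factor A" using assms by (intro less_imp_le sieve_factor_bounds(1)) auto
  qed
  finally show ?thesis by simp
qed

text \<open>Sieving by one more prime \<open>q\<close> removes the multiples of \<open>q\<close>, whose share is \<open>1/q\<^sup>2\<close>.\<close>

lemma sifted_inverse_squares_sums:
  assumes "finite S" "\<And>q. q \<in> S \<Longrightarrow> prime q"
  shows "(\<lambda>n. if \<forall>q\<in>S. \<not> q dvd n then 1 / real n ^ 2 else 0) sums (zeta 2 * sieve_factor S)"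
  using assms
proof (induction S rule: finite_induct)
  case empty
  have "(\<lambda>n. 1 / real (Suc n) ^ 2) sums (pi\<^sup>2 / 6)" using inverse_squares_sums by (simp add: add.commute)
  hence "(\<lambda>n. 1 / real n ^ 2) sums (pi\<^sup>2 / 6)"
    using sums_Suc_iff[of "\<lambda>n. 1 / real n ^ 2" "pi\<^sup>2 / 6"] by simp
  thus ?case by (simp add: sieve_factor_def zeta_2)
next
  case (insert q S)
  let ?f = "\<lambda>S n. if \<forall>q\<in>S. \<not> q dvd n then 1 / real n ^ 2 else 0 :: real"
  have IH: "?f S sums (zeta 2 * sieve_factor S)" using insert by blast
  have q: "prime q" "q > 0" using insert.prems by (auto simp: prime_gt_0_nat)
  have m: "?f S (q * n) = 1 / real q ^ 2 * ?f S n" for n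
  proof -
    have "r dvd q * n \<longleftrightarrow> r dvd n" if "r \<in> S" for r
    proof -
      have "prime r" "r \<noteq> q" using that insert by auto
      hence "\<not> r dvd q" using q primes_dvd_imp_eq by blast
      thus ?thesis using \<open>prime r\<close> by (auto simp: prime_dvd_mult_iff)
    qed
    thus ?thesis by (simp add: power_mult_distrib)
  qed
  have "(\<lambda>n. ?f S (q * n)) sums (1 / real q ^ 2 * (zeta 2 * sieve_factor S))"
    unfolding m by (rule sums_mult[OF IH])
  hence "(\<lambda>n. (\<lambda>n. if q dvd n then ?f S n else 0) (q * n)) sums (1 / real q ^ 2 * (zeta 2 * sieve_factor S))"
    by simp
  hence "(\<lambda>n. if q dvd n then ?f S n else 0) sums (1 / real q ^ 2 * (zeta 2 * sieve_factor S))"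
    by (subst (asm) sums_mono_reindex) (use q in \<open>auto simp: strict_mono_def dvd_def image_iff\<close>)
  from sums_diff[OF IH this]
  have "(\<lambda>n. ?f S n - (if q dvd n then ?f S n else 0)) sums (zeta 2 * sieve_factor S - 1 / real q ^ 2 * (zeta 2 * sieve_factor S))" .
  moreover have "(\<lambda>n. ?f S n - (if q dvd n then ?f S n else 0)) = ?f (insert q S)"
    by auto
  moreover have "zeta 2 * sieve_factor S - 1 / real q ^ 2 * (zeta 2 * sieve_factor S) = zeta 2 * sieve_factor (insert q S)"
    using insert.hyps by (simp add: sieve_factor_def algebra_simps)
  ultimately show ?case by simp
qed

lemma zeta_2_pos: "zeta 2 > 0"
  by (simp add: zeta_2)

lemma primes_upto_prime: "q \<in> primes_upto Y \<Longrightarrow> prime q"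
  by (simp add: primes_upto_def)

text \<open>The number 1 always survives the sieve.\<close>

lemma sieve_factor_primes_lower: "1 / zeta 2 \<le> sieve_factor (primes_upto Y)"
proof -
  let ?f = "\<lambda>n. if \<forall>q\<in>primes_upto Y. \<not> q dvd n then 1 / real n ^ 2 else 0"
  have s1: "?f sums (zeta 2 * sieve_factor (primes_upto Y))"
    by (rule sifted_inverse_squares_sums) (auto simp: primes_upto_prime)
  have s2: "(\<lambda>n. if n = 1 then 1 else 0 :: real) sums 1" by (rule sums_single)
  have "1 \<le> zeta 2 * sieve_factor (primes_upto Y)"
  proof (rule sums_le[OF _ s2 s1])
    fix n show "(if n = 1 then 1 else 0) \<le> ?f n"
      by (auto simp: primes_upto_def)
  qed
  thus ?thesis using zeta_2_pos by (simp add: field_simps)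
qed

text \<open>After sieving by all primes up to \<open>Y\<close> only 1 and numbers greater than \<open>Y\<close> survive.\<close>

lemma sieve_factor_primes_tendsto: "(\<lambda>Y. sieve_factor (primes_upto Y)) \<longlonglongrightarrow> 1 / zeta 2"
proof -
  let ?t = "\<lambda>Y. (zeta 2 - (\<Sum>n<Suc Y. 1 / real n ^ 2) + 1) / zeta 2"
  have full: "(\<lambda>n. 1 / real n ^ 2) sums zeta 2"
    using sifted_inverse_squares_sums[of "{}"] by (simp add: sieve_factor_def)
  have "(\<lambda>Y. (\<Sum>n<Suc Y. 1 / real n ^ 2)) \<longlonglongrightarrow> zeta 2"
    using full unfolding sums_def by (rule LIMSEQ_Suc)
  hence "?t \<longlonglongrightarrow> (zeta 2 - zeta 2 + 1) / zeta 2" using zeta_2_pos by (intro tendsto_intros) auto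
  hence lim: "?t \<longlonglongrightarrow> 1 / zeta 2" by simp
  have up: "sieve_factor (primes_upto Y) \<le> ?t Y" for Y
  proof -
    let ?f = "\<lambda>n. if \<forall>q\<in>primes_upto Y. \<not> q dvd n then 1 / real n ^ 2 else 0"
    have 1: "?f sums (zeta 2 * sieve_factor (primes_upto Y))"
      by (rule sifted_inverse_squares_sums) (auto simp: primes_upto_prime)
    have 2: "(\<lambda>n. if n \<in> {..<Suc Y} then 1 / real n ^ 2 else 0 :: real) sums (\<Sum>n<Suc Y. 1 / real n ^ 2)"
      by (rule sums_If_finite_set) simp
    have 3: "(\<lambda>n. if n = 1 then 1 else 0 :: real) sums 1" by (rule sums_single)
    have "zeta 2 * sieve_factor (primes_upto Y) \<le> zeta 2 - (\<Sum>n<Suc Y. 1 / real n ^ 2) + 1"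
    proof (rule sums_le[OF _ 1 sums_add[OF sums_diff[OF full 2] 3]])
      fix n
      show "?f n \<le> 1 / real n ^ 2 - (if n \<in> {..<Suc Y} then 1 / real n ^ 2 else 0) + (if n = 1 then 1 else 0)"
      proof (cases "n \<in> {2..Y}")
        case True
        then obtain q where "prime q" "q dvd n" using prime_factor_nat[of n] by auto
        moreover have "q \<le> n" using calculation True by (intro dvd_imp_le) auto
        ultimately show ?thesis using True by (auto simp: primes_upto_def)
      next
        case False
        hence "n = 0 \<or> n = 1 \<or> n > Y" by auto
        thus ?thesis by auto
      qed
    qed
    thus ?thesis using zeta_2_pos by (simp add: field_simps)
  qed
  show ?thesis
    by (rule tendsto_sandwich[OF _ _ tendsto_const lim]) (simp_all only: sieve_factor_primes_lower up eventually_True)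
qed

lemma one_minus_power_le:
  fixes x :: real
  assumes "0 \<le> x" "x \<le> 1"
  shows "(1 - x) ^ k * (1 + real k * x) \<le> 1"
proof -
  have "(1 - x) ^ k * (1 + real k * x) \<le> (1 - x) ^ k * (1 + x) ^ k"
    using assms Bernoulli_inequality[of x k] by (intro mult_left_mono) auto
  also have "\<dots> = (1 - x ^ 2) ^ k" by (simp add: power_mult_distrib[symmetric] power2_eq_square algebra_simps)
  also have "\<dots> \<le> 1" using assms by (intro power_le_one) (auto simp: power_le_one)
  finally show ?thesis .
qed

text \<open>With \<open>k\<close> primes up to \<open>b\<close>, Bernoulli's inequality bounds the product by \<open>1/(1 + k/b\<^sup>2)\<close>.\<close>

lemma sieve_factor_window:
  assumes F: "finite F" "\<And>p. p \<in> F \<Longrightarrow> prime p \<and> p \<le> b" and q: "q \<ge> 2" and b: "b > 0"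
    and card: "b ^ 2 \<le> card F * (q ^ 2 - 1)"
  shows "sieve_factor F \<le> 1 - 1 / real q ^ 2"
proof -
  define x where "x = 1 / real b ^ 2"
  define y where "y = real q ^ 2"
  define k where "k = card F"
  have b1: "1 \<le> real b ^ 2" using b by (intro one_le_power) auto
  hence x: "0 < x" "x \<le> 1" using b by (simp_all add: x_def divide_le_eq)
  have "y \<ge> 2 ^ 2" unfolding y_def using q by (intro power_mono) auto
  hence y: "y \<ge> 4" by simp
  have "q ^ 2 \<ge> 1" using q by (intro one_le_power) auto
  hence "real (q ^ 2 - 1) = y - 1" by (simp add: of_nat_diff y_def)
  moreover have "real (b ^ 2) \<le> real (k * (q ^ 2 - 1))" using card unfolding k_def by (rule of_nat_mono)
  ultimately have "real b ^ 2 \<le> real k * (y - 1)" by simp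
  hence "1 \<le> real k * (y - 1) / real b ^ 2" using b1 b by (subst le_divide_eq_1_pos) auto
  hence k1: "1 \<le> real k * x * (y - 1)" by (simp add: x_def)
  have "sieve_factor F \<le> (\<Prod>p\<in>F. 1 - x)" unfolding sieve_factor_def
  proof (rule prod_mono)
    fix p assume p: "p \<in> F"
    hence "0 < p" "p \<le> b" using F(2) prime_gt_0_nat by auto
    hence p1: "1 \<le> real p ^ 2" "real p ^ 2 \<le> real b ^ 2" by (auto intro!: power_mono one_le_power)
    from p1 have "x \<le> 1 / real p ^ 2" unfolding x_def using b \<open>0 < p\<close> by (intro divide_left_mono) auto
    moreover have "1 / real p ^ 2 \<le> 1" using p1 \<open>0 < p\<close> by (simp add: divide_le_eq)
    ultimately show "0 \<le> 1 - 1 / real p ^ 2 \<and> 1 - 1 / real p ^ 2 \<le> 1 - x" by simp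
  qed
  hence "sieve_factor F \<le> (1 - x) ^ k" by (simp add: k_def)
  also have "\<dots> \<le> 1 - 1 / y"
  proof -
    have "(1 - x) ^ k * (1 + real k * x) \<le> 1" using x by (intro one_minus_power_le) auto
    also have "1 \<le> (1 - 1 / y) * (1 + real k * x)"
    proof -
      have "(1 - 1 / y) * (1 + real k * x) = 1 + (real k * x * (y - 1) - 1) / y" using y by (simp add: field_simps)
      thus ?thesis using k1 y by simp
    qed
    finally show ?thesis using x by (simp add: mult_le_cancel_right_pos add_pos_nonneg)
  qed
  finally show ?thesis by (simp add: y_def)
qed

lemma prime_trial_division:
  assumes p: "1 < p" "p < b * b" and ps: "\<And>d. prime d \<Longrightarrow> d < b \<Longrightarrow> d \<in> set ps"
    and trial: "list_all (\<lambda>d. \<not> d dvd p) ps"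
  shows "prime (p::nat)"
proof (rule ccontr)
  assume np: "\<not> prime p"
  obtain r where r: "prime r" "r dvd p" using p(1) prime_factor_nat[of p] by auto
  then obtain c where c: "p = r * c" by auto
  have "r \<noteq> p" using np r by auto
  hence "c \<noteq> 1" using c by simp
  then obtain s where s: "prime s" "s dvd c" using prime_factor_nat[of c] by auto
  have "c \<noteq> 0" using c p(1) by (metis mult_0_right not_less_zero)
  hence "s \<le> c" using s by (intro dvd_imp_le) auto
  have ex: "b \<le> d" if "prime d" "d dvd p" for d
    using ps[OF that(1)] trial that(2) by (auto simp: list_all_iff not_le[symmetric])
  have "b \<le> r" "b \<le> s" using ex r s c by (auto intro: dvd_trans)
  hence "b * b \<le> r * s" by (intro mult_mono) auto
  also have "\<dots> \<le> p" using c \<open>s \<le> c\<close> by simp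
  finally show False using p(2) by simp
qed

lemma primes_less_63:
  assumes "prime d" "d < 63"
  shows "d \<in> set [2,3,5,7,11,13,17,19,23,29,31,37,41,43,47,53,59,61::nat]"
proof -
  have "list_all (\<lambda>d. prime d \<longrightarrow> d \<in> set [2,3,5,7,11,13,17,19,23,29,31,37,41,43,47,53,59,61::nat]) [0..<63]"
    by code_simp
  thus ?thesis using assms by (auto simp only: list_all_iff set_upt atLeastLessThan_iff)
qed

text \<open>The greedy algorithm may skip the prime \<open>q\<close> without ever falling behind: later primes
  can make up for its factor.\<close>

definition sieve_gap :: "nat \<Rightarrow> bool" where
  "sieve_gap q \<longleftrightarrow> (\<exists>F. finite F \<and> (\<forall>p\<in>F. prime p \<and> q < p) \<and> sieve_factor F \<le> 1 - 1 / real q ^ 2)"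

text \<open>Five primes in the interval from \<open>q\<close> to \<open>2 q\<close> suffice, as \<open>5 (q\<^sup>2 - 1) \<ge> (2 q)\<^sup>2\<close>. The same
  five serve all \<open>q\<close> from half the largest of them up to the smallest.\<close>

lemma sieve_gap_five_primes:
  assumes q: "l \<le> q" and l: "5 \<le> l"
    and ps: "list_all (\<lambda>p. prime p \<and> q < p \<and> p \<le> 2 * l) ps" "distinct ps" "length ps = 5"
  shows "sieve_gap q"
  unfolding sieve_gap_def
proof (intro exI conjI)
  have q2: "q ^ 2 \<ge> 25" using power_mono[of 5 q 2] q l by simp
  show "sieve_factor (set ps) \<le> 1 - 1 / real q ^ 2"
  proof (rule sieve_factor_window[where b = "2 * q"])
    show "(2 * q) ^ 2 \<le> card (set ps) * (q ^ 2 - 1)"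
      using q2 ps by (simp add: distinct_card power_mult_distrib)
  qed (use q l ps in \<open>auto simp: list_all_iff\<close>)
  show "\<forall>p\<in>set ps. prime p \<and> q < p" using ps q by (auto simp: list_all_iff)
qed auto

lemma sieve_gap_direct:
  assumes "finite F" "\<And>p. p \<in> F \<Longrightarrow> prime p \<and> q < p" "sieve_factor F \<le> 1 - 1 / real q ^ 2"
  shows "sieve_gap q"
  using assms unfolding sieve_gap_def by blast

lemma small_primes:
  shows "prime (7::nat)" and "prime (11::nat)" and "prime (13::nat)" and "prime (17::nat)" and "prime (19::nat)" and "prime (23::nat)" and "prime (29::nat)" and "prime (31::nat)" and "prime (37::nat)" and "prime (41::nat)" and "prime (43::nat)" and "prime (47::nat)" and "prime (53::nat)" and "prime (59::nat)" and "prime (61::nat)" and "prime (67::nat)" and "prime (71::nat)" and "prime (83::nat)" and "prime (89::nat)" and "prime (97::nat)" and "prime (101::nat)" and "prime (103::nat)"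
    and "prime (139::nat)" and "prime (149::nat)" and "prime (151::nat)" and "prime (157::nat)" and "prime (163::nat)"
    and "prime (257::nat)" and "prime (263::nat)" and "prime (269::nat)" and "prime (271::nat)" and "prime (277::nat)"
    and "prime (487::nat)" and "prime (491::nat)" and "prime (499::nat)" and "prime (503::nat)" and "prime (509::nat)"
    and "prime (941::nat)" and "prime (947::nat)" and "prime (953::nat)" and "prime (967::nat)" and "prime (971::nat)"
    and "prime (1861::nat)" and "prime (1871::nat)" and "prime (1873::nat)" and "prime (1877::nat)" and "prime (1879::nat)"
    and "prime (3691::nat)" and "prime (3697::nat)" and "prime (3701::nat)" and "prime (3709::nat)" and "prime (3719::nat)"
proof -
  show "prime (7::nat)" by simp
  have "prime d \<Longrightarrow> d < 11 \<Longrightarrow> d \<in> set [2,3,5,7]" for d :: nat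
    using primes_less_63[of d] by auto
  note trial = prime_trial_division[OF _ _ this]
  show "prime (11::nat)" "prime (13::nat)" "prime (17::nat)" "prime (19::nat)" "prime (23::nat)" "prime (29::nat)" "prime (31::nat)" "prime (37::nat)" "prime (41::nat)" "prime (43::nat)" "prime (47::nat)" "prime (53::nat)" "prime (59::nat)" "prime (61::nat)" "prime (67::nat)" "prime (71::nat)" "prime (83::nat)" "prime (89::nat)" "prime (97::nat)" "prime (101::nat)" "prime (103::nat)"
    by (rule trial; simp)+
  have "prime d \<Longrightarrow> d < 13 \<Longrightarrow> d \<in> set [2,3,5,7,11]" for d :: nat
    using primes_less_63[of d] by auto
  note trial = prime_trial_division[OF _ _ this]
  show "prime (139::nat)" "prime (149::nat)" "prime (151::nat)" "prime (157::nat)" "prime (163::nat)"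
    by (rule trial; simp)+
  have "prime d \<Longrightarrow> d < 17 \<Longrightarrow> d \<in> set [2,3,5,7,11,13]" for d :: nat
    using primes_less_63[of d] by auto
  note trial = prime_trial_division[OF _ _ this]
  show "prime (257::nat)" "prime (263::nat)" "prime (269::nat)" "prime (271::nat)" "prime (277::nat)"
    by (rule trial; simp)+
  have "prime d \<Longrightarrow> d < 23 \<Longrightarrow> d \<in> set [2,3,5,7,11,13,17,19]" for d :: nat
    using primes_less_63[of d] by auto
  note trial = prime_trial_division[OF _ _ this]
  show "prime (487::nat)" "prime (491::nat)" "prime (499::nat)" "prime (503::nat)" "prime (509::nat)"
    by (rule trial; simp)+
  have "prime d \<Longrightarrow> d < 32 \<Longrightarrow> d \<in> set [2,3,5,7,11,13,17,19,23,29,31]" for d :: nat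
    using primes_less_63[of d] by auto
  note trial = prime_trial_division[OF _ _ this]
  show "prime (941::nat)" "prime (947::nat)" "prime (953::nat)" "prime (967::nat)" "prime (971::nat)"
    by (rule trial; simp)+
  have "prime d \<Longrightarrow> d < 44 \<Longrightarrow> d \<in> set [2,3,5,7,11,13,17,19,23,29,31,37,41,43]" for d :: nat
    using primes_less_63[of d] by auto
  note trial = prime_trial_division[OF _ _ this]
  show "prime (1861::nat)" "prime (1871::nat)" "prime (1873::nat)" "prime (1877::nat)" "prime (1879::nat)"
    by (rule trial; simp)+
  have "prime d \<Longrightarrow> d < 62 \<Longrightarrow> d \<in> set [2,3,5,7,11,13,17,19,23,29,31,37,41,43,47,53,59,61]" for d :: nat
    using primes_less_63[of d] by auto
  note trial = prime_trial_division[OF _ _ this]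
  show "prime (3691::nat)" "prime (3697::nat)" "prime (3701::nat)" "prime (3709::nat)" "prime (3719::nat)"
    by (rule trial; simp)+
qed

lemma sieve_gap_small_primes: "sieve_gap 5" "sieve_gap 7" "sieve_gap 11" "sieve_gap 13" "sieve_gap 17" "sieve_gap 19"
proof -
  \<comment> \<open>For \<open>q = 5\<close> the primes from 7 to 17 would not suffice.\<close>
  show "sieve_gap 5" by (rule sieve_gap_direct[of "{7,11,13,17,19,23}"]) (auto simp: sieve_factor_def small_primes simp del: prime_nat_numeral_eq)
  show "sieve_gap 7" by (rule sieve_gap_direct[of "{11,13,17,19,23}"]) (auto simp: sieve_factor_def small_primes simp del: prime_nat_numeral_eq)
  show "sieve_gap 11" by (rule sieve_gap_direct[of "{13,17}"]) (auto simp: sieve_factor_def small_primes simp del: prime_nat_numeral_eq)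
  show "sieve_gap 13" by (rule sieve_gap_direct[of "{17,19}"]) (auto simp: sieve_factor_def small_primes simp del: prime_nat_numeral_eq)
  show "sieve_gap 17" by (rule sieve_gap_direct[of "{19,23}"]) (auto simp: sieve_factor_def small_primes simp del: prime_nat_numeral_eq)
  show "sieve_gap 19" by (rule sieve_gap_direct[of "{23,29,31}"]) (auto simp: sieve_factor_def small_primes simp del: prime_nat_numeral_eq)
qed

lemma sieve_gap_medium:
  assumes "23 \<le> q" "q < 3691"
  shows "sieve_gap q"
proof -
  note five = sieve_gap_five_primes
  consider "23 \<le> q" "q < 29" | "29 \<le> q" "q < 37" | "37 \<le> q" "q < 53" | "53 \<le> q" "q < 83"
    | "83 \<le> q" "q < 139" | "139 \<le> q" "q < 257" | "257 \<le> q" "q < 487" | "487 \<le> q" "q < 941"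
    | "941 \<le> q" "q < 1861" | "1861 \<le> q" "q < 3691" using assms by linarith
  thus ?thesis
  proof cases
    case 1 show ?thesis by (rule five[of 23 _ "[29,31,37,41,43]"]) (use 1 in \<open>auto simp: small_primes simp del: prime_nat_numeral_eq\<close>)
  next
    case 2 show ?thesis by (rule five[of 29 _ "[37,41,43,47,53]"]) (use 2 in \<open>auto simp: small_primes simp del: prime_nat_numeral_eq\<close>)
  next
    case 3 show ?thesis by (rule five[of 37 _ "[53,59,61,67,71]"]) (use 3 in \<open>auto simp: small_primes simp del: prime_nat_numeral_eq\<close>)
  next
    case 4 show ?thesis by (rule five[of 53 _ "[83,89,97,101,103]"]) (use 4 in \<open>auto simp: small_primes simp del: prime_nat_numeral_eq\<close>)
  next
    case 5 show ?thesis by (rule five[of 83 _ "[139,149,151,157,163]"]) (use 5 in \<open>auto simp: small_primes simp del: prime_nat_numeral_eq\<close>)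
  next
    case 6 show ?thesis by (rule five[of 139 _ "[257,263,269,271,277]"]) (use 6 in \<open>auto simp: small_primes simp del: prime_nat_numeral_eq\<close>)
  next
    case 7 show ?thesis by (rule five[of 257 _ "[487,491,499,503,509]"]) (use 7 in \<open>auto simp: small_primes simp del: prime_nat_numeral_eq\<close>)
  next
    case 8 show ?thesis by (rule five[of 487 _ "[941,947,953,967,971]"]) (use 8 in \<open>auto simp: small_primes simp del: prime_nat_numeral_eq\<close>)
  next
    case 9 show ?thesis by (rule five[of 941 _ "[1861,1871,1873,1877,1879]"]) (use 9 in \<open>auto simp: small_primes simp del: prime_nat_numeral_eq\<close>)
  next
    case 10 show ?thesis by (rule five[of 1861 _ "[3691,3697,3701,3709,3719]"]) (use 10 in \<open>auto simp: small_primes simp del: prime_nat_numeral_eq\<close>)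
  qed
qed

text \<open>Roughly, look at the primes between \<open>q\<close> and \<open>q\<^sup>3\<^sup>/\<^sup>2\<close>. Chebyshev's lower bound provides
  far more of them than the trivial bound \<open>q\<close> for the number of primes up to \<open>q\<close>, with
  enough to spare for \<open>sieve_factor_window\<close>.\<close>

lemma sieve_gap_large:
  assumes q: "3600 \<le> q"
  shows "sieve_gap q"
proof -
  define r where "r = floor_sqrt q"
  \<comment> \<open>The window reaches up to \<open>2 q j\<close>, where \<open>j\<close> is about a quarter of the square
    root of \<open>q\<close>. It must contain at least \<open>5 j\<^sup>2\<close> primes, while some
    \<open>q j ln 4 / ln (2 q j)\<close> are available; the factor 132/100 below exceeds
    \<open>1 + 5 j\<^sup>2/q\<close>, which is at most \<open>21/16\<close>.\<close>
  define j where "j = r div 4"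
  have "60 \<le> r" unfolding r_def le_floor_sqrt_iff using q by simp
  hence j: "15 \<le> j" "4 * j \<le> r" "r < 4 * j + 4" by (auto simp: j_def)
  have "(4 * j) ^ 2 \<le> r ^ 2" using j by (intro power_mono) auto
  also have "\<dots> \<le> q" by (simp add: r_def)
  finally have qlo: "16 * j ^ 2 \<le> q" by (simp add: power_mult_distrib)
  have "q < Suc r ^ 2" unfolding r_def by (rule Suc_floor_sqrt_power2_gt)
  also have "\<dots> \<le> (4 * (j + 1)) ^ 2" using j by (intro power_mono) auto
  also have "\<dots> = 16 * (j + 1) ^ 2" by (simp only: power_mult_distrib) simp
  finally have qhi: "q \<le> 16 * (j + 1) ^ 2" by simp
  define n where "n = q * j"
  define L where "L = ln (2 * real n)"
  have n1: "n \<ge> 1" using j q by (simp add: n_def Suc_le_eq)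
  have j1: "real j + 1 > 0" by simp
  have "n \<le> (16 * (j + 1) ^ 2) * (j + 1)"
    unfolding n_def using qhi by (intro mult_mono) auto
  hence "2 * n \<le> 2 * ((16 * (j + 1) ^ 2) * (j + 1))" by (rule mult_left_mono) simp
  hence "real (2 * n) \<le> real (2 * ((16 * (j + 1) ^ 2) * (j + 1)))" by (rule of_nat_mono)
  also have "\<dots> = 2 ^ 5 * (real j + 1) ^ 3" by (simp add: power2_eq_square power3_eq_cube algebra_simps)
  finally have "L \<le> ln (2 ^ 5 * (real j + 1) ^ 3)" unfolding L_def using n1 j1
    by (subst ln_le_cancel_iff) auto
  also have "\<dots> = 5 * ln 2 + 3 * ln (real j + 1)" using j1 ln_realpow[of 2 5] by (simp add: ln_mult ln_realpow)
  also have "ln (real j + 1) \<le> 4 * ln 2 + (real j - 15) / 16"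
  proof -
    have "ln ((real j + 1) / 2 ^ 4) \<le> (real j + 1) / 2 ^ 4 - 1" using j1 by (intro ln_le_minus_one) auto
    thus ?thesis using j1 ln_realpow[of 2 4] by (simp add: ln_div field_simps)
  qed
  finally have L: "L \<le> 17 * ln 2 + 3 / 16 * (real j - 15)" by simp
  have main: "132 / 100 * L \<le> real j * ln 4"
  proof -
    have l2: "2 / 3 \<le> ln (2::real)" by (rule ln2_ge_two_thirds)
    have "ln (4::real) = 2 * ln 2" using ln_realpow[of 2 2] by simp
    moreover have "(real j - 15) * (2 / 3) \<le> (real j - 15) * ln 2" using l2 j by (intro mult_left_mono) auto
    hence "real j * ln 2 \<ge> 15 * ln 2 + (real j - 15) * (2 / 3)" unfolding left_diff_distrib by linarith
    moreover have "15 \<le> real j" using j(1) by simp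
    moreover have "132 / 100 * L \<le> 2 * X" if "15 * l + (y - 15) * (2 / 3) \<le> X" "15 \<le> y"
        "L \<le> 17 * l + 3 / 16 * (y - 15)" "2 / 3 \<le> l" for l y X :: real
      using that by (simp add: field_simps)
    ultimately show ?thesis using L l2 by (simp only: mult.left_commute[of "real j" 2])
  qed
  have L0: "0 < L" unfolding L_def using n1 by simp
  have "132 / 100 * real q * L \<le> real n * ln 4"
    using mult_left_mono[OF main, of "real q"] by (simp add: n_def mult.assoc mult.left_commute)
  also have "\<dots> \<le> (real (card (primes_upto (2 * n))) + 1) * L"
    unfolding L_def using card_primes_upto_lower[OF n1] by simp
  finally have "132 / 100 * real q \<le> real (card (primes_upto (2 * n))) + 1" using L0 by simp
  hence "real (card (primes_upto (2 * n))) \<ge> 132 / 100 * real q - 1" by simp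
  moreover have "real (16 * j ^ 2) \<le> real q" using qlo by (rule of_nat_mono)
  moreover have "real j ^ 2 \<ge> 15 ^ 2" using j by (intro power_mono) auto
  ultimately have "real (card (primes_upto (2 * n))) \<ge> real q + 5 * real j ^ 2" by simp
  hence "real (q + 5 * j ^ 2) \<le> real (card (primes_upto (2 * n)))" by simp
  hence c: "q + 5 * j ^ 2 \<le> card (primes_upto (2 * n))" by (simp only: of_nat_le_iff)
  let ?F = "{p \<in> primes_upto (2 * n). q < p}"
  have "primes_upto (2 * n) \<subseteq> {1..q} \<union> ?F" by (auto simp: primes_upto_def prime_gt_0_nat Suc_le_eq)
  hence "card (primes_upto (2 * n)) \<le> card ({1..q} \<union> ?F)" by (intro card_mono) auto
  also have "\<dots> \<le> q + card ?F" using card_Un_le[of "{1..q}" ?F] by simp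
  finally have F: "5 * j ^ 2 \<le> card ?F" using c by simp
  have "sieve_factor ?F \<le> 1 - 1 / real q ^ 2"
  proof (rule sieve_factor_window[where b = "2 * n"])
    have "5 \<le> q ^ 2" using power_mono[of 3 q 2] q by simp
    hence "4 * q ^ 2 \<le> 5 * (q ^ 2 - 1)" by simp
    hence "j ^ 2 * (4 * q ^ 2) \<le> j ^ 2 * (5 * (q ^ 2 - 1))" by (rule mult_left_mono) simp
    also have "\<dots> \<le> card ?F * (q ^ 2 - 1)" using F by (simp add: mult.assoc[symmetric] mult.commute[of _ 5])
    finally show "(2 * n) ^ 2 \<le> card ?F * (q ^ 2 - 1)" by (simp add: n_def power_mult_distrib mult.commute mult.left_commute)
  qed (use n1 q in \<open>auto simp: primes_upto_def\<close>)
  thus ?thesis by (intro sieve_gap_direct[of ?F]) (auto simp: primes_upto_def)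
qed

lemma sieve_gap_prime:
  assumes "prime q" "5 \<le> q"
  shows "sieve_gap q"
proof -
  \<comment> \<open>For a prime \<open>q < 23\<close> there are fewer than five primes between \<open>q\<close> and \<open>2 q\<close>.\<close>
  consider "q < 23" | "23 \<le> q" "q < 3691" | "3600 \<le> q" by linarith
  thus ?thesis
  proof cases
    case 1
    hence "q \<in> set [5..<23]" using assms(2) by (simp only: set_upt atLeastLessThan_iff)
    hence all: "q \<in> {5,6,7,8,9,10,11,12,13,14,15,16,17,18,19,20,21,22}" by (simp add: upt_rec)
    have "\<not> 2 dvd q" "\<not> 3 dvd q" using assms primes_dvd_imp_eq[of 2 q] primes_dvd_imp_eq[of 3 q] by auto
    hence "q \<notin> {6,8,10,12,14,16,18,20,22}" "q \<notin> {9,15,21}" by auto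
    with all have "q \<in> {5,7,11,13,17,19}" by simp
    thus ?thesis using sieve_gap_small_primes by auto
  next
    case 2 thus ?thesis by (rule sieve_gap_medium)
  next
    case 3 thus ?thesis by (rule sieve_gap_large)
  qed
qed

definition primes_5_upto :: "nat \<Rightarrow> nat set" where
  "primes_5_upto Y = {q \<in> primes_upto Y. 5 \<le> q}"

lemma finite_primes_5_upto [simp]: "finite (primes_5_upto Y)"
  by (simp add: primes_5_upto_def)

lemma primes_5_upto_Suc:
  "primes_5_upto (Suc Y) = (if prime (Suc Y) \<and> 5 \<le> Suc Y then insert (Suc Y) (primes_5_upto Y) else primes_5_upto Y)"
  by (auto simp: primes_5_upto_def primes_upto_def le_Suc_eq)

lemma sieve_factor_primes_upto_split:
  assumes "3 \<le> Y"
  shows "sieve_factor (primes_upto Y) = 2 / 3 * sieve_factor (primes_5_upto Y)"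
proof -
  have "q = 2 \<or> q = 3 \<or> 5 \<le> q" if "prime q" for q :: nat
  proof -
    have "q \<noteq> 4" using that by auto
    thus ?thesis using prime_ge_2_nat[OF that] by linarith
  qed
  hence e: "primes_upto Y = {2, 3} \<union> primes_5_upto Y"
    using assms by (auto simp: primes_upto_def primes_5_upto_def not_le)
  have "sieve_factor (primes_upto Y) = sieve_factor {2,3} * sieve_factor (primes_5_upto Y)"
    unfolding e by (rule sieve_factor_union) (auto simp: primes_5_upto_def)
  thus ?thesis by (simp add: sieve_factor_def)
qed

lemma sieve_factor_5_lower: "3 / (2 * zeta 2) \<le> sieve_factor (primes_5_upto Y)"
proof -
  have "3 / (2 * zeta 2) \<le> sieve_factor (primes_5_upto (max 3 Y))"
    using sieve_factor_primes_lower[of "max 3 Y"] sieve_factor_primes_upto_split[of "max 3 Y"]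
    by (simp add: field_simps)
  also have "\<dots> \<le> sieve_factor (primes_5_upto Y)"
    by (rule sieve_factor_antimono) (auto simp: primes_5_upto_def primes_upto_def)
  finally show ?thesis .
qed

lemma sieve_factor_5_tendsto: "(\<lambda>Y. sieve_factor (primes_5_upto Y)) \<longlonglongrightarrow> 3 / (2 * zeta 2)"
proof -
  have "(\<lambda>Y. 3 / 2 * sieve_factor (primes_upto Y)) \<longlonglongrightarrow> 3 / 2 * (1 / zeta 2)"
    by (intro tendsto_intros sieve_factor_primes_tendsto)
  moreover have "\<forall>\<^sub>F Y in sequentially. 3 / 2 * sieve_factor (primes_upto Y) = sieve_factor (primes_5_upto Y)"
    using eventually_ge_at_top[of 3] by eventually_elim (simp add: sieve_factor_primes_upto_split)
  ultimately show ?thesis by (simp add: tendsto_cong)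
qed

text \<open>The product over all primes at least 5, which is the left-hand side, is the product
  up to \<open>q\<close> times the tail after \<open>q\<close>, and the tail is at most \<open>1 - 1/q\<^sup>2\<close> by \<open>sieve_gap_prime\<close>.\<close>

lemma sieve_factor_5_skip_prime:
  assumes "prime q" "5 \<le> q"
  shows "3 / (2 * zeta 2) \<le> sieve_factor (primes_5_upto q) * (1 - 1 / real q ^ 2)"
proof -
  obtain F where F: "finite F" "\<And>p. p \<in> F \<Longrightarrow> prime p \<and> q < p" "sieve_factor F \<le> 1 - 1 / real q ^ 2"
    using sieve_gap_prime[OF assms] unfolding sieve_gap_def by blast
  define X where "X = Max (insert q F)"
  have X: "p \<le> X" if "p \<in> F" for p using F(1) that by (simp add: X_def)
  have qX: "q \<le> X" using F(1) by (simp add: X_def)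
  have "3 / (2 * zeta 2) \<le> sieve_factor (primes_5_upto X)" by (rule sieve_factor_5_lower)
  also have "\<dots> \<le> sieve_factor (primes_5_upto q \<union> F)"
  proof (rule sieve_factor_antimono)
    have "p \<in> primes_5_upto X" if "p \<in> F" for p
      using X[OF that] F(2)[OF that] assms(2) by (simp add: primes_5_upto_def primes_upto_def)
    moreover have "primes_5_upto q \<subseteq> primes_5_upto X"
      using qX by (auto simp: primes_5_upto_def primes_upto_def)
    ultimately show "primes_5_upto q \<union> F \<subseteq> primes_5_upto X" by blast
  qed (simp_all add: primes_5_upto_def primes_upto_def)
  also have "\<dots> = sieve_factor (primes_5_upto q) * sieve_factor F"
  proof (rule sieve_factor_union)
    show "primes_5_upto q \<inter> F = {}"
    proof (rule equals0I)
      fix p assume "p \<in> primes_5_upto q \<inter> F"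
      thus False using F(2)[of p] by (simp add: primes_5_upto_def primes_upto_def)
    qed
  qed (use F(1) in simp_all)
  also have "\<dots> \<le> sieve_factor (primes_5_upto q) * (1 - 1 / real q ^ 2)"
    using F(3) sieve_factor_bounds(1)[of "primes_5_upto q"] by (intro mult_left_mono) (auto simp: primes_5_upto_def primes_upto_def less_imp_le)
  finally show ?thesis .
qed

text \<open>Run through the primes at least 5 and take one whenever the product stays at least
  \<open>m\<close>. The second inequality is the invariant that the remaining primes can still bring
  the product down to \<open>m\<close>; it survives the skipping of a prime because of
  \<open>sieve_factor_5_skip_prime\<close>.\<close>

lemma greedy_sieve_factor:
  assumes m: "3 / (2 * zeta 2) \<le> m" "m \<le> 1"
  shows "\<exists>S\<subseteq>primes_5_upto Y. m \<le> sieve_factor S \<and> sieve_factor S * (3 / (2 * zeta 2)) \<le> m * sieve_factor (primes_5_upto Y)"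
proof (induction Y)
  case 0
  thus ?case using m by (intro exI[of _ "{}"]) (simp add: sieve_factor_def primes_5_upto_def primes_upto_def)
next
  case (Suc Y)
  let ?R = "3 / (2 * zeta 2)"
  have m0: "0 < m" using m zeta_2_pos by (intro less_le_trans[OF _ m(1)]) auto
  from Suc obtain S where S: "S \<subseteq> primes_5_upto Y" "m \<le> sieve_factor S"
    "sieve_factor S * ?R \<le> m * sieve_factor (primes_5_upto Y)" by blast
  show ?case
  proof (cases "prime (Suc Y) \<and> 5 \<le> Suc Y")
    case False
    thus ?thesis using S by (auto simp: primes_5_upto_Suc)
  next
    case True
    define q where "q = Suc Y"
    define c where "c = 1 - 1 / real q ^ 2"
    have q: "prime q" "5 \<le> q" using True by (auto simp: q_def)
    have e: "primes_5_upto q = insert q (primes_5_upto Y)" using True by (simp add: q_def primes_5_upto_Suc)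
    have nin: "q \<notin> primes_5_upto Y" by (simp add: primes_5_upto_def primes_upto_def q_def)
    have E: "sieve_factor (primes_5_upto q) = c * sieve_factor (primes_5_upto Y)"
      unfolding e sieve_factor_def c_def using nin by (subst prod.insert) auto
    have c0: "0 < c" using sieve_factor_bounds(1)[of "{q}"] q by (simp add: sieve_factor_def c_def)
    have finS: "finite S" using S(1) by (rule finite_subset) simp
    show ?thesis
    proof (cases "m \<le> c * sieve_factor S")
      case True
      have ins: "sieve_factor (insert q S) = c * sieve_factor S"
        unfolding sieve_factor_def c_def using nin S(1) finS by (subst prod.insert) auto
      have "c * (sieve_factor S * ?R) \<le> c * (m * sieve_factor (primes_5_upto Y))"
        using S(3) c0 by (intro mult_left_mono) auto
      also have "\<dots> = m * sieve_factor (primes_5_upto q)" by (simp only: E mult.left_commute)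
      finally have "sieve_factor (insert q S) * ?R \<le> m * sieve_factor (primes_5_upto q)"
        by (simp only: ins mult.assoc)
      moreover have "m \<le> sieve_factor (insert q S)" using True by (simp only: ins)
      moreover have "insert q S \<subseteq> primes_5_upto q" using S(1) e by auto
      ultimately show ?thesis unfolding q_def[symmetric] by blast
    next
      case False
      have "sieve_factor S * ?R \<le> sieve_factor S * (sieve_factor (primes_5_upto q) * c)"
        using sieve_factor_5_skip_prime[OF q] m0 S(2) unfolding c_def by (intro mult_left_mono) auto
      also have "\<dots> = (c * sieve_factor S) * sieve_factor (primes_5_upto q)" by simp
      also have "\<dots> \<le> m * sieve_factor (primes_5_upto q)"
        using False sieve_factor_bounds(1)[of "primes_5_upto q"] by (intro mult_right_mono) (auto simp: primes_5_upto_def primes_upto_def less_imp_le)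
      finally show ?thesis using S(1,2) e unfolding q_def[symmetric] by blast
    qed
  qed
qed

text \<open>The two intervals correspond to taking or leaving the prime 3. In the greedy choice
  the error is controlled by the tail of the Euler product, which tends to 1.\<close>

lemma sieve_factor_dense:
  assumes x: "x \<in> {1 / zeta 2..2 / 3} \<union> {9 / (8 * zeta 2)..3 / 4}" and e: "0 < e"
  shows "\<forall>\<^sub>F Y in sequentially. \<exists>S\<subseteq>primes_upto Y. 2 \<in> S \<and> \<bar>sieve_factor S - x\<bar> < e"
proof -
  let ?R = "3 / (2 * zeta 2)"
  have R0: "?R > 0" using zeta_2_pos by simp
  obtain B where B: "B = {2,3} \<or> B = {2::nat}" and m: "?R \<le> x / sieve_factor B" "x / sieve_factor B \<le> 1"
  proof -
    from x show ?thesis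
    proof
      assume "x \<in> {1 / zeta 2..2 / 3}"
      thus ?thesis using that[of "{2,3}"] by (simp add: sieve_factor_def field_simps)
    next
      assume "x \<in> {9 / (8 * zeta 2)..3 / 4}"
      thus ?thesis using that[of "{2}"] by (simp add: sieve_factor_def field_simps)
    qed
  qed
  define b where "b = sieve_factor B"
  have "prime q" if "q \<in> B" for q using B that by auto
  hence b: "0 < b" "b \<le> 1" using sieve_factor_bounds[of B] by (auto simp: b_def)
  define m where "m = x / b"
  have m01: "?R \<le> m" "m \<le> 1" using m by (auto simp: m_def b_def)
  have m0: "0 < m" using R0 m01(1) by linarith
  have xb: "x = b * m" using b by (simp add: m_def)
  have "(\<lambda>Y. sieve_factor (primes_5_upto Y) / ?R) \<longlonglongrightarrow> ?R / ?R"
    using R0 by (intro tendsto_intros sieve_factor_5_tendsto) auto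
  hence "(\<lambda>Y. sieve_factor (primes_5_upto Y) / ?R) \<longlonglongrightarrow> 1" using R0 by simp
  hence "\<forall>\<^sub>F Y in sequentially. sieve_factor (primes_5_upto Y) / ?R < 1 + e"
    by (rule order_tendstoD) (use e in simp)
  thus ?thesis using eventually_ge_at_top[of 3]
  proof eventually_elim
    case (elim Y)
    obtain S where S: "S \<subseteq> primes_5_upto Y" "m \<le> sieve_factor S"
      "sieve_factor S * ?R \<le> m * sieve_factor (primes_5_upto Y)" using greedy_sieve_factor[OF m01] by blast
    have finS: "finite S" using S(1) by (rule finite_subset) simp
    have "sieve_factor S \<le> m * (sieve_factor (primes_5_upto Y) / ?R)" using S(3) R0 by (simp add: field_simps)
    also have "\<dots> < m * (1 + e)" using elim(1) m0 by (intro mult_strict_left_mono) auto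
    also have "\<dots> \<le> m + e" using m01(2) e by (simp add: distrib_left)
    finally have "b * sieve_factor S < b * (m + e)" using b by simp
    also have "\<dots> \<le> x + e" using b e by (simp add: xb distrib_left)
    finally have up: "b * sieve_factor S < x + e" .
    have lo: "x \<le> b * sieve_factor S" unfolding xb using S(2) b by simp
    have "sieve_factor (B \<union> S) = b * sieve_factor S" unfolding b_def
      using B S(1) finS by (intro sieve_factor_union) (auto simp: primes_5_upto_def)
    moreover have "B \<union> S \<subseteq> primes_upto Y" "2 \<in> B \<union> S"
      using B S(1) elim(2) by (auto simp: primes_5_upto_def primes_upto_def)
    ultimately show ?case using up lo e by (intro exI[of _ "B \<union> S"]) auto
  qed
qed

section \<open>Uniformity of the limit as a condition on discrete logarithms\<close>

text \<open>That is, \<open>i\<close> and \<open>j\<close> together generate \<open>\<int>/n\<close>, see \<open>generates_iff\<close>.\<close>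

definition generates :: "nat \<Rightarrow> int \<Rightarrow> int \<Rightarrow> bool" where
  "generates n i j \<longleftrightarrow> (\<forall>q\<in>prime_factors n. \<not> (int q dvd i \<and> int q dvd j))"

text \<open>Jordan's totient of order two, one prime at a time: the pairs divisible by \<open>q\<close> are \<open>q\<close>
  times the pairs for \<open>n div q\<close>.\<close>

lemma card_pairs_no_common_prime:
  assumes "finite S" "\<And>q. q \<in> S \<Longrightarrow> prime q \<and> q dvd n"
  shows "real (card {(i,j). i \<in> {0..<int n} \<and> j \<in> {0..<int n} \<and> (\<forall>q\<in>S. \<not> (int q dvd i \<and> int q dvd j))})
     = real n ^ 2 * sieve_factor S"
  using assms
proof (induction S arbitrary: n rule: finite_induct)
  case empty
  have "{(i,j). i \<in> {0..<int n} \<and> j \<in> {0..<int n} \<and> (\<forall>q\<in>{}. \<not> (int q dvd i \<and> int q dvd j))} = {0..<int n} \<times> {0..<int n}"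
    by auto
  thus ?case by (simp add: sieve_factor_def power2_eq_square)
next
  case (insert q S)
  let ?T = "\<lambda>n S. {(i,j). i \<in> {0..<int n} \<and> j \<in> {0..<int n} \<and> (\<forall>q\<in>S. \<not> (int q dvd i \<and> int q dvd j))}"
  have fin: "finite (?T n S)" for n S by (rule finite_subset[of _ "{0..<int n} \<times> {0..<int n}"]) auto
  have q: "prime q" "q dvd n" using insert.prems by auto
  then obtain m where m: "n = q * m" by auto
  have q0: "int q > 0" using q prime_gt_0_nat[of q] by simp
  have ndvd: "int r dvd int q * i \<longleftrightarrow> int r dvd i" if "r \<in> S" for r i
  proof -
    have r: "prime r" "r \<noteq> q" using that insert by auto
    hence "\<not> r dvd q" using q primes_dvd_imp_eq by blast
    hence "\<not> int r dvd int q" by simp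
    moreover have "prime (int r)" using r by simp
    ultimately show ?thesis by (metis prime_dvd_mult_iff)
  qed
  have rm: "prime r \<and> r dvd m" if "r \<in> S" for r
  proof -
    have r: "prime r" "r \<noteq> q" "r dvd q * m" using that insert m by auto
    hence "\<not> r dvd q" using q primes_dvd_imp_eq by blast
    thus ?thesis using r by (auto simp: prime_dvd_mult_iff)
  qed
  let ?f = "\<lambda>(i,j). (int q * i, int q * j)"
  have sub: "?f ` ?T m S \<subseteq> ?T n S"
  proof
    fix x assume "x \<in> ?f ` ?T m S"
    then obtain i j where ij: "x = (int q * i, int q * j)" "(i,j) \<in> ?T m S" by auto
    thus "x \<in> ?T n S" using q0 ndvd by (auto simp: m)
  qed
  have "?T n (insert q S) = ?T n S - ?f ` ?T m S"
  proof (intro equalityI subsetI)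
    fix x assume "x \<in> ?T n (insert q S)"
    thus "x \<in> ?T n S - ?f ` ?T m S" by auto
  next
    fix x assume x: "x \<in> ?T n S - ?f ` ?T m S"
    obtain i j where ij: "x = (i,j)" by (cases x)
    have "\<not> (int q dvd i \<and> int q dvd j)"
    proof
      assume "int q dvd i \<and> int q dvd j"
      then obtain i' j' where e: "i = int q * i'" "j = int q * j'" by (auto elim!: dvdE)
      have "(i', j') \<in> ?T m S" using x ij e q0 ndvd m by (auto simp: zero_le_mult_iff)
      hence "x \<in> ?f ` ?T m S" using ij e by (intro image_eqI[of _ _ "(i',j')"]) auto
      thus False using x by simp
    qed
    thus "x \<in> ?T n (insert q S)" using x ij by auto
  qed
  hence "card (?T n (insert q S)) = card (?T n S) - card (?f ` ?T m S)"
    using sub by (simp only:) (rule card_Diff_subset[OF finite_subset[OF sub fin] sub])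
  moreover have "card (?f ` ?T m S) \<le> card (?T n S)" by (rule card_mono[OF fin sub])
  moreover have "card (?f ` ?T m S) = card (?T m S)"
    using q0 by (intro card_image) (auto simp: inj_on_def)
  ultimately have "real (card (?T n (insert q S))) = real (card (?T n S)) - real (card (?T m S))" by simp
  also have "\<dots> = real n ^ 2 * sieve_factor S - real m ^ 2 * sieve_factor S"
    using insert.IH[of n] insert.IH[of m] rm insert.prems by simp
  also have "\<dots> = real n ^ 2 * sieve_factor (insert q S)"
    using insert.hyps q0 by (simp add: sieve_factor_def m field_simps power_mult_distrib)
  finally show ?case .
qed

lemma card_generates:
  assumes "n > 0"
  shows "real (card {(i,j). i \<in> {0..<int n} \<and> j \<in> {0..<int n} \<and> generates n i j}) = real n ^ 2 * sieve_factor (prime_factors n)"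
  unfolding generates_def by (rule card_pairs_no_common_prime) auto

text \<open>If \<open>d\<close> annihilates \<open>i\<close> and \<open>j\<close> modulo \<open>n\<close>, every prime factor of \<open>n div gcd n d\<close> divides
  both; conversely \<open>n div q\<close> annihilates multiples of \<open>q\<close>.\<close>

lemma generates_iff:
  assumes n: "n > 0"
  shows "generates n i j \<longleftrightarrow> (\<forall>d\<in>{0<..<int n}. \<not> (int n dvd d * i \<and> int n dvd d * j))"
proof
  assume g: "generates n i j"
  show "\<forall>d\<in>{0<..<int n}. \<not> (int n dvd d * i \<and> int n dvd d * j)"
  proof (intro ballI notI)
    fix d assume d: "d \<in> {0<..<int n}" "int n dvd d * i \<and> int n dvd d * j"
    \<comment> \<open>With \<open>n = g' e\<close> and \<open>d = g' f\<close>, where \<open>e\<close> and \<open>f\<close> are coprime, \<open>e > 1\<close> divides \<open>i\<close> and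
      \<open>j\<close>.\<close>
    define g' where "g' = gcd (int n) d"
    have g0: "g' > 0" using d by (simp add: g'_def)
    obtain e where e: "int n = g' * e" unfolding g'_def by (meson gcd_dvd1 dvdE)
    obtain f where f: "d = g' * f" unfolding g'_def by (meson gcd_dvd2 dvdE)
    have "gcd (g' * e) (g' * f) = g'" using e f g'_def by metis
    hence "g' * gcd e f = g'" using g0 by (simp add: gcd_mult_left abs_of_pos)
    hence cop: "coprime e f" using g0 by (simp add: coprime_iff_gcd_eq_1)
    have "e dvd f * i" "e dvd f * j" using d(2) g0 unfolding e f by (simp_all add: mult.assoc)
    hence ei: "e dvd i" "e dvd j" using cop by (simp_all add: coprime_dvd_mult_right_iff)
    have e0: "e > 0" using e n g0 by (metis of_nat_0_less_iff zero_less_mult_pos)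
    have "g' \<le> d" unfolding g'_def using d by (intro zdvd_imp_le) auto
    hence "e \<noteq> 1" using e d by auto
    hence "nat e \<noteq> 1" using e0 by (simp add: nat_eq_iff)
    then obtain q where q: "prime q" "q dvd nat e" using prime_factor_nat by blast
    have qe: "int q dvd e" using q e0 by (metis int_dvd_int_iff int_nat_eq less_imp_le)
    have "int q dvd int n" using qe e by auto
    hence "q \<in> prime_factors n" using q n by (auto simp: prime_factors_dvd)
    thus False using g qe ei unfolding generates_def by (meson dvd_trans)
  qed
next
  assume h: "\<forall>d\<in>{0<..<int n}. \<not> (int n dvd d * i \<and> int n dvd d * j)"
  show "generates n i j" unfolding generates_def
  proof (intro ballI notI)
    fix q assume q: "q \<in> prime_factors n" "int q dvd i \<and> int q dvd j"
    then obtain m where m: "n = q * m" by (auto simp: prime_factors_dvd)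
    have "prime q" using q by (auto simp: prime_factors_dvd)
    hence q1: "q > 1" by (rule prime_gt_1_nat)
    have m0: "m > 0" using m n by (auto intro!: Nat.gr0I)
    have "int m \<in> {0<..<int n}" using m0 q1 m by simp
    moreover have "int n dvd int m * i" "int n dvd int m * j" using q(2) m by (auto simp: mult.commute intro: mult_dvd_mono)
    ultimately show False using h by blast
  qed
qed

text \<open>A convex combination of points of the unit circle has modulus 1 only if the points
  coincide: project onto the direction of the combination.\<close>

lemma convex_unit_norm:
  fixes u v w :: complex
  assumes "norm u = 1" "norm v = 1" "norm w = 1"
  shows "norm (1/2 * u + 1/4 * v + 1/4 * w) = 1 \<longleftrightarrow> u = v \<and> u = w"
proof
  assume e: "norm (1/2 * u + 1/4 * v + 1/4 * w) = 1"
  define z where "z = 1/2 * u + 1/4 * v + 1/4 * w"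
  have nz: "norm z = 1" using e by (simp only: z_def)
  hence z: "z * cnj z = 1" using complex_norm_square[of z] by simp
  have norm_eq: "norm (x * cnj z) = 1" if "norm x = 1" for x
    using that nz by (simp only: norm_mult complex_mod_cnj mult_1)
  have le: "Re (x * cnj z) \<le> 1" if "norm x = 1" for x
    using complex_Re_le_cmod[of "x * cnj z"] norm_eq[OF that] by linarith
  have "Re (z * cnj z) = 1" using z by simp
  moreover have "z * cnj z = 1/2 * (u * cnj z) + 1/4 * (v * cnj z) + 1/4 * (w * cnj z)"
    by (subst (1) z_def) (simp only: ring_distribs mult.assoc)
  moreover have "Re (1/2 * x + 1/4 * y + 1/4 * t) = 1/2 * Re x + 1/4 * Re y + 1/4 * Re t" for x y t
    by simp
  ultimately have "1/2 * Re (u * cnj z) + 1/4 * Re (v * cnj z) + 1/4 * Re (w * cnj z) = 1"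
    by (simp only:)
  hence re: "Re (u * cnj z) = 1" "Re (v * cnj z) = 1" "Re (w * cnj z) = 1"
    using le[OF assms(1)] le[OF assms(2)] le[OF assms(3)] by linarith+
  have eq: "x = z" if "norm x = 1" "Re (x * cnj z) = 1" for x
  proof -
    have "norm (x * cnj z) = 1" using that(1) by (rule norm_eq)
    hence "Re (x * cnj z) ^ 2 + Im (x * cnj z) ^ 2 = 1" by (simp add: cmod_def)
    hence "Im (x * cnj z) = 0" using that(2) by simp
    hence "x * cnj z = 1" using that(2) by (simp add: complex_eq_iff)
    hence "x * (cnj z * z) = z" by (metis mult.assoc mult.commute mult_1)
    thus ?thesis using z by (simp add: mult.commute)
  qed
  show "u = v \<and> u = w" using eq re assms by metis
next
  assume "u = v \<and> u = w"
  hence "v = u" "w = u" by auto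
  hence "1/2 * u + 1/4 * v + 1/4 * w = u" by (simp add: field_simps)
  thus "norm (1/2 * u + 1/4 * v + 1/4 * w) = 1" using assms by simp
qed

lemma chi_eq_1: "chi n j x = chi n 1 (j * x)"
  by (simp add: chi_def mult.assoc)

lemma chi_add: "chi n 1 (x + y) = chi n 1 x * chi n 1 y"
  by (simp add: chi_def exp_add[symmetric] ring_distribs add_divide_distrib)

lemma chi_eq_1_iff: "n > 0 \<Longrightarrow> chi n 1 x = 1 \<longleftrightarrow> int n dvd x"
  using exp_2pi_eq_1_iff[of n x] by (simp add: chi_def)

lemma chi_nonzero: "chi n j x \<noteq> 0"
  by (simp add: chi_def)

lemma norm_chi: "norm (chi n j x) = 1"
proof -
  have "2 * of_real pi * \<i> * of_int j * of_int x / of_nat n = \<i> * of_real (2 * pi * of_int j * of_int x / of_nat n)"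
    by (simp add: mult.commute mult.left_commute)
  thus ?thesis unfolding chi_def by (simp only: norm_exp_i_times)
qed

lemma chi_eq_iff: "n > 0 \<Longrightarrow> chi n 1 x = chi n 1 y \<longleftrightarrow> int n dvd x - y"
proof -
  assume n: "n > 0"
  have "chi n 1 x = chi n 1 (x - y) * chi n 1 y" using chi_add[of n "x - y" y] by simp
  hence "chi n 1 x = chi n 1 y \<longleftrightarrow> chi n 1 (x - y) = 1" using chi_nonzero[of n 1 y] by auto
  thus ?thesis using chi_eq_1_iff[OF n] by simp
qed

lemma sum_chi:
  assumes "n > 0"
  shows "(\<Sum>x\<in>{0..<int n}. chi n j x) = (if int n dvd j then of_nat n else 0)"
proof (cases "int n dvd j")
  case True
  have "chi n j x = 1" for x using True assms by (subst chi_eq_1) (simp add: chi_eq_1_iff)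
  thus ?thesis using True by simp
next
  case False
  have p: "chi n j (int k) = chi n 1 j ^ k" for k
  proof (induction k)
    case 0 thus ?case by (simp add: chi_def)
  next
    case (Suc k)
    have "chi n j (int (Suc k)) = chi n 1 (j * int k + j)" by (subst chi_eq_1) (simp add: algebra_simps)
    thus ?case using Suc chi_eq_1[of n j "int k"] by (simp add: chi_add)
  qed
  have z: "chi n 1 j \<noteq> 1" using False assms by (simp add: chi_eq_1_iff)
  have "chi n 1 j ^ n = chi n j (int n)" by (simp add: p)
  also have "\<dots> = 1" using assms by (subst chi_eq_1) (simp add: chi_eq_1_iff)
  finally have zn: "chi n 1 j ^ n = 1" .
  have "(\<Sum>x\<in>{0..<int n}. chi n j x) = (\<Sum>k\<in>{..<n}. chi n j (int k))"
    by (rule sum.reindex_bij_witness[where i = int and j = nat]) auto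
  also have "\<dots> = (\<Sum>k<n. chi n 1 j ^ k)" by (simp add: p)
  finally have "(1 - chi n 1 j) * (\<Sum>x\<in>{0..<int n}. chi n j x) = 0"
    using one_diff_power_eq[of "chi n 1 j" n] zn by simp
  thus ?thesis using z False by simp
qed

text \<open>The coefficients of \<open>\<phi>\<^sub>k\<close> with respect to the characters are the \<open>\<lambda>\<^sub>j\<^sup>k\<close> with \<open>\<bar>\<lambda>\<^sub>j\<bar> = 1\<close>,
  which are nonzero, so the function is constant only if \<open>j = 0\<close> is the sole index. This
  is independent of \<open>k\<close>.\<close>

lemma phi_uniform_iff:
  assumes p: "p > 2"
  defines "n \<equiv> p - 1"
  shows "(\<forall>x\<in>{0..<int n}. phi p lg A B k x = 1 / of_nat n) \<longleftrightarrow>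
    generates n (lg (alpha p A B) - lg (beta p A B)) (lg (alpha p A B) - lg (gamma p A B))"
proof -
  let ?a = "lg (alpha p A B)" and ?b = "lg (beta p A B)" and ?c = "lg (gamma p A B)"
  have n: "n > 0" using p by (simp add: n_def)
  define J where "J = {j \<in> {0..<int n}. cmod (lam p lg A B j) = 1}"
  have lam_iff: "cmod (lam p lg A B j) = 1 \<longleftrightarrow> int n dvd j * (?a - ?b) \<and> int n dvd j * (?a - ?c)" for j
  proof -
    have "cmod (lam p lg A B j) = 1 \<longleftrightarrow> chi n j (- ?a) = chi n j (- ?b) \<and> chi n j (- ?a) = chi n j (- ?c)"
      unfolding lam_def n_def[symmetric] by (intro convex_unit_norm norm_chi)
    also have "\<dots> \<longleftrightarrow> int n dvd - (j * (?a - ?b)) \<and> int n dvd - (j * (?a - ?c))"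
      using n by (subst (1 2 3 4) chi_eq_1) (simp add: chi_eq_iff algebra_simps)
    finally show ?thesis by (simp only: dvd_minus_iff)
  qed
  have finJ: "finite J" by (rule finite_subset[of _ "{0..<int n}"]) (auto simp: J_def)
  have phi: "phi p lg A B k x = 1 / of_nat n * (\<Sum>j\<in>J. lam p lg A B j ^ k * chi n j x)" for x
    by (simp add: phi_def J_def n_def)
  have J0: "0 \<in> J" using n by (simp add: J_def lam_iff)
  have lam0: "lam p lg A B 0 = 1" by (simp add: lam_def chi_def)
  have gen: "generates n (?a - ?b) (?a - ?c) \<longleftrightarrow> J = {0}"
  proof -
    have "generates n (?a - ?b) (?a - ?c) \<longleftrightarrow> (\<forall>d\<in>{0<..<int n}. d \<notin> J)"
      unfolding generates_iff[OF n] using lam_iff by (auto simp: J_def)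
    also have "\<dots> \<longleftrightarrow> J = {0}"
    proof
      assume h: "\<forall>d\<in>{0<..<int n}. d \<notin> J"
      have "x = 0" if "x \<in> J" for x
      proof (rule ccontr)
        assume "x \<noteq> 0"
        moreover have "0 \<le> x" "x < int n" using that by (simp_all add: J_def)
        ultimately have "x \<in> {0<..<int n}" by simp
        thus False using h that by blast
      qed
      thus "J = {0}" using J0 by blast
    next
      assume "J = {0}" thus "\<forall>d\<in>{0<..<int n}. d \<notin> J" by simp
    qed
    finally show ?thesis .
  qed
  show ?thesis unfolding gen
  proof
    assume "J = {0}"
    thus "\<forall>x\<in>{0..<int n}. phi p lg A B k x = 1 / of_nat n"
      by (simp add: phi lam0) (simp add: chi_def)
  next
    assume u: "\<forall>x\<in>{0..<int n}. phi p lg A B k x = 1 / of_nat n"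
    show "J = {0}"
    proof (rule ccontr)
      assume "J \<noteq> {0}"
      then obtain d where d: "d \<in> J" "d \<noteq> 0" using J0 by auto
      have d': "d \<in> {0<..<int n}" using d by (auto simp: J_def)
      have "(\<Sum>x\<in>{0..<int n}. phi p lg A B k x * chi n (- d) x) = (\<Sum>x\<in>{0..<int n}. \<Sum>j\<in>J. 1 / of_nat n * lam p lg A B j ^ k * chi n (j - d) x)"
      proof (rule sum.cong[OF refl])
        fix x
        have "chi n j x * chi n (- d) x = chi n (j - d) x" for j
          unfolding chi_eq_1[of n j] chi_eq_1[of n "-d"] chi_eq_1[of n "j - d"]
          by (simp add: chi_add[symmetric] algebra_simps)
        thus "phi p lg A B k x * chi n (- d) x = (\<Sum>j\<in>J. 1 / of_nat n * lam p lg A B j ^ k * chi n (j - d) x)"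
          unfolding phi by (simp add: sum_distrib_left sum_distrib_right mult.assoc)
      qed
      also have "\<dots> = (\<Sum>j\<in>J. 1 / of_nat n * lam p lg A B j ^ k * (\<Sum>x\<in>{0..<int n}. chi n (j - d) x))"
        by (subst sum.swap) (simp add: sum_distrib_left)
      also have "\<dots> = (\<Sum>j\<in>J. if j = d then lam p lg A B d ^ k else 0)"
      proof (rule sum.cong[OF refl])
        fix j assume j: "j \<in> J"
        have "int n dvd j - d \<longleftrightarrow> j = d"
        proof
          assume h: "int n dvd j - d"
          have "\<bar>j - d\<bar> < int n" using j d' by (auto simp: J_def)
          thus "j = d" using h by (metis dvd_imp_le_int eq_iff_diff_eq_0 not_le abs_of_nat)
        qed simp
        thus "1 / of_nat n * lam p lg A B j ^ k * (\<Sum>x\<in>{0..<int n}. chi n (j - d) x) = (if j = d then lam p lg A B d ^ k else 0)"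
          using n by (simp add: sum_chi)
      qed
      also have "\<dots> = lam p lg A B d ^ k" using finJ d by simp
      finally have 1: "(\<Sum>x\<in>{0..<int n}. phi p lg A B k x * chi n (- d) x) = lam p lg A B d ^ k" .
      have "(\<Sum>x\<in>{0..<int n}. phi p lg A B k x * chi n (- d) x) = 1 / of_nat n * (\<Sum>x\<in>{0..<int n}. chi n (- d) x)"
        using u by (simp add: sum_distrib_left)
      also have "\<dots> = 0" using n d' by (auto simp: sum_chi dest: zdvd_imp_le)
      finally have "lam p lg A B d = 0" using 1 by simp
      thus False using d by (simp add: J_def)
    qed
  qed
qed

text \<open>The multiples \<open>c [A,B]\<close> with \<open>c \<noteq> 0\<close> are distinct and are exactly the nonzero points of
  the line, so the equality of the two mass functions can be tested on \<open>\<phi>\<^sub>k\<close>.\<close>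

lemma limit_uniform_iff:
  assumes p: "prime p" "odd p" and lg: "is_log p lg"
  shows "limit_uniform p lg k A B \<longleftrightarrow>
    \<not> [alpha p A B * beta p A B * gamma p A B = 0] (mod int p) \<and> bracket p A B \<noteq> 0 \<and>
    generates (p - 1) (lg (alpha p A B) - lg (beta p A B)) (lg (alpha p A B) - lg (gamma p A B))"
proof (cases "bracket p A B = 0")
  case True thus ?thesis by (simp add: limit_uniform_def)
next
  case False
  note L = is_log_bij_hom[OF p lg]
  have p2: "p > 2" using p prime_gt_1_nat[of p] by (cases "p = 2") auto
  define V where "V = bracket p A B"
  have V0: "V \<noteq> 0" using False by (simp add: V_def)
  then obtain r c where rc: "V $ r $ c \<noteq> 0" by (auto simp: vec_eq_iff)
  have "V $ r $ c \<in> {0..<int p}" using p2 by (simp add: V_def bracket_def map_matrix_def)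
  hence cop: "coprime (V $ r $ c) (int p)" using rc p
    by (metis atLeastLessThan_iff coprime_commute nat_int prime_imp_coprime prime_int_nat_transfer order_le_less zdvd_not_zless of_nat_0_le_iff)
  have inj: "inj_on (\<lambda>x. scale p x V) {0..<int p}"
  proof (rule inj_onI)
    fix x y assume xy: "x \<in> {0..<int p}" "y \<in> {0..<int p}" "scale p x V = scale p y V"
    have "(x * V $ r $ c) mod int p = (y * V $ r $ c) mod int p"
      using arg_cong[OF xy(3), of "\<lambda>M. M $ r $ c"] by (simp add: scale_def map_matrix_def)
    hence "[x * V $ r $ c = y * V $ r $ c] (mod int p)" by (simp add: cong_def)
    hence "[x = y] (mod int p)" using cop by (simp add: cong_mult_rcancel)
    thus "x = y" using xy by (simp add: cong_def)
  qed
  have s0: "scale p 0 V = 0" by (simp add: scale_def map_matrix_def vec_eq_iff)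
  define I where "I = (\<lambda>x. scale p x V) ` {0<..<int p}"
  have R: "{0..<int p} = insert 0 {0<..<int p}" using p2 by auto
  have "0 \<notin> I"
  proof
    assume "0 \<in> I"
    then obtain x where "x \<in> {0<..<int p}" "scale p x V = scale p 0 V" using s0 by (auto simp: I_def)
    thus False using inj_onD[OF inj, of x 0] p2 by auto
  qed
  hence line: "line p V - {0} = I" unfolding line_def R I_def using s0 by auto
  have injI: "inj_on (\<lambda>x. scale p x V) {0<..<int p}" using inj by (rule inj_on_subset) auto
  have cardI: "card I = p - 1" unfolding I_def using card_image[OF injI] by simp
  have "scale p 1 V \<in> I" using p2 by (simp add: I_def)
  hence I: "finite I" "I \<noteq> {}" by (auto simp: I_def)
  have nu: "pmf (nu p A B) X = (if X \<in> I then 1 / real (p - 1) else 0)" for X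
    unfolding nu_def V_def[symmetric] line using I by (simp add: cardI indicator_def)
  have nu_even_I: "nu_even p lg A B k (scale p x V) = phi p lg A B k (lg x)" if "x \<in> {0<..<int p}" for x
  proof -
    have "{c. c \<in> carrier (mult_group p) \<and> scale p c V = scale p x V} = {x}"
      unfolding L(4) using that inj_onD[OF injI] by auto
    thus ?thesis by (simp add: nu_even_def V_def)
  qed
  have nu_even_0: "nu_even p lg A B k X = 0" if "X \<notin> I" for X
  proof -
    have "{c. c \<in> carrier (mult_group p) \<and> scale p c V = X} = {}"
      unfolding L(4) using that by (auto simp: I_def)
    thus ?thesis unfolding nu_even_def V_def[symmetric] by (simp only: sum.empty)
  qed
  have "(\<forall>X. nu_even p lg A B k X = complex_of_real (pmf (nu p A B) X)) \<longleftrightarrow>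
    (\<forall>x\<in>{0<..<int p}. phi p lg A B k (lg x) = 1 / of_nat (p - 1))"
  proof
    assume h: "\<forall>X. nu_even p lg A B k X = complex_of_real (pmf (nu p A B) X)"
    show "\<forall>x\<in>{0<..<int p}. phi p lg A B k (lg x) = 1 / of_nat (p - 1)"
    proof
      fix x assume x: "x \<in> {0<..<int p}"
      have "scale p x V \<in> I" using x by (simp add: I_def)
      thus "phi p lg A B k (lg x) = 1 / of_nat (p - 1)"
        using h[rule_format, of "scale p x V"] nu_even_I[OF x] by (simp add: nu)
    qed
  next
    assume h: "\<forall>x\<in>{0<..<int p}. phi p lg A B k (lg x) = 1 / of_nat (p - 1)"
    show "\<forall>X. nu_even p lg A B k X = complex_of_real (pmf (nu p A B) X)"
    proof
      fix X show "nu_even p lg A B k X = complex_of_real (pmf (nu p A B) X)"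
      proof (cases "X \<in> I")
        case True
        then obtain x where "x \<in> {0<..<int p}" "X = scale p x V" by (auto simp: I_def)
        thus ?thesis using h nu_even_I True by (simp add: nu)
      qed (simp add: nu nu_even_0)
    qed
  qed
  also have "\<dots> \<longleftrightarrow> (\<forall>y\<in>lg ` {0<..<int p}. phi p lg A B k y = 1 / of_nat (p - 1))" by blast
  also have "lg ` {0<..<int p} = {0..<int (p - 1)}" using L(1) by (simp only: bij_betw_def)
  finally show ?thesis using phi_uniform_iff[OF p2] by (simp only: limit_uniform_def)
qed

section \<open>Counting pairs of matrices by their Gram invariants\<close>

lemma sum_affine_mod:
  fixes f :: "int \<Rightarrow> real"
  assumes p: "p > 0" and c: "coprime c (int p)"
  shows "(\<Sum>x\<in>{0..<int p}. f ((c * x + d) mod int p)) = (\<Sum>x\<in>{0..<int p}. f x)"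
proof -
  have inj: "inj_on (\<lambda>x. (c * x + d) mod int p) {0..<int p}"
  proof (rule inj_onI)
    fix x y assume xy: "x \<in> {0..<int p}" "y \<in> {0..<int p}" "(c * x + d) mod int p = (c * y + d) mod int p"
    hence "[c * x + d = c * y + d] (mod int p)" by (simp add: cong_def)
    hence "[c * x = c * y] (mod int p)" by (simp only: cong_add_rcancel)
    hence "[x = y] (mod int p)" using c by (simp add: cong_mult_lcancel)
    thus "x = y" using xy by (simp add: cong_def)
  qed
  have "(\<lambda>x. (c * x + d) mod int p) ` {0..<int p} = {0..<int p}"
    using inj p by (intro endo_inj_surj) auto
  thus ?thesis using sum.reindex[OF inj, of f] by (simp add: o_def)
qed

lemma mult_mod_prime_unit:
  assumes "prime p" "x \<in> {0<..<int p}" "y \<in> {0<..<int p}"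
  shows "(x * y) mod int p \<in> {0<..<int p}"
proof -
  have "\<not> int p dvd x" "\<not> int p dvd y" using assms by (auto dest: zdvd_imp_le)
  hence "\<not> int p dvd x * y" using assms(1) by (simp add: prime_dvd_mult_iff)
  hence "(x * y) mod int p \<noteq> 0" by (simp add: dvd_eq_mod_eq_0)
  moreover have "0 \<le> (x * y) mod int p" "(x * y) mod int p < int p" using assms(2) by auto
  ultimately show ?thesis by simp
qed

lemma coprime_prime_unit:
  assumes "prime p" "x \<in> {0<..<int p}"
  shows "coprime x (int p)"
proof -
  have "\<not> int p dvd x" using assms by (auto dest: zdvd_imp_le)
  moreover have "prime (int p)" using assms(1) by simp
  ultimately have "coprime (int p) x" by (intro prime_imp_coprime)
  thus ?thesis by (simp only: coprime_commute)
qed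

lemma sum_mult_mod_units:
  fixes f :: "int \<Rightarrow> real"
  assumes p: "prime p" and c: "c \<in> {0<..<int p}"
  shows "(\<Sum>x\<in>{0<..<int p}. f ((c * x) mod int p)) = (\<Sum>x\<in>{0<..<int p}. f x)"
proof -
  have inj: "inj_on (\<lambda>x. (c * x) mod int p) {0<..<int p}"
  proof (rule inj_onI)
    fix x y assume xy: "x \<in> {0<..<int p}" "y \<in> {0<..<int p}" "(c * x) mod int p = (c * y) mod int p"
    hence "[c * x = c * y] (mod int p)" by (simp add: cong_def)
    hence "[x = y] (mod int p)" using coprime_prime_unit[OF p c] by (simp add: cong_mult_lcancel)
    thus "x = y" using xy by (simp add: cong_def)
  qed
  have "(\<lambda>x. (c * x) mod int p) ` {0<..<int p} = {0<..<int p}"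
    using inj mult_mod_prime_unit[OF p c] by (intro endo_inj_surj) auto
  thus ?thesis using sum.reindex[OF inj, of f] by (simp add: o_def)
qed

lemma sum_swap4:
  fixes f :: "'a \<Rightarrow> 'b \<Rightarrow> 'c \<Rightarrow> 'd \<Rightarrow> real"
  shows "(\<Sum>u\<in>A. \<Sum>v\<in>B. \<Sum>y\<in>C. \<Sum>x\<in>D. f u v y x) = (\<Sum>v\<in>B. \<Sum>y\<in>C. \<Sum>x\<in>D. \<Sum>u\<in>A. f u v y x)"
proof -
  have "(\<Sum>u\<in>A. \<Sum>v\<in>B. \<Sum>y\<in>C. \<Sum>x\<in>D. f u v y x) = (\<Sum>v\<in>B. \<Sum>u\<in>A. \<Sum>y\<in>C. \<Sum>x\<in>D. f u v y x)"
    by (rule sum.swap)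
  also have "\<dots> = (\<Sum>v\<in>B. \<Sum>y\<in>C. \<Sum>u\<in>A. \<Sum>x\<in>D. f u v y x)"
    by (intro sum.cong refl) (rule sum.swap)
  also have "\<dots> = (\<Sum>v\<in>B. \<Sum>y\<in>C. \<Sum>x\<in>D. \<Sum>u\<in>A. f u v y x)"
    by (intro sum.cong refl) (rule sum.swap)
  finally show ?thesis .
qed

text \<open>For \<open>A = (a, b; c, -a)\<close> and \<open>B = (a', b'; c', -a')\<close> let \<open>Q = a\<^sup>2 + b c\<close>,
  \<open>u = 2 a a' + b c' + c b'\<close> and \<open>R = a'\<^sup>2 + b' c'\<close>; then \<open>(\<alpha>, \<beta>, \<gamma>) = (2 u, 4 Q, 4 R)\<close>. A
  weight \<open>G\<close> on these invariants is considered that depends only on the ratios \<open>Q/u\<close> and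
  \<open>R/u\<close>, through \<open>K\<close>.\<close>

locale homogeneous_weight =
  fixes p :: nat and G :: "int \<Rightarrow> int \<Rightarrow> int \<Rightarrow> real" and K :: "int \<Rightarrow> int \<Rightarrow> real"
  assumes p: "prime p"
    and zero: "\<And>Q R. G Q 0 R = 0"
    and hom: "\<And>u v w. u \<in> {0<..<int p} \<Longrightarrow> G ((u * v) mod int p) u ((u * w) mod int p) = K (v mod int p) (w mod int p)"
begin

lemma p_pos: "p > 0" using p by (rule prime_gt_0_nat)

lemma residues_split: "{0..<int p} = insert 0 {0<..<int p}"
  using p_pos by auto

text \<open>The points with \<open>x = 0\<close> give the ratio \<open>w = g\<close>. For \<open>x \<noteq> 0\<close> write \<open>x = s r\<close> and \<open>u = s x\<close>:
  then \<open>x\<^sup>2 = u r\<close>, so \<open>w = r + g\<close>, which runs through the other residues while \<open>s\<close> is free.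
  The substitution avoids inverses modulo \<open>p\<close>.\<close>

lemma sum_conic:
  assumes v: "v \<in> {0..<int p}"
  shows "(\<Sum>x\<in>{0..<int p}. \<Sum>u\<in>{0<..<int p}. G ((u * v) mod int p) u ((x\<^sup>2 + u * g) mod int p))
    = (real p - 1) * (\<Sum>w\<in>{0..<int p}. K v w)"
proof -
  let ?U = "{0<..<int p}"
  let ?F = "\<lambda>x u. G ((u * v) mod int p) u ((x\<^sup>2 + u * g) mod int p)"
  have vm: "v mod int p = v" using v by simp
  have cardU: "real (card ?U) = real p - 1" using p_pos by simp
  have "(\<Sum>x\<in>?U. \<Sum>u\<in>?U. ?F x u) = (\<Sum>x\<in>?U. \<Sum>s\<in>?U. ?F x ((x * s) mod int p))"
    by (intro sum.cong refl sum_mult_mod_units[OF p, symmetric])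
  also have "\<dots> = (\<Sum>s\<in>?U. \<Sum>x\<in>?U. ?F x ((x * s) mod int p))" by (rule sum.swap)
  also have "\<dots> = (\<Sum>s\<in>?U. \<Sum>r\<in>?U. ?F ((s * r) mod int p) ((((s * r) mod int p) * s) mod int p))"
    by (intro sum.cong refl sum_mult_mod_units[OF p, symmetric])
  also have "\<dots> = (\<Sum>s\<in>?U. \<Sum>r\<in>?U. K v ((r + g) mod int p))"
  proof (intro sum.cong refl)
    fix s r assume sr: "s \<in> ?U" "r \<in> ?U"
    define x where "x = (s * r) mod int p"
    define u where "u = (x * s) mod int p"
    have x: "x \<in> ?U" unfolding x_def using mult_mod_prime_unit[OF p] sr by blast
    have u: "u \<in> ?U" unfolding u_def using mult_mod_prime_unit[OF p x] sr by blast
    have cx: "[x = s * r] (mod int p)" by (simp add: x_def cong_def)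
    have cu: "[u = s * r * s] (mod int p)"
      using cong_scalar_right[OF cx, of s] by (simp add: u_def cong_def)
    have "[x\<^sup>2 + u * g = (s * r)\<^sup>2 + u * g] (mod int p)" using cx by (intro cong_add cong_pow cong_refl)
    moreover have "[u * r + u * g = (s * r * s) * r + u * g] (mod int p)" using cu by (intro cong_add cong_mult cong_refl)
    moreover have "(s * r * s) * r + u * g = (s * r)\<^sup>2 + u * g" by (simp add: power2_eq_square)
    ultimately have "[x\<^sup>2 + u * g = u * (r + g)] (mod int p)" by (simp add: distrib_left) (metis cong_sym cong_trans)
    hence "(x\<^sup>2 + u * g) mod int p = (u * (r + g)) mod int p" by (simp add: cong_def)
    thus "?F ((s * r) mod int p) ((((s * r) mod int p) * s) mod int p) = K v ((r + g) mod int p)"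
      unfolding x_def[symmetric] u_def[symmetric] using hom[OF u, of v "r + g"] vm by simp
  qed
  also have "\<dots> = (real p - 1) * (\<Sum>r\<in>?U. K v ((r + g) mod int p))" by (simp add: cardU[symmetric])
  finally have nz: "(\<Sum>x\<in>?U. \<Sum>u\<in>?U. ?F x u) = (real p - 1) * (\<Sum>r\<in>?U. K v ((r + g) mod int p))" .
  have z: "(\<Sum>u\<in>?U. ?F 0 u) = (real p - 1) * K v (g mod int p)"
  proof -
    have "(\<Sum>u\<in>?U. ?F 0 u) = (\<Sum>u\<in>?U. K v (g mod int p))"
      using hom[of _ v g] vm by (intro sum.cong refl) simp
    thus ?thesis by (simp add: cardU[symmetric])
  qed
  have "(\<Sum>x\<in>{0..<int p}. \<Sum>u\<in>?U. ?F x u) = (real p - 1) * (K v (g mod int p) + (\<Sum>r\<in>?U. K v ((r + g) mod int p)))"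
    unfolding residues_split using z nz by (subst sum.insert) (auto simp: distrib_left)
  also have "K v (g mod int p) + (\<Sum>r\<in>?U. K v ((r + g) mod int p)) = (\<Sum>r\<in>{0..<int p}. K v ((1 * r + g) mod int p))"
    unfolding residues_split by (subst sum.insert) auto
  also have "\<dots> = (\<Sum>w\<in>{0..<int p}. K v w)" using p_pos by (intro sum_affine_mod) auto
  finally show ?thesis .
qed

text \<open>Writing \<open>Q = u v\<close>, the third argument becomes \<open>x\<^sup>2 + u (y - v y\<^sup>2)\<close>, which is \<open>sum_conic\<close>
  for each \<open>v\<close> and \<open>y\<close>.\<close>

lemma sum_normal_form:
  "(\<Sum>Q\<in>{0..<int p}. \<Sum>y\<in>{0..<int p}. \<Sum>x\<in>{0..<int p}. \<Sum>u\<in>{0<..<int p}. G Q u ((x\<^sup>2 - Q * y\<^sup>2 + u * y) mod int p))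
    = real p * (real p - 1) * (\<Sum>v\<in>{0..<int p}. \<Sum>w\<in>{0..<int p}. K v w)"
proof -
  let ?R = "{0..<int p}" and ?U = "{0<..<int p}"
  let ?H = "\<lambda>Q u x y. G Q u ((x\<^sup>2 - Q * y\<^sup>2 + u * y) mod int p)"
  have "(\<Sum>Q\<in>?R. \<Sum>y\<in>?R. \<Sum>x\<in>?R. \<Sum>u\<in>?U. ?H Q u x y) = (\<Sum>u\<in>?U. \<Sum>Q\<in>?R. \<Sum>y\<in>?R. \<Sum>x\<in>?R. ?H Q u x y)"
    by (rule sum_swap4[symmetric])
  also have "\<dots> = (\<Sum>u\<in>?U. \<Sum>v\<in>?R. \<Sum>y\<in>?R. \<Sum>x\<in>?R. ?H ((u * v) mod int p) u x y)"
  proof (rule sum.cong[OF refl])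
    fix u assume "u \<in> ?U"
    from sum_affine_mod[OF p_pos coprime_prime_unit[OF p this], of "\<lambda>Q. \<Sum>y\<in>?R. \<Sum>x\<in>?R. ?H Q u x y" 0]
    show "(\<Sum>Q\<in>?R. \<Sum>y\<in>?R. \<Sum>x\<in>?R. ?H Q u x y) = (\<Sum>v\<in>?R. \<Sum>y\<in>?R. \<Sum>x\<in>?R. ?H ((u * v) mod int p) u x y)"
      by simp
  qed
  also have "\<dots> = (\<Sum>v\<in>?R. \<Sum>y\<in>?R. \<Sum>x\<in>?R. \<Sum>u\<in>?U. ?H ((u * v) mod int p) u x y)"
    by (rule sum_swap4)
  also have "\<dots> = (\<Sum>v\<in>?R. \<Sum>y\<in>?R. \<Sum>x\<in>?R. \<Sum>u\<in>?U. G ((u * v) mod int p) u ((x\<^sup>2 + u * (y - v * y\<^sup>2)) mod int p))"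
  proof (intro sum.cong refl)
    fix v y x u
    have "[(u * v) mod int p = u * v] (mod int p)" by (simp add: cong_def)
    hence "[x\<^sup>2 - ((u * v) mod int p) * y\<^sup>2 + u * y = x\<^sup>2 - (u * v) * y\<^sup>2 + u * y] (mod int p)"
      by (intro cong_add cong_diff cong_mult cong_refl)
    moreover have "x\<^sup>2 - (u * v) * y\<^sup>2 + u * y = x\<^sup>2 + u * (y - v * y\<^sup>2)" by (simp add: algebra_simps)
    ultimately show "?H ((u * v) mod int p) u x y = G ((u * v) mod int p) u ((x\<^sup>2 + u * (y - v * y\<^sup>2)) mod int p)"
      by (simp only: cong_def)
  qed
  also have "\<dots> = (\<Sum>v\<in>?R. \<Sum>y\<in>?R. (real p - 1) * (\<Sum>w\<in>?R. K v w))"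
    by (intro sum.cong refl sum_conic)
  also have "\<dots> = real p * (real p - 1) * (\<Sum>v\<in>?R. \<Sum>w\<in>?R. K v w)"
    by (simp add: sum_distrib_left mult.assoc)
  finally show ?thesis .
qed

text \<open>For fixed \<open>a\<close> and \<open>c \<noteq> 0\<close> substitute \<open>c' = c y\<close> and \<open>a' = x + a y\<close>. Then \<open>u\<close> is affine in \<open>b'\<close>
  and \<open>Q\<close> is affine in \<open>b\<close>, both with leading coefficient \<open>c\<close>, and \<open>R = x\<^sup>2 - Q y\<^sup>2 + u y\<close>; so
  \<open>Q\<close>, \<open>u\<close>, \<open>x\<close> and \<open>y\<close> can serve as independent variables.\<close>

theorem sum_gram_invariants:
  "(\<Sum>a\<in>{0..<int p}. \<Sum>c\<in>{0<..<int p}. \<Sum>b\<in>{0..<int p}. \<Sum>c'\<in>{0..<int p}. \<Sum>a'\<in>{0..<int p}. \<Sum>b'\<in>{0..<int p}.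
     G ((a\<^sup>2 + b * c) mod int p) ((2 * a * a' + b * c' + c * b') mod int p) ((a'\<^sup>2 + b' * c') mod int p))
   = real p ^ 2 * (real p - 1) ^ 2 * (\<Sum>v\<in>{0..<int p}. \<Sum>w\<in>{0..<int p}. K v w)"
proof -
  let ?R = "{0..<int p}" and ?U = "{0<..<int p}"
  let ?X = "\<lambda>a c b c' a' b'. G ((a\<^sup>2 + b * c) mod int p) ((2 * a * a' + b * c' + c * b') mod int p) ((a'\<^sup>2 + b' * c') mod int p)"
  let ?H = "\<lambda>Q y x u. G Q u ((x\<^sup>2 - Q * y\<^sup>2 + u * y) mod int p)"
  have inner: "(\<Sum>b\<in>?R. \<Sum>c'\<in>?R. \<Sum>a'\<in>?R. \<Sum>b'\<in>?R. ?X a c b c' a' b') = real p * (real p - 1) * (\<Sum>v\<in>?R. \<Sum>w\<in>?R. K v w)"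
    if c: "c \<in> ?U" for a c
  proof -
    note cop = coprime_prime_unit[OF p c]
    have "(\<Sum>b\<in>?R. \<Sum>c'\<in>?R. \<Sum>a'\<in>?R. \<Sum>b'\<in>?R. ?X a c b c' a' b') =
      (\<Sum>b\<in>?R. \<Sum>y\<in>?R. \<Sum>a'\<in>?R. \<Sum>b'\<in>?R. ?X a c b ((c * y) mod int p) a' b')"
    proof (rule sum.cong[OF refl])
      fix b
      from sum_affine_mod[OF p_pos cop, of "\<lambda>c'. \<Sum>a'\<in>?R. \<Sum>b'\<in>?R. ?X a c b c' a' b'" 0]
      show "(\<Sum>c'\<in>?R. \<Sum>a'\<in>?R. \<Sum>b'\<in>?R. ?X a c b c' a' b') = (\<Sum>y\<in>?R. \<Sum>a'\<in>?R. \<Sum>b'\<in>?R. ?X a c b ((c * y) mod int p) a' b')"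
        by simp
    qed
    also have "\<dots> = (\<Sum>b\<in>?R. \<Sum>y\<in>?R. \<Sum>x\<in>?R. \<Sum>b'\<in>?R. ?X a c b ((c * y) mod int p) ((x + a * y) mod int p) b')"
    proof (rule sum.cong[OF refl], rule sum.cong[OF refl])
      fix b y
      from sum_affine_mod[OF p_pos coprime_1_left, of "\<lambda>a'. \<Sum>b'\<in>?R. ?X a c b ((c * y) mod int p) a' b'" "a * y"]
      show "(\<Sum>a'\<in>?R. \<Sum>b'\<in>?R. ?X a c b ((c * y) mod int p) a' b') = (\<Sum>x\<in>?R. \<Sum>b'\<in>?R. ?X a c b ((c * y) mod int p) ((x + a * y) mod int p) b')"
        by simp
    qed
    also have "\<dots> = (\<Sum>b\<in>?R. \<Sum>y\<in>?R. \<Sum>x\<in>?R. \<Sum>u\<in>?R. ?H ((a\<^sup>2 + b * c) mod int p) y x u)"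
    proof (rule sum.cong[OF refl], rule sum.cong[OF refl], rule sum.cong[OF refl])
      fix b y x
      define c' where "c' = (c * y) mod int p"
      define a' where "a' = (x + a * y) mod int p"
      define Q where "Q = (a\<^sup>2 + b * c) mod int p"
      define d where "d = 2 * a * a' + b * c'"
      have cc: "[c' = c * y] (mod int p)" "[a' = x + a * y] (mod int p)" "[Q = a\<^sup>2 + b * c] (mod int p)"
        by (simp_all add: c'_def a'_def Q_def cong_def)
      have "?X a c b c' a' b' = ?H Q y x ((c * b' + d) mod int p)" for b'
      proof -
        define u where "u = (c * b' + d) mod int p"
        have u: "(2 * a * a' + b * c' + c * b') mod int p = u" by (simp add: u_def d_def add.commute add.left_commute)
        have "[u = c * b' + d] (mod int p)" by (simp add: u_def cong_def)
        also have "[c * b' + d = c * b' + (2 * a * (x + a * y) + b * (c * y))] (mod int p)"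
          unfolding d_def using cc by (intro cong_add cong_mult cong_refl)
        finally have cu: "[u = c * b' + (2 * a * (x + a * y) + b * (c * y))] (mod int p)" .
        have "[x\<^sup>2 - Q * y\<^sup>2 + u * y = x\<^sup>2 - (a\<^sup>2 + b * c) * y\<^sup>2 + (c * b' + (2 * a * (x + a * y) + b * (c * y))) * y] (mod int p)"
          using cc(3) cu by (intro cong_add cong_diff cong_mult cong_refl)
        moreover have "x\<^sup>2 - (a\<^sup>2 + b * c) * y\<^sup>2 + (c * b' + (2 * a * (x + a * y) + b * (c * y))) * y = (x + a * y)\<^sup>2 + b' * (c * y)"
          by (simp add: power2_eq_square algebra_simps)
        moreover have "[a'\<^sup>2 + b' * c' = (x + a * y)\<^sup>2 + b' * (c * y)] (mod int p)"
          using cc by (intro cong_add cong_mult cong_pow cong_refl)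
        ultimately have "(a'\<^sup>2 + b' * c') mod int p = (x\<^sup>2 - Q * y\<^sup>2 + u * y) mod int p" by (simp add: cong_def)
        thus ?thesis unfolding u_def[symmetric] Q_def[symmetric] u by simp
      qed
      hence "(\<Sum>b'\<in>?R. ?X a c b c' a' b') = (\<Sum>b'\<in>?R. ?H Q y x ((c * b' + d) mod int p))" by simp
      also have "\<dots> = (\<Sum>u\<in>?R. ?H Q y x u)" by (rule sum_affine_mod[OF p_pos cop])
      finally show "(\<Sum>b'\<in>?R. ?X a c b ((c * y) mod int p) ((x + a * y) mod int p) b') = (\<Sum>u\<in>?R. ?H ((a\<^sup>2 + b * c) mod int p) y x u)"
        by (simp only: c'_def a'_def Q_def)
    qed
    also have "\<dots> = (\<Sum>b\<in>?R. \<Sum>y\<in>?R. \<Sum>x\<in>?R. \<Sum>u\<in>?R. ?H ((c * b + a\<^sup>2) mod int p) y x u)"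
      by (simp only: add.commute mult.commute)
    also have "\<dots> = (\<Sum>Q\<in>?R. \<Sum>y\<in>?R. \<Sum>x\<in>?R. \<Sum>u\<in>?R. ?H Q y x u)"
      by (rule sum_affine_mod[OF p_pos cop])
    also have "\<dots> = (\<Sum>Q\<in>?R. \<Sum>y\<in>?R. \<Sum>x\<in>?R. \<Sum>u\<in>?U. ?H Q y x u)"
      by (intro sum.cong refl sum.mono_neutral_right) (auto simp: zero residues_split)
    also have "\<dots> = real p * (real p - 1) * (\<Sum>v\<in>?R. \<Sum>w\<in>?R. K v w)" by (rule sum_normal_form)
    finally show ?thesis .
  qed
  have "(\<Sum>a\<in>?R. \<Sum>c\<in>?U. \<Sum>b\<in>?R. \<Sum>c'\<in>?R. \<Sum>a'\<in>?R. \<Sum>b'\<in>?R. ?X a c b c' a' b') = (\<Sum>a\<in>?R. \<Sum>c\<in>?U. real p * (real p - 1) * (\<Sum>v\<in>?R. \<Sum>w\<in>?R. K v w))"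
    by (intro sum.cong refl inner)
  also have "\<dots> = real p * (real p - 1) * (real p * (real p - 1) * (\<Sum>v\<in>?R. \<Sum>w\<in>?R. K v w))"
    using p_pos by simp
  finally show ?thesis by (simp add: power2_eq_square mult.assoc mult.left_commute)
qed

end

definition sl2_mat :: "nat \<Rightarrow> int \<Rightarrow> int \<Rightarrow> int \<Rightarrow> mat2" where
  "sl2_mat p a b c = vector [vector [a, b], vector [c, (- a) mod int p]]"

lemma sl2_mat_entries [simp]:
  "sl2_mat p a b c $ 1 $ 1 = a" "sl2_mat p a b c $ 1 $ 2 = b" "sl2_mat p a b c $ 2 $ 1 = c"
  "sl2_mat p a b c $ 2 $ 2 = (- a) mod int p"
  by (simp_all add: sl2_mat_def)

lemma mat2_eq_iff: "(X::mat2) = Y \<longleftrightarrow> X $ 1 $ 1 = Y $ 1 $ 1 \<and> X $ 1 $ 2 = Y $ 1 $ 2 \<and> X $ 2 $ 1 = Y $ 2 $ 1 \<and> X $ 2 $ 2 = Y $ 2 $ 2"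
  by (auto simp: vec_eq_iff forall_2)

lemma bij_betw_sl2_mat:
  assumes p: "p > 0"
  shows "bij_betw (\<lambda>(a,c,b). sl2_mat p a b c) ({0..<int p} \<times> {0..<int p} \<times> {0..<int p}) (sl2 p)"
proof (rule bij_betwI[where g = "\<lambda>X. (X $ 1 $ 1, X $ 2 $ 1, X $ 1 $ 2)"])
  show "(\<lambda>(a,c,b). sl2_mat p a b c) \<in> {0..<int p} \<times> {0..<int p} \<times> {0..<int p} \<rightarrow> sl2 p"
    using p by (auto simp: sl2_def forall_2 trace_def sum_2 cong_def mod_simps)
  show "(\<lambda>X. (X $ 1 $ 1, X $ 2 $ 1, X $ 1 $ 2)) \<in> sl2 p \<rightarrow> {0..<int p} \<times> {0..<int p} \<times> {0..<int p}"
    by (auto simp: sl2_def)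
  fix X assume X: "X \<in> sl2 p"
  have r: "X $ 2 $ 2 \<in> {0..<int p}" using X by (simp add: sl2_def)
  have "[X $ 1 $ 1 + X $ 2 $ 2 = 0] (mod int p)" using X by (simp add: sl2_def trace_def sum_2)
  hence "[- X $ 1 $ 1 + (X $ 1 $ 1 + X $ 2 $ 2) = - X $ 1 $ 1 + 0] (mod int p)" by (intro cong_add cong_refl)
  hence "X $ 2 $ 2 mod int p = (- X $ 1 $ 1) mod int p" by (simp add: cong_def)
  hence "X $ 2 $ 2 = (- X $ 1 $ 1) mod int p" using r by simp
  thus "(case (X $ 1 $ 1, X $ 2 $ 1, X $ 1 $ 2) of (a, c, b) \<Rightarrow> sl2_mat p a b c) = X"
    by (simp add: mat2_eq_iff)
qed auto

lemma sum_sl2: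
  fixes f :: "mat2 \<Rightarrow> real"
  assumes "p > 0"
  shows "(\<Sum>X\<in>sl2 p. f X) = (\<Sum>a\<in>{0..<int p}. \<Sum>c\<in>{0..<int p}. \<Sum>b\<in>{0..<int p}. f (sl2_mat p a b c))"
proof -
  have "(\<Sum>X\<in>sl2 p. f X) = (\<Sum>(a,c,b)\<in>{0..<int p} \<times> {0..<int p} \<times> {0..<int p}. f (sl2_mat p a b c))"
    using sum.reindex_bij_betw[OF bij_betw_sl2_mat[OF assms], of f] by (simp add: case_prod_unfold)
  also have "\<dots> = (\<Sum>a\<in>{0..<int p}. \<Sum>(c,b)\<in>{0..<int p} \<times> {0..<int p}. f (sl2_mat p a b c))"
    by (simp add: sum.cartesian_product)
  also have "\<dots> = (\<Sum>a\<in>{0..<int p}. \<Sum>c\<in>{0..<int p}. \<Sum>b\<in>{0..<int p}. f (sl2_mat p a b c))"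
    by (simp add: sum.cartesian_product)
  finally show ?thesis .
qed

lemma card_sl2: "p > 0 \<Longrightarrow> finite (sl2 p) \<and> card (sl2 p) = p ^ 3"
proof -
  assume p: "p > 0"
  note b = bij_betw_sl2_mat[OF this]
  have "finite (sl2 p)" using bij_betw_finite[OF b] by simp
  moreover have "card (sl2 p) = p ^ 3" using bij_betw_same_card[OF b] by (simp add: power3_eq_cube)
  ultimately show ?thesis by blast
qed

lemma trace_mult_sl2_mat:
  "[trace (sl2_mat p a b c ** sl2_mat p a' b' c') = 2 * a * a' + b * c' + c * b'] (mod int p)"
proof -
  have "trace (sl2_mat p a b c ** sl2_mat p a' b' c') = a * a' + b * c' + (c * b' + ((- a) mod int p) * ((- a') mod int p))"
    by (simp add: trace_def sum_2 matrix_matrix_mult_def)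
  also have "[\<dots> = a * a' + b * c' + (c * b' + (- a) * (- a'))] (mod int p)"
    by (intro cong_add cong_mult cong_refl) (simp_all add: cong_def)
  also have "a * a' + b * c' + (c * b' + (- a) * (- a')) = 2 * a * a' + b * c' + c * b'" by (simp add: algebra_simps)
  finally show ?thesis .
qed

lemma gram_sl2_mat:
  fixes p :: nat and a b c a' b' c' :: int
  defines "A \<equiv> sl2_mat p a b c" and "B \<equiv> sl2_mat p a' b' c'"
  shows "alpha p A B = (2 * ((2 * a * a' + b * c' + c * b') mod int p)) mod int p"
    and "beta p A B = (4 * ((a\<^sup>2 + b * c) mod int p)) mod int p"
    and "gamma p A B = (4 * ((a'\<^sup>2 + b' * c') mod int p)) mod int p"
proof -
  have t: "(2 * trace (sl2_mat p a b c ** sl2_mat p a' b' c')) mod int p = (2 * (2 * a * a' + b * c' + c * b')) mod int p" for a b c a' b' c'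
    using cong_scalar_left[OF trace_mult_sl2_mat, of 2] by (simp add: cong_def)
  show "alpha p A B = (2 * ((2 * a * a' + b * c' + c * b') mod int p)) mod int p"
    unfolding alpha_def A_def B_def t by (simp add: mod_simps)
  have e: "2 * (2 * a * a + b * c + c * b) = 4 * (a\<^sup>2 + b * c)" for a b c :: int
    by (simp add: power2_eq_square algebra_simps)
  show "beta p A B = (4 * ((a\<^sup>2 + b * c) mod int p)) mod int p"
    unfolding beta_def A_def B_def t e by (simp add: mod_simps)
  show "gamma p A B = (4 * ((a'\<^sup>2 + b' * c') mod int p)) mod int p"
    unfolding gamma_def A_def B_def t e by (simp add: mod_simps)
qed

text \<open>The difference of the two sides is a quadratic form in the entries of the bracket.\<close>

lemma commuting_imp_degenerate:
  assumes "bracket p (sl2_mat p a b c) (sl2_mat p a' b' c') = 0"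
  shows "[(2 * a * a' + b * c' + c * b')\<^sup>2 = 4 * (a\<^sup>2 + b * c) * (a'\<^sup>2 + b' * c')] (mod int p)"
proof -
  let ?A = "sl2_mat p a b c" and ?B = "sl2_mat p a' b' c'"
  have z: "(?A ** ?B - ?B ** ?A) $ i $ j mod int p = 0" for i j
    using arg_cong[OF assms, of "\<lambda>M. M $ i $ j"] by (simp add: bracket_def map_matrix_def)
  have n: "[(- a) mod int p = - a] (mod int p)" "[(- a') mod int p = - a'] (mod int p)" by (simp_all add: cong_def)
  have 11: "[b * c' - b' * c = 0] (mod int p)"
    using z[of 1 1] by (simp add: matrix_matrix_mult_def sum_2 cong_def algebra_simps)
  have 12: "[2 * (a * b' - a' * b) = 0] (mod int p)"
  proof -
    have "(?A ** ?B - ?B ** ?A) $ 1 $ 2 = a * b' + b * ((- a') mod int p) - (a' * b + b' * ((- a) mod int p))"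
      by (simp add: matrix_matrix_mult_def sum_2)
    also have "[\<dots> = a * b' + b * (- a') - (a' * b + b' * (- a))] (mod int p)"
      using n by (intro cong_add cong_diff cong_mult cong_refl)
    also have "a * b' + b * (- a') - (a' * b + b' * (- a)) = 2 * (a * b' - a' * b)" by (simp add: algebra_simps)
    finally show ?thesis using z[of 1 2] by (simp add: cong_def)
  qed
  have 21: "[2 * (a * c' - a' * c) = 0] (mod int p)"
  proof -
    have "(?A ** ?B - ?B ** ?A) $ 2 $ 1 = c * a' + ((- a) mod int p) * c' - (c' * a + ((- a') mod int p) * c)"
      by (simp add: matrix_matrix_mult_def sum_2)
    also have "[\<dots> = c * a' + (- a) * c' - (c' * a + (- a') * c)] (mod int p)"
      using n by (intro cong_add cong_diff cong_mult cong_refl)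
    also have "c * a' + (- a) * c' - (c' * a + (- a') * c) = - (2 * (a * c' - a' * c))" by (simp add: algebra_simps)
    finally have "[- (2 * (a * c' - a' * c)) = 0] (mod int p)" using z[of 2 1] by (simp add: cong_def)
    thus ?thesis by (simp only: cong_0_iff dvd_minus_iff)
  qed
  have "(2 * a * a' + b * c' + c * b')\<^sup>2 - 4 * (a\<^sup>2 + b * c) * (a'\<^sup>2 + b' * c')
     = (b * c' - b' * c)\<^sup>2 - (2 * (a * b' - a' * b)) * (2 * (a * c' - a' * c))"
    by (simp add: power2_eq_square algebra_simps)
  also have "[\<dots> = 0\<^sup>2 - 0 * 0] (mod int p)" using 11 12 21 by (intro cong_diff cong_mult cong_pow)
  finally show ?thesis by (simp add: cong_diff_iff_cong_0)
qed

section \<open>The probability and the choice of primes\<close>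

locale discrete_log =
  fixes p :: nat and lg :: "int \<Rightarrow> int"
  assumes prime: "prime p" and odd: "odd p" and log: "is_log p lg"
begin

lemma p_gt_2: "p > 2"
  using prime odd prime_gt_1_nat[of p] by (cases "p = 2") auto

lemmas log_bij = is_log_bij_hom(1)[OF prime odd log]
lemmas log_mult = is_log_bij_hom(2)[OF prime odd log]

text \<open>Here \<open>v = \<beta>/\<alpha>\<close> and \<open>w = \<gamma>/\<alpha>\<close>. The flag \<open>T\<close> adds \<open>\<beta> \<gamma> \<noteq> \<alpha>\<^sup>2\<close>, which guarantees a nonzero
  bracket; the event to be measured lies between the two versions.\<close>

definition generic :: "bool \<Rightarrow> int \<Rightarrow> int \<Rightarrow> bool" where
  "generic T v w \<longleftrightarrow> v \<noteq> 0 \<and> w \<noteq> 0 \<and> generates (p - 1) (lg v) (lg w) \<and> (T \<longrightarrow> (v * w) mod int p \<noteq> 1)"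

definition generic_gram :: "bool \<Rightarrow> int \<Rightarrow> int \<Rightarrow> int \<Rightarrow> bool" where
  "generic_gram T \<alpha> \<beta> \<gamma> \<longleftrightarrow> \<alpha> \<noteq> 0 \<and> \<beta> \<noteq> 0 \<and> \<gamma> \<noteq> 0 \<and>
     generates (p - 1) (lg \<alpha> - lg \<beta>) (lg \<alpha> - lg \<gamma>) \<and> (T \<longrightarrow> (\<beta> * \<gamma>) mod int p \<noteq> (\<alpha> * \<alpha>) mod int p)"

lemma generates_log_quotient:
  assumes "\<alpha> \<in> {0<..<int p}" "v \<in> {0<..<int p}" "w \<in> {0<..<int p}"
  shows "generates (p - 1) (lg \<alpha> - lg ((\<alpha> * v) mod int p)) (lg \<alpha> - lg ((\<alpha> * w) mod int p)) \<longleftrightarrow> generates (p - 1) (lg v) (lg w)"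
proof -
  have dv: "int q dvd lg \<alpha> - lg ((\<alpha> * v) mod int p) \<longleftrightarrow> int q dvd lg v"
    if "q \<in> prime_factors (p - 1)" "v \<in> {0<..<int p}" for q v
  proof -
    have "q dvd p - 1" using that by auto
    hence q: "int q dvd int (p - 1)" by (simp only: int_dvd_int_iff)
    have "lg ((\<alpha> * v) mod int p) = (lg \<alpha> + lg v) mod int (p - 1)" using assms(1) that(2) by (rule log_mult)
    hence "[lg ((\<alpha> * v) mod int p) = lg \<alpha> + lg v] (mod int (p - 1))" by (simp add: cong_def)
    hence "[lg ((\<alpha> * v) mod int p) = lg \<alpha> + lg v] (mod int q)" using q by (rule cong_dvd_modulus)
    hence "[lg \<alpha> - lg ((\<alpha> * v) mod int p) = lg \<alpha> - (lg \<alpha> + lg v)] (mod int q)" by (intro cong_diff cong_refl)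
    hence "int q dvd lg \<alpha> - lg ((\<alpha> * v) mod int p) \<longleftrightarrow> int q dvd lg \<alpha> - (lg \<alpha> + lg v)" by (rule cong_dvd_iff)
    thus ?thesis by simp
  qed
  show ?thesis unfolding generates_def using dv assms by auto
qed

lemma generic_gram_scale:
  assumes \<alpha>: "\<alpha> \<in> {0<..<int p}" and v: "v \<in> {0..<int p}" and w: "w \<in> {0..<int p}"
  shows "generic_gram T \<alpha> ((\<alpha> * v) mod int p) ((\<alpha> * w) mod int p) \<longleftrightarrow> generic T v w"
proof (cases "v = 0 \<or> w = 0")
  case True thus ?thesis by (auto simp: generic_gram_def generic_def)
next
  case False
  hence v': "v \<in> {0<..<int p}" and w': "w \<in> {0<..<int p}" using v w by auto
  have nz: "(\<alpha> * v) mod int p \<noteq> 0" "(\<alpha> * w) mod int p \<noteq> 0" "\<alpha> \<noteq> 0" "v \<noteq> 0" "w \<noteq> 0"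
    using mult_mod_prime_unit[OF prime \<alpha> v'] mult_mod_prime_unit[OF prime \<alpha> w'] \<alpha> v' w' by auto
  have cop: "coprime (\<alpha> * \<alpha>) (int p)" using coprime_prime_unit[OF prime \<alpha>] by simp
  have "(((\<alpha> * v) mod int p) * ((\<alpha> * w) mod int p)) mod int p = (\<alpha> * v * (\<alpha> * w)) mod int p" by (rule mod_mult_eq)
  also have "\<alpha> * v * (\<alpha> * w) = (\<alpha> * \<alpha>) * (v * w)" by simp
  finally have "(((\<alpha> * v) mod int p) * ((\<alpha> * w) mod int p)) mod int p = (\<alpha> * \<alpha>) mod int p \<longleftrightarrow>
      [(\<alpha> * \<alpha>) * (v * w) = (\<alpha> * \<alpha>) * 1] (mod int p)" by (simp add: cong_def)
  also have "\<dots> \<longleftrightarrow> [v * w = 1] (mod int p)" using cop by (rule cong_mult_lcancel)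
  also have "\<dots> \<longleftrightarrow> (v * w) mod int p = 1" using p_gt_2 by (simp add: cong_def)
  finally show ?thesis
    using nz generates_log_quotient[OF \<alpha> v' w'] by (simp add: generic_gram_def generic_def)
qed

definition gram_weight :: "bool \<Rightarrow> int \<Rightarrow> int \<Rightarrow> int \<Rightarrow> real" where
  "gram_weight T Q u R = of_bool (generic_gram T ((2 * u) mod int p) ((4 * Q) mod int p) ((4 * R) mod int p))"

definition ratio_weight :: "bool \<Rightarrow> int \<Rightarrow> int \<Rightarrow> real" where
  "ratio_weight T v w = of_bool (generic T ((2 * v) mod int p) ((2 * w) mod int p))"

text \<open>All three of \<open>\<alpha>\<close>, \<open>\<beta>\<close>, \<open>\<gamma>\<close> scale by the same factor, and the logarithm turns the factor
  into a common summand.\<close>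

lemma homogeneous_gram_weight: "homogeneous_weight p (gram_weight T) (ratio_weight T)"
proof
  show "prime p" by (rule prime)
  show "gram_weight T Q 0 R = 0" for Q R by (simp add: gram_weight_def generic_gram_def)
  fix u v w assume u: "u \<in> {0<..<int p}"
  define \<alpha> where "\<alpha> = (2 * u) mod int p"
  have \<alpha>: "\<alpha> \<in> {0<..<int p}" unfolding \<alpha>_def using p_gt_2 by (intro mult_mod_prime_unit[OF prime _ u]) auto
  have e: "(4 * ((u * v) mod int p)) mod int p = (\<alpha> * ((2 * (v mod int p)) mod int p)) mod int p" for v
  proof -
    have "(4 * ((u * v) mod int p)) mod int p = (4 * (u * v)) mod int p" by (rule mod_mult_right_eq)
    also have "4 * (u * v) = (2 * u) * (2 * v)" by simp
    also have "((2 * u) * (2 * v)) mod int p = (\<alpha> * ((2 * (v mod int p)) mod int p)) mod int p"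
      unfolding \<alpha>_def by (simp add: mod_simps)
    finally show ?thesis .
  qed
  show "gram_weight T ((u * v) mod int p) u ((u * w) mod int p) = ratio_weight T (v mod int p) (w mod int p)"
    unfolding gram_weight_def ratio_weight_def e \<alpha>_def[symmetric]
    using p_gt_2 by (subst generic_gram_scale[OF \<alpha>]) auto
qed

lemma sum_ratio_weight:
  "(\<Sum>v\<in>{0..<int p}. \<Sum>w\<in>{0..<int p}. ratio_weight T v w) = (\<Sum>v\<in>{0..<int p}. \<Sum>w\<in>{0..<int p}. of_bool (generic T v w))"
proof -
  have p0: "p > 0" using p_gt_2 by simp
  have cop: "coprime 2 (int p)" using p_gt_2 by (intro coprime_prime_unit[OF prime]) auto
  have "(\<Sum>v\<in>{0..<int p}. \<Sum>w\<in>{0..<int p}. ratio_weight T v w) = (\<Sum>v\<in>{0..<int p}. \<Sum>w\<in>{0..<int p}. of_bool (generic T ((2 * v) mod int p) w))"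
  proof (rule sum.cong[OF refl])
    fix v
    show "(\<Sum>w\<in>{0..<int p}. ratio_weight T v w) = (\<Sum>w\<in>{0..<int p}. of_bool (generic T ((2 * v) mod int p) w))"
      using sum_affine_mod[OF p0 cop, of "\<lambda>w. of_bool (generic T ((2 * v) mod int p) w)" 0] by (simp add: ratio_weight_def)
  qed
  also have "\<dots> = (\<Sum>v\<in>{0..<int p}. \<Sum>w\<in>{0..<int p}. of_bool (generic T v w))"
    using sum_affine_mod[OF p0 cop, of "\<lambda>v. \<Sum>w\<in>{0..<int p}. of_bool (generic T v w)" 0] by simp
  finally show ?thesis .
qed

text \<open>The logarithm carries pairs of nonzero residues to pairs in \<open>\<int>/(p-1)\<close>.\<close>

lemma sum_generic_False:
  "(\<Sum>v\<in>{0..<int p}. \<Sum>w\<in>{0..<int p}. of_bool (generic False v w)) = (real p - 1)\<^sup>2 * sieve_factor (prime_factors (p - 1))"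
proof -
  let ?R = "{0..<int p}" and ?U = "{0<..<int p}" and ?N = "{0..<int (p - 1)}"
  have "(\<Sum>v\<in>?R. \<Sum>w\<in>?R. of_bool (generic False v w)) = (\<Sum>v\<in>?U. \<Sum>w\<in>?R. of_bool (generic False v w) :: real)"
  proof (rule sum.mono_neutral_right)
    show "\<forall>v\<in>?R - ?U. (\<Sum>w\<in>?R. of_bool (generic False v w)) = (0::real)"
    proof
      fix v assume "v \<in> ?R - ?U"
      hence "v = 0" by auto
      thus "(\<Sum>w\<in>?R. of_bool (generic False v w)) = (0::real)" by (simp add: generic_def)
    qed
  qed auto
  also have "\<dots> = (\<Sum>v\<in>?U. \<Sum>w\<in>?U. of_bool (generates (p - 1) (lg v) (lg w)))"
  proof (rule sum.cong[OF refl])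
    fix v assume v: "v \<in> ?U"
    have "(\<Sum>w\<in>?R. of_bool (generic False v w)) = (\<Sum>w\<in>?U. of_bool (generic False v w) :: real)"
      by (rule sum.mono_neutral_right) (auto simp: generic_def)
    also have "\<dots> = (\<Sum>w\<in>?U. of_bool (generates (p - 1) (lg v) (lg w)))"
      using v by (intro sum.cong refl) (auto simp: generic_def)
    finally show "(\<Sum>w\<in>?R. of_bool (generic False v w)) = (\<Sum>w\<in>?U. of_bool (generates (p - 1) (lg v) (lg w)) :: real)" .
  qed
  also have "\<dots> = (\<Sum>v\<in>?U. \<Sum>j\<in>?N. of_bool (generates (p - 1) (lg v) j))"
  proof (rule sum.cong[OF refl])
    fix v show "(\<Sum>w\<in>?U. of_bool (generates (p - 1) (lg v) (lg w))) = (\<Sum>j\<in>?N. of_bool (generates (p - 1) (lg v) j) :: real)"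
      by (rule sum.reindex_bij_betw[OF log_bij, of "\<lambda>j. of_bool (generates (p - 1) (lg v) j)"])
  qed
  also have "\<dots> = (\<Sum>i\<in>?N. \<Sum>j\<in>?N. of_bool (generates (p - 1) i j))"
    by (rule sum.reindex_bij_betw[OF log_bij, of "\<lambda>i. \<Sum>j\<in>?N. of_bool (generates (p - 1) i j)"])
  also have "\<dots> = (\<Sum>(i,j)\<in>?N \<times> ?N. of_bool (generates (p - 1) i j))"
    by (rule sum.cartesian_product)
  also have "\<dots> = (\<Sum>x\<in>?N \<times> ?N. if (case x of (i,j) \<Rightarrow> generates (p - 1) i j) then 1 else 0)"
    by (intro sum.cong refl) auto
  also have "\<dots> = real (card {x \<in> ?N \<times> ?N. case x of (i,j) \<Rightarrow> generates (p - 1) i j})"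
    by (subst sum.inter_filter[symmetric]) auto
  also have "{x \<in> ?N \<times> ?N. case x of (i,j) \<Rightarrow> generates (p - 1) i j} = {(i,j). i \<in> ?N \<and> j \<in> ?N \<and> generates (p - 1) i j}"
    by auto
  also have "real (card \<dots>) = real (p - 1) ^ 2 * sieve_factor (prime_factors (p - 1))"
    using p_gt_2 by (intro card_generates) simp
  also have "real (p - 1) = real p - 1" using p_gt_2 by (simp add: of_nat_diff)
  finally show ?thesis .
qed

text \<open>The flag excludes the pairs with \<open>v w = 1\<close>, one for each \<open>v \<noteq> 0\<close>.\<close>

lemma sum_generic_True:
  "(real p - 1)\<^sup>2 * sieve_factor (prime_factors (p - 1)) - (real p - 1)
    \<le> (\<Sum>v\<in>{0..<int p}. \<Sum>w\<in>{0..<int p}. of_bool (generic True v w))"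
proof -
  let ?R = "{0..<int p}" and ?U = "{0<..<int p}"
  have p0: "p > 0" using p_gt_2 by simp
  have "(\<Sum>v\<in>?R. \<Sum>w\<in>?R. of_bool (generic False v w))
     \<le> (\<Sum>v\<in>?R. \<Sum>w\<in>?R. of_bool (generic True v w) + of_bool (v \<noteq> 0 \<and> (v * w) mod int p = 1) :: real)"
    by (intro sum_mono) (auto simp: generic_def)
  also have "\<dots> = (\<Sum>v\<in>?R. \<Sum>w\<in>?R. of_bool (generic True v w)) + (\<Sum>v\<in>?R. \<Sum>w\<in>?R. of_bool (v \<noteq> 0 \<and> (v * w) mod int p = 1))"
    by (simp add: sum.distrib)
  also have "(\<Sum>v\<in>?R. \<Sum>w\<in>?R. of_bool (v \<noteq> 0 \<and> (v * w) mod int p = 1)) = (\<Sum>v\<in>?U. \<Sum>w\<in>?R. of_bool ((v * w) mod int p = 1) :: real)"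
  proof -
    have "(\<Sum>v\<in>?R. \<Sum>w\<in>?R. of_bool (v \<noteq> 0 \<and> (v * w) mod int p = 1)) = (\<Sum>v\<in>?U. \<Sum>w\<in>?R. of_bool (v \<noteq> 0 \<and> (v * w) mod int p = 1) :: real)"
      by (rule sum.mono_neutral_right) auto
    thus ?thesis by simp
  qed
  also have "\<dots> = (\<Sum>v\<in>?U. 1)"
  proof (rule sum.cong[OF refl])
    fix v assume v: "v \<in> ?U"
    have "(\<Sum>w\<in>?R. of_bool ((v * w) mod int p = 1)) = (\<Sum>w\<in>?R. of_bool (w = 1) :: real)"
      using sum_affine_mod[OF p0 coprime_prime_unit[OF prime v], of "\<lambda>w. of_bool (w = 1)" 0] by simp
    also have "\<dots> = (\<Sum>w\<in>?R. if w = 1 then 1 else 0)" by (intro sum.cong refl) simp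
    also have "\<dots> = 1" using p_gt_2 by simp
    finally show "(\<Sum>w\<in>?R. of_bool ((v * w) mod int p = 1)) = (1::real)" .
  qed
  also have "\<dots> = real p - 1" using p_gt_2 by (simp add: of_nat_diff)
  finally show ?thesis by (simp only: sum_generic_False)
qed

lemma limit_uniform_generic_gram:
  fixes a b c a' b' c' :: int
  defines "A \<equiv> sl2_mat p a b c" and "B \<equiv> sl2_mat p a' b' c'"
  shows "limit_uniform p lg k A B \<longrightarrow> generic_gram False (alpha p A B) (beta p A B) (gamma p A B)"
    and "generic_gram True (alpha p A B) (beta p A B) (gamma p A B) \<longrightarrow> limit_uniform p lg k A B"
proof -
  have r: "alpha p A B mod int p = alpha p A B" "beta p A B mod int p = beta p A B" "gamma p A B mod int p = gamma p A B"
    by (simp_all add: alpha_def beta_def gamma_def)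
  have pr: "prime (int p)" using prime by simp
  have d: "int p dvd alpha p A B \<longleftrightarrow> alpha p A B = 0" "int p dvd beta p A B \<longleftrightarrow> beta p A B = 0"
    "int p dvd gamma p A B \<longleftrightarrow> gamma p A B = 0" by (simp_all only: dvd_eq_mod_eq_0 r)
  have nz: "[alpha p A B * beta p A B * gamma p A B = 0] (mod int p) \<longleftrightarrow> alpha p A B = 0 \<or> beta p A B = 0 \<or> gamma p A B = 0"
    by (simp add: cong_0_iff prime_dvd_mult_iff[OF pr] d)
  note iff = limit_uniform_iff[OF prime odd log, of k A B, unfolded nz]
  show "limit_uniform p lg k A B \<longrightarrow> generic_gram False (alpha p A B) (beta p A B) (gamma p A B)"
    unfolding iff generic_gram_def by simp
  have "bracket p A B \<noteq> 0" if "generic_gram True (alpha p A B) (beta p A B) (gamma p A B)"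
  proof
    assume "bracket p A B = 0"
    hence "[(2 * a * a' + b * c' + c * b')\<^sup>2 = 4 * (a\<^sup>2 + b * c) * (a'\<^sup>2 + b' * c')] (mod int p)"
      unfolding A_def B_def by (rule commuting_imp_degenerate)
    hence "[4 * (2 * a * a' + b * c' + c * b')\<^sup>2 = 4 * (4 * (a\<^sup>2 + b * c) * (a'\<^sup>2 + b' * c'))] (mod int p)"
      by (intro cong_mult cong_refl)
    moreover have cong: "[alpha p A B = 2 * (2 * a * a' + b * c' + c * b')] (mod int p)"
      "[beta p A B = 4 * (a\<^sup>2 + b * c)] (mod int p)" "[gamma p A B = 4 * (a'\<^sup>2 + b' * c')] (mod int p)"
      unfolding A_def B_def gram_sl2_mat by (simp_all add: cong_def mod_simps)
    have "[alpha p A B * alpha p A B = (2 * (2 * a * a' + b * c' + c * b')) * (2 * (2 * a * a' + b * c' + c * b'))] (mod int p)"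
      "[beta p A B * gamma p A B = (4 * (a\<^sup>2 + b * c)) * (4 * (a'\<^sup>2 + b' * c'))] (mod int p)"
      by (rule cong_mult[OF cong(1) cong(1)], rule cong_mult[OF cong(2) cong(3)])
    moreover have "(2 * (2 * a * a' + b * c' + c * b')) * (2 * (2 * a * a' + b * c' + c * b')) = 4 * (2 * a * a' + b * c' + c * b')\<^sup>2"
      "(4 * (a\<^sup>2 + b * c)) * (4 * (a'\<^sup>2 + b' * c')) = 4 * (4 * (a\<^sup>2 + b * c) * (a'\<^sup>2 + b' * c'))"
      by (simp_all only: power2_eq_square)
    ultimately have "(beta p A B * gamma p A B) mod int p = (alpha p A B * alpha p A B) mod int p" by (simp only: cong_def)
    thus False using that by (simp add: generic_gram_def)
  qed
  thus "generic_gram True (alpha p A B) (beta p A B) (gamma p A B) \<longrightarrow> limit_uniform p lg k A B"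
    unfolding iff by (auto simp: generic_gram_def)
qed

text \<open>Pairs with \<open>c = 0\<close> have probability \<open>1/p\<close>; on the others the event is squeezed between
  the two versions of \<open>generic_gram\<close>, which \<open>sum_gram_invariants\<close> counts.\<close>

lemma prob_limit_uniform_approx:
  "\<bar>prob_limit_uniform p lg k - sieve_factor (prime_factors (p - 1))\<bar> \<le> 5 / real p"
proof -
  let ?R = "{0..<int p}" and ?U = "{0<..<int p}"
  let ?m = "sl2_mat p"
  define dens where "dens = sieve_factor (prime_factors (p - 1))"
  have dens: "0 < dens" "dens \<le> 1" unfolding dens_def by (auto intro!: sieve_factor_bounds)
  have p0: "p > 0" using p_gt_2 by simp
  define f where "f A B = (of_bool (limit_uniform p lg k A B) :: real)" for A B
  have S: "finite (sl2 p)" "card (sl2 p) = p ^ 3" using card_sl2[OF p0] by auto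
  have ne: "sl2 p \<times> sl2 p \<noteq> {}" using S p0 by (metis Sigma_empty1 card.empty card_cartesian_product mult_eq_0_iff power_eq_0_iff less_irrefl)
  define N where "N = (\<Sum>A\<in>sl2 p. \<Sum>B\<in>sl2 p. f A B)"
  have "real (card ((sl2 p \<times> sl2 p) \<inter> {(A, B). limit_uniform p lg k A B})) = (\<Sum>x\<in>sl2 p \<times> sl2 p. if x \<in> {(A, B). limit_uniform p lg k A B} then 1 else 0)"
    using S by (subst sum.inter_restrict[symmetric]) auto
  also have "\<dots> = (\<Sum>(A,B)\<in>sl2 p \<times> sl2 p. f A B)" by (intro sum.cong refl) (auto simp: f_def)
  also have "\<dots> = N" by (simp add: N_def sum.cartesian_product)
  finally have "prob_limit_uniform p lg k = N / real (card (sl2 p \<times> sl2 p))"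
    unfolding prob_limit_uniform_def using ne S by (subst measure_pmf_of_set) auto
  also have "card (sl2 p \<times> sl2 p) = p ^ 6" using S by (simp add: card_cartesian_product power_add[symmetric])
  finally have prob: "prob_limit_uniform p lg k = N / real p ^ 6" by simp
  define g where "g c a = (\<Sum>b\<in>?R. \<Sum>c'\<in>?R. \<Sum>a'\<in>?R. \<Sum>b'\<in>?R. f (?m a b c) (?m a' b' c'))" for c a
  have "N = (\<Sum>a\<in>?R. \<Sum>c\<in>?R. \<Sum>b\<in>?R. \<Sum>a'\<in>?R. \<Sum>c'\<in>?R. \<Sum>b'\<in>?R. f (?m a b c) (?m a' b' c'))"
    unfolding N_def by (simp only: sum_sl2[OF p0])
  also have "\<dots> = (\<Sum>a\<in>?R. \<Sum>c\<in>?R. g c a)"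
    unfolding g_def by (rule sum.cong[OF refl], rule sum.cong[OF refl], rule sum.cong[OF refl], rule sum.swap)
  also have "\<dots> = (\<Sum>a\<in>?R. g 0 a + (\<Sum>c\<in>?U. g c a))"
  proof (rule sum.cong[OF refl])
    fix a
    have "?R = insert 0 ?U" using p0 by auto
    thus "(\<Sum>c\<in>?R. g c a) = g 0 a + (\<Sum>c\<in>?U. g c a)" by simp
  qed
  also have "\<dots> = (\<Sum>a\<in>?R. g 0 a) + (\<Sum>a\<in>?R. \<Sum>c\<in>?U. g c a)" by (rule sum.distrib)
  finally have N: "N = (\<Sum>a\<in>?R. g 0 a) + (\<Sum>a\<in>?R. \<Sum>c\<in>?U. g c a)" .
  have z1: "0 \<le> (\<Sum>a\<in>?R. g 0 a)" unfolding g_def f_def by (intro sum_nonneg) auto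
  have "(\<Sum>a\<in>?R. g 0 a) \<le> (\<Sum>a\<in>?R. \<Sum>b\<in>?R. \<Sum>c'\<in>?R. \<Sum>a'\<in>?R. \<Sum>b'\<in>?R. 1)"
    unfolding g_def f_def by (intro sum_mono) auto
  also have "\<dots> = real p ^ 5" by (simp add: power_numeral_reduce)
  finally have z2: "(\<Sum>a\<in>?R. g 0 a) \<le> real p ^ 5" .
  define h where "h T = (\<Sum>a\<in>?R. \<Sum>c\<in>?U. \<Sum>b\<in>?R. \<Sum>c'\<in>?R. \<Sum>a'\<in>?R. \<Sum>b'\<in>?R.
     gram_weight T ((a\<^sup>2 + b * c) mod int p) ((2 * a * a' + b * c' + c * b') mod int p) ((a'\<^sup>2 + b' * c') mod int p))" for T
  have h: "h T = real p ^ 2 * (real p - 1) ^ 2 * (\<Sum>v\<in>?R. \<Sum>w\<in>?R. of_bool (generic T v w))" for T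
    unfolding h_def homogeneous_weight.sum_gram_invariants[OF homogeneous_gram_weight] sum_ratio_weight ..
  have up: "(\<Sum>a\<in>?R. \<Sum>c\<in>?U. g c a) \<le> h False"
    unfolding g_def h_def gram_weight_def f_def
  proof (intro sum_mono)
    fix a c b c' a' b'
    show "of_bool (limit_uniform p lg k (?m a b c) (?m a' b' c')) \<le> (of_bool (generic_gram False ((2 * ((2 * a * a' + b * c' + c * b') mod int p)) mod int p)
        ((4 * ((a\<^sup>2 + b * c) mod int p)) mod int p) ((4 * ((a'\<^sup>2 + b' * c') mod int p)) mod int p)) :: real)"
      unfolding gram_sl2_mat[of p a b c a' b' c', symmetric]
      using limit_uniform_generic_gram(1)[of k a b c a' b' c'] by auto
  qed
  have lo: "h True \<le> (\<Sum>a\<in>?R. \<Sum>c\<in>?U. g c a)"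
    unfolding g_def h_def gram_weight_def f_def
  proof (intro sum_mono)
    fix a c b c' a' b'
    show "(of_bool (generic_gram True ((2 * ((2 * a * a' + b * c' + c * b') mod int p)) mod int p)
        ((4 * ((a\<^sup>2 + b * c) mod int p)) mod int p) ((4 * ((a'\<^sup>2 + b' * c') mod int p)) mod int p)) :: real) \<le> of_bool (limit_uniform p lg k (?m a b c) (?m a' b' c'))"
      unfolding gram_sl2_mat[of p a b c a' b' c', symmetric]
      using limit_uniform_generic_gram(2)[of a b c a' b' c' k] by auto
  qed
  define x where "x = real p"
  have x: "x > 2" using p_gt_2 by (simp add: x_def)
  have Nup: "N \<le> x ^ 2 * (x - 1) ^ 2 * ((x - 1) ^ 2 * dens) + x ^ 5"
    using N z2 up h[of False] unfolding sum_generic_False dens_def[symmetric] x_def by linarith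
  have "x ^ 2 * (x - 1) ^ 2 * ((x - 1) ^ 2 * dens - (x - 1)) \<le> h True"
    unfolding h x_def dens_def using sum_generic_True by (intro mult_left_mono) auto
  hence Nlo: "x ^ 2 * (x - 1) ^ 2 * ((x - 1) ^ 2 * dens - (x - 1)) \<le> N"
    using N z1 lo by linarith
  \<comment> \<open>Dividing by \<open>p\<^sup>6\<close> leaves the factor \<open>r\<^sup>4\<close>, which is at least \<open>1 - 4/p\<close>; the pairs
    with \<open>c = 0\<close> or \<open>v w = 1\<close> cost at most another \<open>1/p\<close> on either side.\<close>
  define r where "r = 1 - 1 / x"
  have r: "0 \<le> r" "r \<le> 1" "x - 1 = x * r" using x by (auto simp: r_def field_simps)
  have "N / x ^ 6 \<le> dens + 1 / x"
  proof -
    have "N \<le> x ^ 6 * (r ^ 4 * dens) + x ^ 5" using Nup unfolding r(3) by (simp add: power_mult_distrib power_numeral_reduce mult_ac)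
    also have "\<dots> \<le> x ^ 6 * (1 * dens) + x ^ 5" using r dens x by (intro add_right_mono mult_left_mono mult_right_mono power_le_one) auto
    finally have "N / x ^ 6 \<le> (x ^ 6 * dens + x ^ 5) / x ^ 6" using x by (intro divide_right_mono) auto
    also have "\<dots> = dens + 1 / x" using x by (simp add: field_simps power_numeral_reduce)
    finally show ?thesis .
  qed
  moreover have "dens - 5 / x \<le> N / x ^ 6"
  proof -
    have "x ^ 6 * (r ^ 4 * dens) - x ^ 5 * r ^ 3 \<le> N" using Nlo unfolding r(3) by (simp add: power_mult_distrib power_numeral_reduce algebra_simps)
    moreover have "x ^ 5 * r ^ 3 \<le> x ^ 5 * 1" using r x by (intro mult_left_mono power_le_one) auto
    moreover have "x ^ 6 * ((1 - 4 / x) * dens) \<le> x ^ 6 * (r ^ 4 * dens)"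
      using Bernoulli_inequality[of "- 1 / x" 4] x dens by (intro mult_left_mono mult_right_mono) (auto simp: r_def)
    ultimately have "x ^ 6 * ((1 - 4 / x) * dens) - x ^ 5 \<le> N" by linarith
    hence "(x ^ 6 * ((1 - 4 / x) * dens) - x ^ 5) / x ^ 6 \<le> N / x ^ 6" using x by (intro divide_right_mono) auto
    also have "(x ^ 6 * ((1 - 4 / x) * dens) - x ^ 5) / x ^ 6 = (1 - 4 / x) * dens - 1 / x"
      using x by (simp add: diff_divide_distrib power_numeral_reduce)
    also have "(1 - 4 / x) * dens = dens - 4 / x * dens" by (simp add: left_diff_distrib)
    finally have "dens - 4 / x * dens - 1 / x \<le> N / x ^ 6" .
    moreover have "4 / x * dens \<le> 4 / x * 1" using dens x by (intro mult_left_mono) auto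
    moreover have "5 / x = 4 / x + 1 / x" by (simp add: add_divide_distrib[symmetric])
    ultimately show ?thesis by linarith
  qed
  moreover have "1 / x \<le> 5 / x" using x by (simp add: divide_right_mono)
  ultimately have "\<bar>N / x ^ 6 - dens\<bar> \<le> 5 / x" by linarith
  thus ?thesis by (simp only: prob x_def dens_def)
qed

end

text \<open>Thus \<open>sieve_factor F\<close> is at least the tail of the Euler product after \<open>Y\<close>, which tends
  to 1 as \<open>Y\<close> grows, uniformly in \<open>F\<close>.\<close>

lemma sieve_factor_avoiding_small_primes:
  assumes "finite F" "\<And>q. q \<in> F \<Longrightarrow> prime q \<and> Y < q"
  shows "1 / zeta 2 \<le> sieve_factor F * sieve_factor (primes_upto Y)"
proof -
  define X where "X = Max (insert Y F)"
  have X: "q \<le> X" if "q \<in> F" for q using assms(1) that by (simp add: X_def)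
  have "Y \<le> X" using assms(1) by (simp add: X_def)
  have "F \<union> primes_upto Y \<subseteq> primes_upto X"
  proof
    fix q assume "q \<in> F \<union> primes_upto Y"
    thus "q \<in> primes_upto X"
    proof
      assume "q \<in> F" thus ?thesis using X assms(2) by (simp add: primes_upto_def)
    next
      assume "q \<in> primes_upto Y" thus ?thesis using \<open>Y \<le> X\<close> by (simp add: primes_upto_def)
    qed
  qed
  hence "sieve_factor (primes_upto X) \<le> sieve_factor (F \<union> primes_upto Y)"
    by (rule sieve_factor_antimono) (auto simp: primes_upto_prime)
  also have "\<dots> = sieve_factor F * sieve_factor (primes_upto Y)"
  proof (rule sieve_factor_union[OF assms(1)])
    show "F \<inter> primes_upto Y = {}"
    proof (rule equals0I)
      fix q assume "q \<in> F \<inter> primes_upto Y"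
      thus False using assms(2)[of q] by (simp add: primes_upto_def)
    qed
  qed simp
  finally show ?thesis using sieve_factor_primes_lower[of X] by linarith
qed

text \<open>By the Chinese remainder theorem choose \<open>a \<equiv> 1\<close> modulo the primes of \<open>S\<close> and \<open>a \<equiv> -1\<close>
  modulo the others. The latter is different from 1 because \<open>2 \<in> S\<close>.\<close>

lemma residue_class_prescribed_divisors:
  assumes S: "S \<subseteq> primes_upto Y" "2 \<in> S"
  shows "\<exists>a. coprime a (\<Prod>(primes_upto Y)) \<and> (\<forall>p. prime p \<longrightarrow> [p = a] (mod \<Prod>(primes_upto Y)) \<longrightarrow>
     prime_factors (p - 1) \<inter> primes_upto Y = S)"
proof -
  let ?P = "primes_upto Y"
  have cop: "\<forall>i\<in>?P. \<forall>j\<in>?P. i \<noteq> j \<longrightarrow> coprime i j" by (auto simp: primes_upto_def primes_coprime)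
  obtain a where a: "\<forall>q\<in>?P. [a = (if q \<in> S then 1 else q - 1)] (mod q)"
    using chinese_remainder_nat[of ?P "\<lambda>q. q" "\<lambda>q. if q \<in> S then 1 else q - 1"] cop by auto
  have "coprime a q" if q: "q \<in> ?P" for q
  proof -
    have "q > 1" using q primes_upto_prime prime_gt_1_nat by blast
    hence "coprime (if q \<in> S then 1 else q - 1) q" using coprime_diff_one_left_nat[of q] by simp
    moreover have "[(if q \<in> S then 1 else q - 1) = a] (mod q)" using a q by (simp add: cong_sym_eq)
    ultimately show ?thesis by (rule cong_imp_coprime[rotated])
  qed
  hence "coprime a (\<Prod>?P)" by (intro prod_coprime_right) auto
  moreover have "prime_factors (p - 1) \<inter> ?P = S" if p: "prime p" "[p = a] (mod \<Prod>?P)" for p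
  proof -
    have "q \<in> prime_factors (p - 1) \<longleftrightarrow> q \<in> S" if q: "q \<in> ?P" for q
    proof -
      have q': "prime q" using q primes_upto_prime by blast
      have "p > 1" using p prime_gt_1_nat by blast
      have "q dvd \<Prod>?P" using q by (intro dvd_prodI) auto
      hence "[p = a] (mod q)" using p(2) cong_dvd_modulus_nat by blast
      hence pq: "[p = (if q \<in> S then 1 else q - 1)] (mod q)" using a q cong_trans by blast
      have "q \<in> prime_factors (p - 1) \<longleftrightarrow> q dvd p - 1" using q' \<open>p > 1\<close> by (auto simp: prime_factors_dvd)
      also have "\<dots> \<longleftrightarrow> [p = 1] (mod q)" using \<open>p > 1\<close> by (subst cong_altdef_nat) auto
      also have "\<dots> \<longleftrightarrow> [(if q \<in> S then 1 else q - 1) = 1] (mod q)" using pq cong_trans cong_sym by blast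
      also have "\<dots> \<longleftrightarrow> q \<in> S"
      proof (cases "q \<in> S")
        case False
        hence "q \<noteq> 2" using S(2) by auto
        hence "q > 2" using q' prime_ge_2_nat[of q] by linarith
        thus ?thesis using False by (simp add: cong_def)
      qed simp
      finally show ?thesis .
    qed
    thus ?thesis using S(1) by blast
  qed
  ultimately show ?thesis by blast
qed

theorem theorem1p2:
  fixes s t :: real
  assumes "s < t"
    and "{s<..<t} \<subseteq> {1 / zeta 2..2 / 3} \<union> {9 / (8 * zeta 2)..3 / 4}"
  shows "\<exists>Z \<subseteq> {p. prime p \<and> odd p}. 0 < lower_density Z \<and>
           (\<forall>p\<in>Z. \<forall>lg. is_log p lg \<longrightarrow> (\<forall>k. prob_limit_uniform p lg k \<in> {s<..<t}))"
proof -
  define x where "x = (s + t) / 2"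
  \<comment> \<open>The midpoint \<open>x\<close> is approximated in three steps with error at most \<open>e\<close> each: by
    a product over small primes, by the product over the prime factors of \<open>p - 1\<close>,
    and by the probability. The distance from \<open>x\<close> to the ends of the interval is
    \<open>4 e\<close>.\<close>
  define e where "e = (t - s) / 8"
  have e: "e > 0" using assms(1) by (simp add: e_def)
  have x: "x \<in> {1 / zeta 2..2 / 3} \<union> {9 / (8 * zeta 2)..3 / 4}"
    using assms by (intro subsetD[OF assms(2)]) (simp add: x_def)
  have "(\<lambda>Y. 1 / zeta 2 / sieve_factor (primes_upto Y)) \<longlonglongrightarrow> 1 / zeta 2 / (1 / zeta 2)"
    using zeta_2_pos by (intro tendsto_intros sieve_factor_primes_tendsto) auto
  hence "(\<lambda>Y. 1 / zeta 2 / sieve_factor (primes_upto Y)) \<longlonglongrightarrow> 1" using zeta_2_pos by simp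
  hence "\<forall>\<^sub>F Y in sequentially. 1 - e < 1 / zeta 2 / sieve_factor (primes_upto Y)"
    by (rule order_tendstoD) (use e in simp)
  from eventually_happens'[OF sequentially_bot eventually_conj[OF this sieve_factor_dense[OF x e]]]
  obtain Y S where Y: "1 - e < 1 / zeta 2 / sieve_factor (primes_upto Y)"
    and S: "S \<subseteq> primes_upto Y" "2 \<in> S" "\<bar>sieve_factor S - x\<bar> < e" by blast
  obtain a where a: "coprime a (\<Prod>(primes_upto Y))"
    "\<And>p. prime p \<Longrightarrow> [p = a] (mod \<Prod>(primes_upto Y)) \<Longrightarrow> prime_factors (p - 1) \<inter> primes_upto Y = S"
    using residue_class_prescribed_divisors[OF S(1,2)] by blast
  define p0 where "p0 = max 3 (nat \<lceil>5 / e\<rceil>)"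
  define Z where "Z = {p. prime p \<and> p0 \<le> p \<and> [p = a] (mod \<Prod>(primes_upto Y))}"
  have "Z \<subseteq> {p. prime p \<and> odd p}"
  proof
    fix p assume "p \<in> Z"
    hence "prime p" "p \<noteq> 2" by (auto simp: Z_def p0_def)
    thus "p \<in> {p. prime p \<and> odd p}" using prime_odd_nat[of p] prime_ge_2_nat[of p] by simp
  qed
  moreover have "0 < lower_density Z" unfolding Z_def
    by (rule lower_density_class_pos[OF finite_primes_upto primes_upto_prime refl a(1)])
  moreover have "prob_limit_uniform p lg k \<in> {s<..<t}" if p: "p \<in> Z" and lg: "is_log p lg" for p lg k
  proof -
    have pr: "prime p" "odd p" using p calculation(1) by auto
    interpret discrete_log p lg using pr lg by unfold_locales
    have "5 / e \<le> real p" using p unfolding Z_def p0_def by simp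
    hence err: "5 / real p \<le> e" using e p_gt_2 by (simp add: field_simps)
    define F where "F = prime_factors (p - 1) - primes_upto Y"
    have SF: "prime_factors (p - 1) = S \<union> F" using a(2)[of p] p by (auto simp: F_def Z_def)
    have finS: "finite S" using S(1) by (rule finite_subset) simp
    have F: "finite F" "\<And>q. q \<in> F \<Longrightarrow> prime q \<and> Y < q"
      by (auto simp: F_def primes_upto_def)
    have S1: "0 < sieve_factor S" "sieve_factor S \<le> 1" using S(1) by (auto intro!: sieve_factor_bounds simp: primes_upto_def)
    have F1: "sieve_factor F \<le> 1" using F by (intro sieve_factor_bounds) auto
    have P0: "0 < sieve_factor (primes_upto Y)" by (intro sieve_factor_bounds) (rule primes_upto_prime)
    have "1 / zeta 2 / sieve_factor (primes_upto Y) \<le> sieve_factor F"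
      using sieve_factor_avoiding_small_primes[OF F] by (simp only: pos_divide_le_eq[OF P0])
    hence F2: "1 - e \<le> sieve_factor F" using Y by linarith
    have prod: "sieve_factor (prime_factors (p - 1)) = sieve_factor S * sieve_factor F"
      unfolding SF using S(1) finS F(1) by (intro sieve_factor_union) (auto simp: F_def)
    have "sieve_factor S * sieve_factor F \<le> sieve_factor S * 1" using S1 F1 by (intro mult_left_mono) auto
    moreover have "sieve_factor S * (1 - e) \<le> sieve_factor S * sieve_factor F" using S1 F2 by (intro mult_left_mono) auto
    moreover have "sieve_factor S * e \<le> 1 * e" using S1 e by (intro mult_right_mono) auto
    ultimately have "\<bar>sieve_factor (prime_factors (p - 1)) - sieve_factor S\<bar> \<le> e"
      unfolding prod by (simp add: right_diff_distrib abs_le_iff)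
    hence "\<bar>prob_limit_uniform p lg k - x\<bar> < 3 * e"
      using prob_limit_uniform_approx[of k] err S(3) by linarith
    moreover have "s = x - 4 * e" "t = x + 4 * e" by (simp_all add: x_def e_def field_simps)
    ultimately show ?thesis using e by (simp add: abs_less_iff)
  qed
  ultimately show ?thesis by blast
qed

end
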